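(* Let $(Z_n)_{n\ge0}$ be a Galton--Watson process with $Z_0=1$ and offspring distribution $F$ on $\{0,1,2,\dots\}$ with mean $m:=\mathbb E\xi>1$, and let $W_n:=Z_n/m^n$ and $W:=\lim_{n\to\infty}W_n$ (almost sure limit). Assume $\mathbb E\xi\log\xi<\infty$ and that $\overline F(x)$ is regularly varying with index $-1$. Then, uniformly in $n\ge1$, $$\Pr\{W_n>x\}\sim\sum_{i=0}^{n-1}m^i\overline F(m^{i+1}x)\sim\frac{1}{m\log m}\,x^{-1}\int_x^{m^nx}\overline F(u)\,du\quad\text{as }x\to\infty,$$ and $$\Pr\{W>x\}\sim\sum_{i=0}^{\infty}m^i\overline F(m^{i+1}x)\sim\frac{1}{m\log m}\,x^{-1}\int_x^{\infty}\overline F(u)\,du\quad\text{as }x\to\infty.$$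
   Context: The process is defined by $Z_{n+1}=\sum_{i=1}^{Z_n}\xi_i^{(n)}$, where $\xi_i^{(n)}$, $i\ge1$, $n\ge0$, are i.i.d. copies of a random variable $\xi$ with distribution $F$ on $\{0,1,2,\dots\}$; $\overline F(x):=\Pr\{\xi>x\}$ for real $x$. $f(x)\sim g(x)$ means $f(x)/g(x)\to1$. $\overline F$ regularly varying with index $-1$ means $\overline F(tx)/\overline F(x)\to t^{-1}$ as $x\to\infty$ for every $t>0$. *)

theory Defs
  imports "HOL-Probability.Probability" "HOL-Library.Landau_Symbols"
begin

definition Fbar :: "nat pmf \<Rightarrow> real \<Rightarrow> real" where
  "Fbar F x = measure_pmf.prob F {k. real k > x}"

definition offspring_mean :: "nat pmf \<Rightarrow> real" where
  "offspring_mean F = measure_pmf.expectation F real"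

fun GW :: "(nat \<Rightarrow> nat \<Rightarrow> 'a \<Rightarrow> nat) \<Rightarrow> nat \<Rightarrow> 'a \<Rightarrow> nat" where
  "GW xi 0 \<omega> = 1"
| "GW xi (Suc n) \<omega> = (\<Sum>i=1..GW xi n \<omega>. xi i n \<omega>)"

definition GW_Wn :: "real \<Rightarrow> (nat \<Rightarrow> nat \<Rightarrow> 'a \<Rightarrow> nat) \<Rightarrow> nat \<Rightarrow> 'a \<Rightarrow> real" where
  "GW_Wn m xi n \<omega> = real (GW xi n \<omega>) / m ^ n"

definition GW_W :: "real \<Rightarrow> (nat \<Rightarrow> nat \<Rightarrow> 'a \<Rightarrow> nat) \<Rightarrow> 'a \<Rightarrow> real" where
  "GW_W m xi \<omega> = lim (\<lambda>n. GW_Wn m xi n \<omega>)"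

definition regularly_varying_neg1 :: "(real \<Rightarrow> real) \<Rightarrow> bool" where
  "regularly_varying_neg1 G \<longleftrightarrow>
     (\<forall>t>0. ((\<lambda>x. G (t * x) / G x) \<longlongrightarrow> 1 / t) at_top)"

definition unif_asymp_equiv :: "(nat \<Rightarrow> real \<Rightarrow> real) \<Rightarrow> (nat \<Rightarrow> real \<Rightarrow> real) \<Rightarrow> bool" where
  "unif_asymp_equiv f g \<longleftrightarrow>
     (\<forall>e>0. eventually (\<lambda>x. \<forall>n\<ge>1. \<bar>f n x - g n x\<bar> \<le> e * \<bar>g n x\<bar>) at_top)"

end

(* A large value of W_n is caused by one individual with about m^(i+1) x children in some generation i;
   E xi log xi < infinity makes the increments W_(n+1) - W_n summable in L^1, hence W_n uniformly
   integrable and almost surely convergent, and gives a law of large numbers for sums of copies of W_r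
   that is uniform in r.

   Lower bound: conditioning on the first generation, q_n(x) = P(W_n > x) satisfies
   q_(n+1)(x) >= (1 - delta) Fbar((1 + epsilon) m x) + m (1 - loss) q_n(m x), with losses that are summable
   along x, m x, m^2 x, ...  Iterating yields the sum of m^i Fbar(m^(i+1) x).

   Upper bound: truncate the offspring of generation i at c m^(i+1) x.  By Karamata the truncated process
   has second moment of order 1 + c x^2 sum_i m^i Fbar(m^(i+1) x), so Chebyshev's inequality makes its
   contribution negligible for small c.  When one family exceeds the truncation level but stays below
   (1 - 2 epsilon) m^(i+1) x, the weak law makes W_n > x unlikely. *)
theory Submission
  imports Defs
begin

section \<open>Sums of independent copies and Galton--Watson laws\<close>

text \<open>With index -1 the offspring variance is infinite, so second moments are available only
  after truncation. Moreover the ratio of neighbouring summands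
  \<open>m ^ i * Fbar F (m ^ (i + 1) * x)\<close> tends to 1 as \<open>x\<close> grows: no
  generation dominates, and every error has to be small relative to each summand, uniformly in the
  generation and in \<open>n\<close>.

  Two facts supply this uniformity. All levels \<open>m ^ (i + 1) * x\<close> are at least
  \<open>x\<close>, so a bound on \<open>Fbar F (t * y) / Fbar F y\<close> for one fixed
  \<open>t\<close>, valid beyond some threshold, serves all generations at once. And the constants
  taken from the laws of the normalised generation sizes all come from one summable bound on the L^1
  increments, so they do not depend on the generation.

  The estimates live on discrete laws and use nonnegative extended integrals, which have no
  integrability side conditions. The probability space enters through the joint law of two
  consecutive generations, which transports the estimates and yields almost sure convergence. A
  possible atom of the limit is bypassed by comparing two levels \<open>x < y\<close> whose ratio is
  then absorbed by regular variation.\<close>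

fun sum_iid_pmf :: "nat pmf \<Rightarrow> nat \<Rightarrow> nat pmf" where
  "sum_iid_pmf p 0 = return_pmf 0"
| "sum_iid_pmf p (Suc k) = bind_pmf p (\<lambda>a. map_pmf ((+) a) (sum_iid_pmf p k))"

text \<open>The recursion splits at the root, whose children start independent copies running
  \<open>n\<close> steps; the lower bound conditions in this way. \<open>gw_pmf_Suc_last\<close>
  gives the form that follows \<open>GW\<close>.\<close>

fun gw_pmf :: "nat pmf \<Rightarrow> nat \<Rightarrow> nat pmf" where
  "gw_pmf p 0 = return_pmf 1"
| "gw_pmf p (Suc n) = bind_pmf p (sum_iid_pmf (gw_pmf p n))"

text \<open>Values above \<open>y\<close> become 0 rather than \<open>y\<close>. Then a value is its
  truncation plus its part on \<open>{y<..}\<close>, and the loss in the mean is exactly the tail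
  mean.\<close>

definition trunc_pmf :: "real \<Rightarrow> nat pmf \<Rightarrow> nat pmf" where
  "trunc_pmf y p = map_pmf (\<lambda>k. if real k \<le> y then k else 0) p"

lemma sum_iid_pmf_add:
  "sum_iid_pmf p (a + b) = bind_pmf (sum_iid_pmf p a) (\<lambda>s. map_pmf ((+) s) (sum_iid_pmf p b))"
proof (induction a)
  case 0
  then show ?case by (simp add: bind_return_pmf map_pmf_idI)
next
  case (Suc a)
  have [simp]: "(+) (x + y) = (\<lambda>z. x + (y + z))" for x y :: nat
    by (simp add: fun_eq_iff)
  show ?case
    by (simp add: Suc map_bind_pmf bind_map_pmf bind_assoc_pmf pmf.map_comp o_def add.assoc)
qed

text \<open>Branching property: the grandchildren of \<open>k\<close> individuals, grouped by
  grandparent, form \<open>k\<close> independent compound sums. The induction rests on drawing the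
  children of the first family and the sizes of the other families in either order.\<close>

lemma bind_sum_iid_pmf:
  "bind_pmf (sum_iid_pmf p k) (sum_iid_pmf q) = sum_iid_pmf (bind_pmf p (sum_iid_pmf q)) k"
proof (induction k)
  case 0
  then show ?case by (simp add: bind_return_pmf)
next
  case (Suc k)
  have "bind_pmf (sum_iid_pmf p (Suc k)) (sum_iid_pmf q) =
    bind_pmf p (\<lambda>a. bind_pmf (sum_iid_pmf p k) (\<lambda>s. bind_pmf (sum_iid_pmf q a) (\<lambda>u. map_pmf ((+) u) (sum_iid_pmf q s))))"
    by (simp add: bind_assoc_pmf bind_map_pmf sum_iid_pmf_add)
  also have "\<dots> = bind_pmf p (\<lambda>a. bind_pmf (sum_iid_pmf q a) (\<lambda>u. bind_pmf (sum_iid_pmf p k) (\<lambda>s. map_pmf ((+) u) (sum_iid_pmf q s))))"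
    by (subst bind_commute_pmf) simp
  also have "\<dots> = sum_iid_pmf (bind_pmf p (sum_iid_pmf q)) (Suc k)"
    by (simp add: bind_assoc_pmf map_bind_pmf flip: Suc)
  finally show ?case .
qed

text \<open>Expanding the subtrees of the root at their last generation and regrouping with
  \<open>bind_sum_iid_pmf\<close> moves the last step to the outside.\<close>

lemma gw_pmf_Suc_last: "gw_pmf p (Suc n) = bind_pmf (gw_pmf p n) (sum_iid_pmf p)"
proof (induction n)
  case 0
  have "sum_iid_pmf (return_pmf 1) k = return_pmf k" for k
    by (induction k) (simp_all add: bind_return_pmf)
  then have "sum_iid_pmf (return_pmf 1) = return_pmf" by blast
  moreover have "sum_iid_pmf p 1 = p"
    by (simp add: bind_return_pmf')
  ultimately show ?case by (simp add: bind_return_pmf bind_return_pmf')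
next
  case (Suc n)
  have "gw_pmf p (Suc (Suc n)) = bind_pmf p (sum_iid_pmf (bind_pmf (gw_pmf p n) (sum_iid_pmf p)))"
    unfolding Suc[symmetric] by simp
  also have "\<dots> = bind_pmf (gw_pmf p (Suc n)) (sum_iid_pmf p)"
    by (simp add: bind_assoc_pmf bind_sum_iid_pmf)
  finally show ?case .
qed

section \<open>Moments of sums of independent copies and the cost of truncation\<close>

lemma nn_integral_sum_iid_Suc:
  "(\<integral>\<^sup>+s. f s \<partial>sum_iid_pmf p (Suc k)) = (\<integral>\<^sup>+a. \<integral>\<^sup>+s. f (a + s) \<partial>sum_iid_pmf p k \<partial>p)"
  by simp

lemma nn_integral_pmf_swap:
  "(\<integral>\<^sup>+a. \<integral>\<^sup>+b. f a b \<partial>measure_pmf q \<partial>measure_pmf p) = (\<integral>\<^sup>+b. \<integral>\<^sup>+a. f a b \<partial>measure_pmf p \<partial>measure_pmf q)"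
  using nn_integral_pair_pmf'[of p q "case_prod f"] nn_integral_pair_pmf'[of q p "\<lambda>(b, a). f a b"]
    arg_cong[OF pair_commute_pmf[of p q], of "\<lambda>r. \<integral>\<^sup>+x. case_prod f x \<partial>measure_pmf r"]
  by (simp add: case_prod_beta)

lemma nn_integral_trunc_pmf:
  "(\<integral>\<^sup>+s. f s \<partial>trunc_pmf y p) = (\<integral>\<^sup>+a. f (if real a \<le> y then a else 0) \<partial>p)"
  by (simp add: trunc_pmf_def)

lemma nn_integral_sum_iid_mean:
  fixes p :: "nat pmf"
  assumes "(\<integral>\<^sup>+a. ennreal (real a) \<partial>p) = ennreal \<mu>" "0 \<le> \<mu>"
  shows "(\<integral>\<^sup>+s. ennreal (real s) \<partial>sum_iid_pmf p k) = ennreal (real k * \<mu>)"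
proof (induction k)
  case (Suc k)
  have "(\<integral>\<^sup>+s. ennreal (real s) \<partial>sum_iid_pmf p (Suc k)) =
    (\<integral>\<^sup>+a. \<integral>\<^sup>+s. ennreal (real a) + ennreal (real s) \<partial>sum_iid_pmf p k \<partial>p)"
    by (simp add: ennreal_plus)
  also have "\<dots> = ennreal \<mu> + ennreal (real k * \<mu>)"
    by (simp add: nn_integral_add Suc assms)
  finally show ?case using assms by (simp add: algebra_simps flip: ennreal_plus)
qed simp

text \<open>In the induction the cross term contributes \<open>2 * real k * \<mu>\<^sup>2\<close>,
  at most the growth of \<open>(real k)\<^sup>2 * \<mu>\<^sup>2\<close>. With this slack the
  variance below is bounded through the raw second moment \<open>v\<close>.\<close>

lemma nn_integral_sum_iid_square:
  fixes p :: "nat pmf"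
  assumes "(\<integral>\<^sup>+a. ennreal (real a) \<partial>p) = ennreal \<mu>" "0 \<le> \<mu>"
    and "(\<integral>\<^sup>+a. ennreal ((real a)\<^sup>2) \<partial>p) \<le> ennreal v" "0 \<le> v"
  shows "(\<integral>\<^sup>+s. ennreal ((real s)\<^sup>2) \<partial>sum_iid_pmf p k) \<le> ennreal (real k * v + (real k)\<^sup>2 * \<mu>\<^sup>2)"
proof (induction k)
  case (Suc k)
  have "(\<integral>\<^sup>+s. ennreal ((real s)\<^sup>2) \<partial>sum_iid_pmf p (Suc k)) =
    (\<integral>\<^sup>+a. \<integral>\<^sup>+s. ennreal ((real a)\<^sup>2) + (ennreal (2 * real a) * ennreal (real s) + ennreal ((real s)\<^sup>2)) \<partial>sum_iid_pmf p k \<partial>p)"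
    by (simp add: power2_sum algebra_simps flip: ennreal_plus ennreal_mult)
  also have "\<dots> = (\<integral>\<^sup>+a. ennreal ((real a)\<^sup>2) + (ennreal (2 * real a) * ennreal (real k * \<mu>) + (\<integral>\<^sup>+s. ennreal ((real s)\<^sup>2) \<partial>sum_iid_pmf p k)) \<partial>p)"
    by (simp add: nn_integral_add nn_integral_cmult nn_integral_sum_iid_mean[OF assms(1,2)])
  also have "\<dots> = (\<integral>\<^sup>+a. ennreal ((real a)\<^sup>2) \<partial>p) + (ennreal (2 * real k * \<mu>) * (\<integral>\<^sup>+a. ennreal (real a) \<partial>p) + (\<integral>\<^sup>+s. ennreal ((real s)\<^sup>2) \<partial>sum_iid_pmf p k))"
    using assms(2) by (simp add: nn_integral_add ennreal_mult mult_ac flip: nn_integral_cmult)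
  also have "\<dots> \<le> ennreal v + (ennreal (2 * real k * \<mu>) * ennreal \<mu> + ennreal (real k * v + (real k)\<^sup>2 * \<mu>\<^sup>2))"
    using assms Suc by (intro add_mono) auto
  also have "\<dots> \<le> ennreal (real (Suc k) * v + (real (Suc k))\<^sup>2 * \<mu>\<^sup>2)"
    using assms by (simp add: algebra_simps power2_eq_square flip: ennreal_plus ennreal_mult)
  finally show ?case .
qed simp

lemma nn_integral_sum_iid_variance:
  fixes p :: "nat pmf"
  assumes "(\<integral>\<^sup>+a. ennreal (real a) \<partial>p) = ennreal \<mu>" "0 \<le> \<mu>"
    and "(\<integral>\<^sup>+a. ennreal ((real a)\<^sup>2) \<partial>p) \<le> ennreal v" "0 \<le> v"
  shows "(\<integral>\<^sup>+s. ennreal ((real s - real k * \<mu>)\<^sup>2) \<partial>sum_iid_pmf p k) \<le> ennreal (real k * v)"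
proof -
  let ?c = "2 * (real k)\<^sup>2 * \<mu>\<^sup>2"
  let ?I = "\<integral>\<^sup>+s. ennreal ((real s - real k * \<mu>)\<^sup>2) \<partial>sum_iid_pmf p k"
  \<comment> \<open>Differences in \<open>ennreal\<close> are awkward, so the cross term of the
    square, whose expectation is \<open>?c\<close>, is added to both sides and cancelled at the
    end.\<close>
  have "?I + ennreal ?c = ?I + ennreal (2 * real k * \<mu>) * (\<integral>\<^sup>+s. ennreal (real s) \<partial>sum_iid_pmf p k)"
    using assms by (simp add: nn_integral_sum_iid_mean[OF assms(1,2)] power2_eq_square mult_ac flip: ennreal_mult)
  also have "\<dots> = (\<integral>\<^sup>+s. ennreal ((real s - real k * \<mu>)\<^sup>2) + ennreal (2 * real k * \<mu>) * ennreal (real s) \<partial>sum_iid_pmf p k)"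
    by (simp add: nn_integral_add nn_integral_cmult)
  also have "\<dots> = (\<integral>\<^sup>+s. ennreal ((real s)\<^sup>2) + ennreal ((real k * \<mu>)\<^sup>2) \<partial>sum_iid_pmf p k)"
  proof (intro nn_integral_cong)
    fix s
    have "(real s - real k * \<mu>)\<^sup>2 + 2 * real k * \<mu> * real s = (real s)\<^sup>2 + (real k * \<mu>)\<^sup>2"
      by (simp add: power2_eq_square algebra_simps)
    then show "ennreal ((real s - real k * \<mu>)\<^sup>2) + ennreal (2 * real k * \<mu>) * ennreal (real s) = ennreal ((real s)\<^sup>2) + ennreal ((real k * \<mu>)\<^sup>2)"
      using assms(2) by (simp flip: ennreal_plus ennreal_mult)
  qed
  also have "\<dots> = (\<integral>\<^sup>+s. ennreal ((real s)\<^sup>2) \<partial>sum_iid_pmf p k) + ennreal ((real k * \<mu>)\<^sup>2)"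
    by (simp add: nn_integral_add)
  also have "\<dots> \<le> ennreal (real k * v + (real k)\<^sup>2 * \<mu>\<^sup>2) + ennreal ((real k * \<mu>)\<^sup>2)"
    using nn_integral_sum_iid_square[OF assms, of k] by (intro add_mono) auto
  also have "\<dots> = ennreal (real k * v) + ennreal ?c"
    using assms by (simp add: power2_eq_square algebra_simps flip: ennreal_plus ennreal_mult)
  finally show ?thesis
    by (simp add: ennreal_add_left_cancel_le add.commute[of _ "ennreal ?c"])
qed

text \<open>Truncating one summand lowers the sum by the part above \<open>A\<close>, and by the
  one-sided Lipschitz condition \<open>f\<close> drops by at most that amount. Each of the
  \<open>k\<close> summands costs at most \<open>\<eta>\<close> in expectation.\<close>

lemma nn_integral_sum_iid_Lipschitz_trunc:
  fixes f :: "nat \<Rightarrow> real" and p :: "nat pmf"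
  assumes "\<And>s. 0 \<le> f s" and "\<And>s d. f (s + d) \<le> f s + real d"
    and "(\<integral>\<^sup>+a. ennreal (real a * indicator {A<..} (real a)) \<partial>p) \<le> ennreal \<eta>" "0 \<le> \<eta>"
  shows "(\<integral>\<^sup>+s. ennreal (f s) \<partial>sum_iid_pmf p k) \<le> (\<integral>\<^sup>+s. ennreal (f s) \<partial>sum_iid_pmf (trunc_pmf A p) k) + ennreal (real k * \<eta>)"
  using assms(1,2)
proof (induction k arbitrary: f)
  case (Suc k)
  let ?t = "\<lambda>a. if real a \<le> A then a else 0 :: nat"
  let ?S = "sum_iid_pmf (trunc_pmf A p) k"
  have 1: "f (a + s) \<le> f (?t a + s) + real a * indicator {A<..} (real a)" for a s
    using Suc.prems(2)[of s a] by (auto simp: add.commute)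
  have "(\<integral>\<^sup>+s. ennreal (f s) \<partial>sum_iid_pmf p (Suc k)) \<le> (\<integral>\<^sup>+a. ((\<integral>\<^sup>+s. ennreal (f (a + s)) \<partial>?S) + ennreal (real k * \<eta>)) \<partial>p)"
    unfolding nn_integral_sum_iid_Suc using Suc.prems(2)[of "_ + _"]
    by (intro nn_integral_mono Suc.IH Suc.prems(1)) (simp add: add.assoc)
  also have "\<dots> \<le> (\<integral>\<^sup>+a. ((\<integral>\<^sup>+s. ennreal (f (?t a + s)) + ennreal (real a * indicator {A<..} (real a)) \<partial>?S) + ennreal (real k * \<eta>)) \<partial>p)"
    using Suc.prems(1) 1
    by (intro nn_integral_mono add_mono order_refl) (simp del: indicator_simps add: ennreal_leI flip: ennreal_plus)
  also have "\<dots> = (\<integral>\<^sup>+s. ennreal (f s) \<partial>sum_iid_pmf (trunc_pmf A p) (Suc k)) + (\<integral>\<^sup>+a. ennreal (real a * indicator {A<..} (real a)) \<partial>p) + ennreal (real k * \<eta>)"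
    unfolding nn_integral_sum_iid_Suc nn_integral_trunc_pmf
    by (simp add: nn_integral_add del: sum_iid_pmf.simps)
  also have "\<dots> \<le> (\<integral>\<^sup>+s. ennreal (f s) \<partial>sum_iid_pmf (trunc_pmf A p) (Suc k)) + ennreal \<eta> + ennreal (real k * \<eta>)"
    using assms(3) by (intro add_mono order_refl)
  also have "\<dots> = (\<integral>\<^sup>+s. ennreal (f s) \<partial>sum_iid_pmf (trunc_pmf A p) (Suc k)) + ennreal (real (Suc k) * \<eta>)"
    using assms(4) by (simp add: algebra_simps flip: ennreal_plus)
  finally show ?case .
qed (simp)

text \<open>An L^1 law of large numbers for a law without variance. Truncation at \<open>A\<close>
  costs \<open>k * \<eta>\<close> for the sum and again \<open>k * \<eta>\<close> for the shift of
  its mean; the truncated law has second moment at most \<open>A * \<mu>\<close>, which gives the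
  rest.\<close>

lemma nn_integral_sum_iid_abs_deviation:
  fixes p :: "nat pmf"
  assumes mean: "(\<integral>\<^sup>+a. ennreal (real a) \<partial>p) = ennreal \<mu>" "0 \<le> \<mu>"
    and tail: "(\<integral>\<^sup>+a. ennreal (real a * indicator {A<..} (real a)) \<partial>p) \<le> ennreal \<eta>" "0 \<le> \<eta>"
    and "0 \<le> A" "0 < \<theta>"
  shows "(\<integral>\<^sup>+s. ennreal \<bar>real s - real k * \<mu>\<bar> \<partial>sum_iid_pmf p k)
    \<le> ennreal (2 * real k * \<eta> + (real k * (A * \<mu>) / \<theta> + \<theta>) / 2)"
proof -
  let ?q = "trunc_pmf A p"
  have split: "(\<integral>\<^sup>+a. ennreal (real a) \<partial>?q) + (\<integral>\<^sup>+a. ennreal (real a * indicator {A<..} (real a)) \<partial>p) = ennreal \<mu>"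
    unfolding nn_integral_trunc_pmf mean(1)[symmetric]
    by (subst nn_integral_add[symmetric]) (auto intro!: nn_integral_cong)
  then have "(\<integral>\<^sup>+a. ennreal (real a) \<partial>?q) \<le> ennreal \<mu>"
    by (metis le_iff_add)
  then obtain \<nu> where \<nu>: "(\<integral>\<^sup>+a. ennreal (real a) \<partial>?q) = ennreal \<nu>" "0 \<le> \<nu>" "\<nu> \<le> \<mu>"
    using mean(2) by (metis ennreal_cases ennreal_le_iff ennreal_less_top infinity_ennreal_def leD)
  have "ennreal \<mu> \<le> ennreal (\<nu> + \<eta>)"
    unfolding split[symmetric] \<nu>(1) using \<nu> tail by (simp add: ennreal_plus)
  then have \<nu>3: "\<mu> \<le> \<nu> + \<eta>" using \<nu> tail by (simp add: ennreal_le_iff del: ennreal_plus)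
  have sq: "(\<integral>\<^sup>+a. ennreal ((real a)\<^sup>2) \<partial>?q) \<le> ennreal (A * \<mu>)"
  proof -
    have "(\<integral>\<^sup>+a. ennreal ((real a)\<^sup>2) \<partial>?q) \<le> (\<integral>\<^sup>+a. ennreal A * ennreal (real a) \<partial>p)"
      unfolding nn_integral_trunc_pmf using \<open>0 \<le> A\<close>
      by (intro nn_integral_mono) (auto simp: power2_eq_square mult_right_mono intro!: ennreal_leI simp flip: ennreal_mult)
    also have "\<dots> = ennreal (A * \<mu>)"
      using \<open>0 \<le> A\<close> mean by (simp add: nn_integral_cmult ennreal_mult)
    finally show ?thesis .
  qed
  let ?S = "sum_iid_pmf ?q k"
  have "(\<integral>\<^sup>+s. ennreal \<bar>real s - real k * \<mu>\<bar> \<partial>sum_iid_pmf p k) \<le> (\<integral>\<^sup>+s. ennreal \<bar>real s - real k * \<mu>\<bar> \<partial>?S) + ennreal (real k * \<eta>)"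
    by (rule nn_integral_sum_iid_Lipschitz_trunc[OF _ _ tail]) auto
  also have "(\<integral>\<^sup>+s. ennreal \<bar>real s - real k * \<mu>\<bar> \<partial>?S) \<le>
     (\<integral>\<^sup>+s. ennreal (1 / (2 * \<theta>)) * ennreal ((real s - real k * \<nu>)\<^sup>2) + ennreal (\<theta> / 2 + real k * \<eta>) \<partial>?S)"
  proof (intro nn_integral_mono)
    fix s
    \<comment> \<open>Young's inequality takes the place of Cauchy-Schwarz; it leaves
      \<open>\<theta>\<close> free, to be balanced in each application.\<close>
    have "0 \<le> (\<bar>real s - real k * \<nu>\<bar> - \<theta>)\<^sup>2" by simp
    then have "\<bar>real s - real k * \<nu>\<bar> \<le> 1 / (2 * \<theta>) * (real s - real k * \<nu>)\<^sup>2 + \<theta> / 2"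
      using \<open>0 < \<theta>\<close> by (simp add: field_simps power2_eq_square abs_mult_self_eq)
    moreover have "\<bar>real k * \<nu> - real k * \<mu>\<bar> \<le> real k * \<eta>"
      using \<nu>(3) \<nu>3 by (simp add: mult_left_mono flip: right_diff_distrib) (simp add: abs_mult mult_left_mono)
    ultimately have "\<bar>real s - real k * \<mu>\<bar> \<le> 1 / (2 * \<theta>) * (real s - real k * \<nu>)\<^sup>2 + (\<theta> / 2 + real k * \<eta>)"
      by linarith
    then show "ennreal \<bar>real s - real k * \<mu>\<bar> \<le> ennreal (1 / (2 * \<theta>)) * ennreal ((real s - real k * \<nu>)\<^sup>2) + ennreal (\<theta> / 2 + real k * \<eta>)"
      using \<open>0 < \<theta>\<close> tail by (simp add: ennreal_leI flip: ennreal_mult ennreal_plus)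
  qed
  also have "\<dots> \<le> ennreal (1 / (2 * \<theta>)) * ennreal (real k * (A * \<mu>)) + ennreal (\<theta> / 2 + real k * \<eta>)"
    using nn_integral_sum_iid_variance[OF \<nu>(1,2) sq, of k] mean \<open>0 \<le> A\<close>
    by (simp add: nn_integral_add nn_integral_cmult mult_left_mono)
  also have "\<dots> + ennreal (real k * \<eta>) = ennreal (2 * real k * \<eta> + (real k * (A * \<mu>) / \<theta> + \<theta>) / 2)"
    using \<open>0 < \<theta>\<close> mean tail \<open>0 \<le> A\<close>
    by (simp add: field_simps flip: ennreal_mult ennreal_plus)
  finally show ?thesis by (simp add: add_right_mono)
qed

text \<open>Either no summand exceeds \<open>y\<close>, and truncation changes nothing, or one of
  the \<open>k\<close> exchangeable summands does. This is a union bound that keeps the size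
  \<open>a\<close> of the large summand and the independent rest, which is what the later
  conditioning needs.\<close>

lemma nn_integral_sum_iid_trunc_le:
  fixes h :: "nat \<Rightarrow> ennreal"
  shows "(\<integral>\<^sup>+s. h s \<partial>sum_iid_pmf p k) \<le> (\<integral>\<^sup>+s. h s \<partial>sum_iid_pmf (trunc_pmf y p) k)
    + of_nat k * (\<integral>\<^sup>+a. indicator {y<..} (real a) * (\<integral>\<^sup>+s. h (a + s) \<partial>sum_iid_pmf p (k - 1)) \<partial>p)"
proof (induction k arbitrary: h)
  case (Suc k)
  let ?t = "\<lambda>a. if real a \<le> y then a else 0 :: nat"
  let ?S = "sum_iid_pmf (trunc_pmf y p) k"
  let ?J = "\<integral>\<^sup>+a. indicator {y<..} (real a) * (\<integral>\<^sup>+s. h (a + s) \<partial>sum_iid_pmf p k) \<partial>p"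
  let ?R = "\<lambda>c. \<integral>\<^sup>+a. indicator {y<..} (real a) * (\<integral>\<^sup>+s. h (c + (a + s)) \<partial>sum_iid_pmf p (k - 1)) \<partial>p"
  \<comment> \<open>Adding the free summand \<open>c\<close> to the other \<open>k - 1\<close> gives
    \<open>k\<close> copies. For \<open>k = 0\<close> the difference \<open>k - 1\<close> is 0 and
    this regrouping fails, but the factor \<open>k\<close> vanishes.\<close>
  have R: "of_nat k * (\<integral>\<^sup>+c. ?R c \<partial>p) = of_nat k * ?J"
  proof (cases k)
    case (Suc l)
    have "(\<integral>\<^sup>+c. ?R c \<partial>p) = (\<integral>\<^sup>+a. \<integral>\<^sup>+c. indicator {y<..} (real a) * (\<integral>\<^sup>+s. h (c + (a + s)) \<partial>sum_iid_pmf p (k - 1)) \<partial>p \<partial>p)"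
      by (rule nn_integral_pmf_swap)
    also have "\<dots> = ?J"
      unfolding Suc nn_integral_sum_iid_Suc by (simp add: nn_integral_cmult add.left_commute)
    finally show ?thesis by simp
  qed simp
  have "(\<integral>\<^sup>+s. h s \<partial>sum_iid_pmf p (Suc k)) \<le> (\<integral>\<^sup>+c. indicator {y<..} (real c) * (\<integral>\<^sup>+s. h (c + s) \<partial>sum_iid_pmf p k) + ((\<integral>\<^sup>+s. h (?t c + s) \<partial>?S) + of_nat k * ?R c) \<partial>p)"
    unfolding nn_integral_sum_iid_Suc
  proof (intro nn_integral_mono)
    fix c
    show "(\<integral>\<^sup>+s. h (c + s) \<partial>sum_iid_pmf p k) \<le> indicator {y<..} (real c) * (\<integral>\<^sup>+s. h (c + s) \<partial>sum_iid_pmf p k) + ((\<integral>\<^sup>+s. h (?t c + s) \<partial>?S) + of_nat k * ?R c)"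
      using Suc[of "\<lambda>s. h (c + s)"] by (cases "real c \<le> y") (auto simp: add_increasing2)
  qed
  also have "\<dots> = (\<integral>\<^sup>+s. h s \<partial>sum_iid_pmf (trunc_pmf y p) (Suc k)) + of_nat (Suc k) * ?J"
    unfolding nn_integral_sum_iid_Suc nn_integral_trunc_pmf
    by (simp add: nn_integral_add nn_integral_cmult R[simplified] algebra_simps del: sum_iid_pmf.simps)
  finally show ?case by simp
qed simp

lemma nn_integral_sum_iid_mono_count:
  assumes "mono h"
  shows "mono (\<lambda>k. \<integral>\<^sup>+s. (h s :: ennreal) \<partial>sum_iid_pmf p k)"
proof (intro mono_iff_le_Suc[THEN iffD2] allI)
  fix k
  have "(\<integral>\<^sup>+s. h s \<partial>sum_iid_pmf p k) = (\<integral>\<^sup>+a. \<integral>\<^sup>+s. h s \<partial>sum_iid_pmf p k \<partial>p)" by simp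
  also have "\<dots> \<le> (\<integral>\<^sup>+a. \<integral>\<^sup>+s. h (a + s) \<partial>sum_iid_pmf p k \<partial>p)"
    by (intro nn_integral_mono monoD[OF assms]) simp
  finally show "(\<integral>\<^sup>+s. h s \<partial>sum_iid_pmf p k) \<le> (\<integral>\<^sup>+s. h s \<partial>sum_iid_pmf p (Suc k))"
    unfolding nn_integral_sum_iid_Suc .
qed

lemma nn_integral_sum_iid_trunc_mono:
  assumes "mono h"
  shows "(\<integral>\<^sup>+s. (h s :: ennreal) \<partial>sum_iid_pmf (trunc_pmf y p) k) \<le> (\<integral>\<^sup>+s. h s \<partial>sum_iid_pmf p k)"
  using assms
proof (induction k arbitrary: h)
  case (Suc k)
  have "(\<integral>\<^sup>+s. h (a + s) \<partial>sum_iid_pmf (trunc_pmf y p) k) \<le> (\<integral>\<^sup>+s. h (b + s) \<partial>sum_iid_pmf p k)" if "a \<le> b" for a b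
  proof -
    have "(\<integral>\<^sup>+s. h (a + s) \<partial>sum_iid_pmf (trunc_pmf y p) k) \<le> (\<integral>\<^sup>+s. h (a + s) \<partial>sum_iid_pmf p k)"
      using Suc.prems by (intro Suc.IH) (auto simp: mono_def)
    also have "\<dots> \<le> (\<integral>\<^sup>+s. h (b + s) \<partial>sum_iid_pmf p k)"
      using that by (intro nn_integral_mono monoD[OF Suc.prems]) simp
    finally show ?thesis .
  qed
  then show ?case
    unfolding nn_integral_sum_iid_Suc nn_integral_trunc_pmf by (intro nn_integral_mono) simp
qed simp

text \<open>A sum of nonnegative terms is at most \<open>y\<close> only if every term is. The lower
  bound uses the complement: one copy above \<open>y\<close> suffices.\<close>

lemma prob_sum_iid_le_power:
  "measure (sum_iid_pmf p k) {s. real s \<le> y} \<le> (1 - measure p {s. real s > y}) ^ k"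
proof (induction k)
  case (Suc k)
  have q: "1 - measure p {s. real s > y} = measure p {s. real s \<le> y}"
    by (subst measure_pmf.prob_compl[symmetric]) (auto intro!: arg_cong[where f="measure p"])
  have "emeasure (sum_iid_pmf p (Suc k)) {s. real s \<le> y} = (\<integral>\<^sup>+a. emeasure (sum_iid_pmf p k) {s. real (a + s) \<le> y} \<partial>p)"
    by (simp add: vimage_def)
  also have "\<dots> \<le> (\<integral>\<^sup>+a. emeasure (sum_iid_pmf p k) {s. real s \<le> y} * indicator {s. real s \<le> y} a \<partial>p)"
    by (intro nn_integral_mono) (auto simp: indicator_def intro!: emeasure_mono)
  also have "\<dots> = emeasure (sum_iid_pmf p k) {s. real s \<le> y} * emeasure p {s. real s \<le> y}"
    by (simp add: nn_integral_cmult)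
  finally have "measure (sum_iid_pmf p (Suc k)) {s. real s \<le> y} \<le> measure (sum_iid_pmf p k) {s. real s \<le> y} * measure p {s. real s \<le> y}"
    by (simp add: measure_pmf.emeasure_eq_measure flip: ennreal_mult)
  also have "\<dots> \<le> (1 - measure p {s. real s > y}) ^ k * measure p {s. real s \<le> y}"
    using Suc by (intro mult_right_mono) auto
  finally show ?case by (simp add: q mult.commute)
qed simp

text \<open>A Bonferroni bound: among \<open>k\<close> independent trials of success probability
  \<open>q\<close>, at least one succeeds with probability at least
  \<open>k * q - (k * q)\<^sup>2\<close>.\<close>

lemma one_minus_power_le:
  fixes q :: real assumes "0 \<le> q" "q \<le> 1"
  shows "(1 - q) ^ k \<le> 1 - real k * q + (real k)\<^sup>2 * q\<^sup>2"
proof (induction k)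
  case (Suc k)
  have "(1 - q) ^ Suc k \<le> (1 - q) * (1 - real k * q + (real k)\<^sup>2 * q\<^sup>2)"
    using Suc assms by (simp add: mult_left_mono)
  also have "\<dots> = 1 - real (Suc k) * q + (real (Suc k))\<^sup>2 * q\<^sup>2 - ((real k)\<^sup>2 * q ^ 3 + real k * q\<^sup>2 + q\<^sup>2)"
    by (simp add: power2_eq_square power3_eq_cube algebra_simps)
  also have "\<dots> \<le> 1 - real (Suc k) * q + (real (Suc k))\<^sup>2 * q\<^sup>2"
  proof -
    have "0 \<le> (real k)\<^sup>2 * q ^ 3 + real k * q\<^sup>2 + q\<^sup>2" using assms by simp
    then show ?thesis by linarith
  qed
  finally show ?case .
qed simp

section \<open>Martingale increments, uniform integrability and the weak law\<close>

lemma pmf_markov: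
  fixes f :: "nat \<Rightarrow> real" and p :: "nat pmf"
  assumes "0 < c" "0 \<le> B" "(\<integral>\<^sup>+s. ennreal (f s) \<partial>p) \<le> ennreal B"
  shows "measure p {s. c \<le> f s} \<le> B / c"
proof -
  have "ennreal c * emeasure p {s. c \<le> f s} = (\<integral>\<^sup>+s. ennreal c * indicator {s. c \<le> f s} s \<partial>p)"
    by (simp add: nn_integral_cmult)
  also have "\<dots> \<le> (\<integral>\<^sup>+s. ennreal (f s) \<partial>p)"
    by (intro nn_integral_mono) (auto simp: indicator_def intro: ennreal_leI)
  also note assms(3)
  finally have "ennreal (c * measure p {s. c \<le> f s}) \<le> ennreal B"
    using \<open>0 < c\<close> by (simp add: measure_pmf.emeasure_eq_measure ennreal_mult)
  then show ?thesis using assms by (simp add: field_simps)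
qed

text \<open>\<open>ennreal\<close> maps negative reals to 0, so the integrand is the positive part
  of \<open>f s - real i\<close>. It is dominated by \<open>f\<close> and vanishes for large
  \<open>i\<close>.\<close>

lemma pmf_excess_tendsto_zero:
  fixes f :: "nat \<Rightarrow> real" and p :: "nat pmf"
  assumes "(\<integral>\<^sup>+s. ennreal (f s) \<partial>p) < \<infinity>"
  shows "(\<lambda>i. \<integral>\<^sup>+s. ennreal (f s - real i) \<partial>p) \<longlonglongrightarrow> 0"
proof -
  have "(\<lambda>i. \<integral>\<^sup>+s. ennreal (f s - real i) \<partial>p) \<longlonglongrightarrow> (\<integral>\<^sup>+s. 0 \<partial>p)"
  proof (rule nn_integral_dominated_convergence[where w="\<lambda>s. ennreal (f s)"])
    show "AE s in p. (\<lambda>i. ennreal (f s - real i)) \<longlonglongrightarrow> 0"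
    proof (rule AE_I2)
      fix s
      have "eventually (\<lambda>i. f s \<le> real i) sequentially"
        using filterlim_real_sequentially by (auto simp: filterlim_at_top)
      then have "eventually (\<lambda>i. ennreal (f s - real i) = 0) sequentially"
        by eventually_elim (simp add: ennreal_neg)
      then show "(\<lambda>i. ennreal (f s - real i)) \<longlonglongrightarrow> 0"
        by (simp add: tendsto_eventually)
    qed
  qed (use assms in \<open>auto intro!: ennreal_leI\<close>)
  then show ?thesis by simp
qed

locale supercritical_offspring =
  fixes F :: "nat pmf" and m :: real
  assumes integrable_offspring: "integrable (measure_pmf F) real"
    and mean_offspring: "measure_pmf.expectation F real = m"
    and m_gt_1: "1 < m"
    and integrable_xlogx: "integrable (measure_pmf F) (\<lambda>k. real k * ln (real k))"
begin

lemma m_pos [simp]: "0 < m" using m_gt_1 by simp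

lemma m_ge [simp]: "0 \<le> m" using m_gt_1 by simp

lemma m_neq_0 [simp]: "m \<noteq> 0" using m_gt_1 by simp

text \<open>Offspring in generation \<open>r\<close> is truncated at the cube root of \<open>m ^ r\<close>: small enough for the variance term
  of \<open>W\<^sub>r\<^sub>+\<^sub>1 - W\<^sub>r\<close> to decay geometrically, while \<open>E xi log xi < \<infinity>\<close> still makes the tail means summable.\<close>

definition root_m :: real where "root_m = m powr (1/3)"

lemma root_m_gt_1: "1 < root_m" unfolding root_m_def using m_gt_1 by simp

lemma root_m_pos [simp]: "0 < root_m" using root_m_gt_1 by simp

lemma root_m_ge [simp]: "0 \<le> root_m" using root_m_gt_1 by simp

lemma root_m_neq_0 [simp]: "root_m \<noteq> 0" using root_m_gt_1 by simp

lemma root_m_power3: "root_m ^ 3 = m"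
proof -
  have "root_m ^ 3 = root_m powr real 3" by (rule powr_realpow[OF root_m_pos, symmetric])
  then show ?thesis by (simp add: root_m_def powr_powr)
qed

lemma root_m_power_cubed: "m ^ r = root_m ^ r * root_m ^ r * root_m ^ r"
proof -
  have "m ^ r = (root_m ^ 3) ^ r" by (simp add: root_m_power3)
  also have "\<dots> = root_m ^ r * root_m ^ r * root_m ^ r" by (simp only: power3_eq_cube power_mult_distrib)
  finally show ?thesis .
qed

definition tail_mean :: "real \<Rightarrow> real" where
  "tail_mean y = measure_pmf.expectation F (\<lambda>k. real k * indicator {y<..} (real k))"

lemma integrable_tail: "integrable (measure_pmf F) (\<lambda>k. real k * indicator {y<..} (real k))"
  by (rule Bochner_Integration.integrable_bound[OF integrable_offspring]) (auto simp: indicator_def)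

lemma tail_mean_nonneg: "0 \<le> tail_mean y"
  unfolding tail_mean_def by (intro integral_nonneg_AE AE_I2) simp

lemma nn_mean: "(\<integral>\<^sup>+a. ennreal (real a) \<partial>F) = ennreal m"
  using integrable_offspring by (subst nn_integral_eq_integral) (simp_all add: mean_offspring)

lemma nn_tail_mean: "(\<integral>\<^sup>+a. ennreal (real a * indicator {y<..} (real a)) \<partial>F) = ennreal (tail_mean y)"
  unfolding tail_mean_def using integrable_tail by (subst nn_integral_eq_integral) simp_all

text \<open>This is where \<open>E xi log xi\<close> enters. A family of size \<open>k > 0\<close>
  exceeds \<open>root_m ^ r\<close> for at most \<open>1 + ln k / ln root_m\<close> values of
  \<open>r\<close>, so summing the tail means first over \<open>r\<close> leaves the expectation of
  \<open>k + k * ln k / ln root_m\<close>.\<close>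

lemma summable_tail_mean: "summable (\<lambda>r. tail_mean (root_m ^ r))"
proof (rule summableI_nonneg_bounded[OF tail_mean_nonneg])
  fix n
  have lnb: "0 < ln root_m" using root_m_gt_1 by simp
  have pt: "(\<Sum>r<n. real k * indicator {root_m ^ r<..} (real k)) \<le> real k + real k * ln (real k) / ln root_m" for k
  proof (cases "k = 0")
    case False
    have "r < nat \<lceil>ln (real k) / ln root_m\<rceil>" if "root_m ^ r < real k" for r
    proof -
      have "ln (root_m ^ r) < ln (real k)" using that root_m_gt_1 False by (subst ln_less_cancel_iff) auto
      then have "real r < ln (real k) / ln root_m" using lnb by (simp add: ln_realpow field_simps)
      then show ?thesis by linarith
    qed
    then have "card {r \<in> {..<n}. root_m ^ r < real k} \<le> card {..<nat \<lceil>ln (real k) / ln root_m\<rceil>}"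
      by (intro card_mono) auto
    moreover have "0 \<le> ln (real k) / ln root_m" using False lnb by simp
    ultimately have card: "real (card {r \<in> {..<n}. root_m ^ r < real k}) \<le> 1 + ln (real k) / ln root_m"
      by simp linarith
    have "(\<Sum>r<n. real k * indicator {root_m ^ r<..} (real k)) = real k * real (card {r \<in> {..<n}. root_m ^ r < real k})"
      by (simp add: indicator_def sum_distrib_left[symmetric] if_distrib[of "of_nat"] sum.If_cases Int_def)
    also have "\<dots> \<le> real k * (1 + ln (real k) / ln root_m)"
      using card by (rule mult_left_mono) simp
    also have "\<dots> = real k + real k * ln (real k) / ln root_m"
      by (simp add: distrib_left)
    finally show ?thesis .
  qed simp
  have "(\<Sum>r<n. tail_mean (root_m ^ r)) = measure_pmf.expectation F (\<lambda>k. \<Sum>r<n. real k * indicator {root_m ^ r<..} (real k))"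
    unfolding tail_mean_def using integrable_tail by (subst Bochner_Integration.integral_sum) auto
  also have "\<dots> \<le> measure_pmf.expectation F (\<lambda>k. real k + real k * ln (real k) / ln root_m)"
    using integrable_tail integrable_offspring integrable_xlogx
    by (intro integral_mono pt Bochner_Integration.integrable_sum Bochner_Integration.integrable_add) auto
  finally show "(\<Sum>r<n. tail_mean (root_m ^ r)) \<le> measure_pmf.expectation F (\<lambda>k. real k + real k * ln (real k) / ln root_m)" .
qed

text \<open>Bound for the mean of \<open>|W_(r+1) - W_r|\<close>: the first term is the cost of
  truncating at \<open>root_m ^ r\<close>, the second the fluctuation of the truncated sum.\<close>

definition increment_bound :: "nat \<Rightarrow> real" where
  "increment_bound r = 2 * tail_mean (root_m ^ r) + inverse root_m ^ r"

lemma increment_bound_nonneg: "0 \<le> increment_bound r"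
  unfolding increment_bound_def by (intro add_nonneg_nonneg mult_nonneg_nonneg tail_mean_nonneg) (simp_all add: less_imp_le)

lemma summable_increment_bound: "summable increment_bound"
  unfolding increment_bound_def[abs_def] using root_m_gt_1
  by (intro summable_add summable_mult summable_tail_mean summable_geometric) (simp add: field_simps)

lemma gw_mean: "(\<integral>\<^sup>+k. ennreal (real k) \<partial>gw_pmf F r) = ennreal (m ^ r)"
proof (induction r)
  case (Suc r)
  then show ?case
    by (simp add: nn_integral_sum_iid_mean ennreal_mult nn_integral_multc nn_mean mult.commute)
qed simp

lemma expected_increment_le:
  "(\<integral>\<^sup>+k. \<integral>\<^sup>+s. ennreal \<bar>real s / m ^ Suc r - real k / m ^ r\<bar> \<partial>sum_iid_pmf F k \<partial>gw_pmf F r) \<le> ennreal (increment_bound r)"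
proof -
  \<comment> \<open>With truncation level \<open>root_m ^ r\<close> and about
    \<open>m ^ r = root_m ^ (3 r)\<close> individuals, \<open>\<theta> = root_m ^ (2 r)\<close>
    balances the two terms of Young's inequality. Both have order \<open>root_m ^ (2 r)\<close>,
    hence \<open>root_m ^ (-r)\<close> after division by \<open>m ^ r\<close>.\<close>
  let ?\<eta> = "tail_mean (root_m ^ r)" let ?\<theta> = "root_m ^ r * root_m ^ r"
  let ?c = "(2 * ?\<eta> + m / (2 * root_m ^ r)) / m ^ Suc r" and ?d = "?\<theta> / (2 * m ^ Suc r)"
  have c: "0 \<le> ?c" and d: "0 \<le> ?d" using tail_mean_nonneg[of "root_m ^ r"] by (simp_all add: less_imp_le)
  have "(\<integral>\<^sup>+s. ennreal \<bar>real s / m ^ Suc r - real k / m ^ r\<bar> \<partial>sum_iid_pmf F k) \<le> ennreal ?c * ennreal (real k) + ennreal ?d" for k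
  proof -
    have "\<bar>real s / m ^ Suc r - real k / m ^ r\<bar> = 1 / m ^ Suc r * \<bar>real s - real k * m\<bar>" for s
    proof -
      have "real s / m ^ Suc r - real k / m ^ r = 1 / m ^ Suc r * (real s - real k * m)"
        by (simp add: field_simps)
      then show ?thesis by (simp add: abs_mult)
    qed
    then have "(\<integral>\<^sup>+s. ennreal \<bar>real s / m ^ Suc r - real k / m ^ r\<bar> \<partial>sum_iid_pmf F k)
      = (\<integral>\<^sup>+s. ennreal (1 / m ^ Suc r) * ennreal \<bar>real s - real k * m\<bar> \<partial>sum_iid_pmf F k)"
      by (simp only: ennreal_mult'' abs_ge_zero)
    also have "\<dots> = ennreal (1 / m ^ Suc r) * (\<integral>\<^sup>+s. ennreal \<bar>real s - real k * m\<bar> \<partial>sum_iid_pmf F k)"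
      by (intro nn_integral_cmult) simp
    also have "\<dots> \<le> ennreal (1 / m ^ Suc r) * ennreal (2 * real k * ?\<eta> + (real k * (root_m ^ r * m) / ?\<theta> + ?\<theta>) / 2)"
      by (intro mult_left_mono nn_integral_sum_iid_abs_deviation[OF nn_mean]) (simp_all add: nn_tail_mean tail_mean_nonneg)
    also have "\<dots> = ennreal (1 / m ^ Suc r * (2 * real k * ?\<eta> + (real k * (root_m ^ r * m) / ?\<theta> + ?\<theta>) / 2))"
      by (intro ennreal_mult[symmetric]) (auto intro!: add_nonneg_nonneg simp: tail_mean_nonneg)
    also have "1 / m ^ Suc r * (2 * real k * ?\<eta> + (real k * (root_m ^ r * m) / ?\<theta> + ?\<theta>) / 2) = ?c * real k + ?d"
      by (simp add: field_simps del: power_Suc)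
    also have "ennreal (?c * real k + ?d) = ennreal ?c * ennreal (real k) + ennreal ?d"
      unfolding ennreal_plus[OF mult_nonneg_nonneg[OF c of_nat_0_le_iff] d] ennreal_mult[OF c of_nat_0_le_iff] ..
    finally show ?thesis .
  qed
  then have "(\<integral>\<^sup>+k. \<integral>\<^sup>+s. ennreal \<bar>real s / m ^ Suc r - real k / m ^ r\<bar> \<partial>sum_iid_pmf F k \<partial>gw_pmf F r)
    \<le> (\<integral>\<^sup>+k. ennreal ?c * ennreal (real k) + ennreal ?d \<partial>gw_pmf F r)"
    by (intro nn_integral_mono)
  also have "\<dots> = ennreal ?c * ennreal (m ^ r) + ennreal ?d"
    by (subst nn_integral_add) (auto simp: nn_integral_cmult gw_mean simp del: power_Suc)
  also have "\<dots> = ennreal (?c * m ^ r + ?d)"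
    unfolding ennreal_plus[OF mult_nonneg_nonneg[OF c zero_le_power[OF m_ge]] d] ennreal_mult[OF c zero_le_power[OF m_ge]] ..
  also have "?c * m ^ r + ?d = 2 * ?\<eta> / m + 1 / (2 * root_m ^ r) + 1 / (2 * m * root_m ^ r)"
    by (simp add: root_m_power_cubed field_simps)
  also have "\<dots> \<le> increment_bound r"
  proof -
    have "2 * ?\<eta> / m \<le> 2 * ?\<eta>" using m_gt_1 tail_mean_nonneg[of "root_m ^ r"] by (simp add: divide_le_eq mult_le_cancel_left1)
    moreover have "1 / (2 * m * root_m ^ r) \<le> 1 / (2 * root_m ^ r)"
      using m_gt_1 by (intro divide_left_mono) auto
    moreover have "1 / (2 * root_m ^ r) + 1 / (2 * root_m ^ r) = inverse root_m ^ r" by (simp add: power_inverse field_simps)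
    ultimately show ?thesis unfolding increment_bound_def by linarith
  qed
  finally show ?thesis by (simp add: ennreal_leI)
qed

text \<open>The positive part is 1-Lipschitz, so the mean excess over \<open>K\<close> grows by at
  most the mean absolute increment.\<close>

lemma gw_excess_Suc:
  "(\<integral>\<^sup>+k. ennreal (real k / m ^ Suc r - K) \<partial>gw_pmf F (Suc r)) \<le> (\<integral>\<^sup>+k. ennreal (real k / m ^ r - K) \<partial>gw_pmf F r) + ennreal (increment_bound r)"
proof -
  have "(\<integral>\<^sup>+k. ennreal (real k / m ^ Suc r - K) \<partial>gw_pmf F (Suc r)) \<le>
    (\<integral>\<^sup>+k. (\<integral>\<^sup>+s. ennreal (real k / m ^ r - K) + ennreal \<bar>real s / m ^ Suc r - real k / m ^ r\<bar> \<partial>sum_iid_pmf F k) \<partial>gw_pmf F r)"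
    unfolding gw_pmf_Suc_last nn_integral_bind_pmf
  proof (intro nn_integral_mono)
    fix k s
    let ?u = "real k / m ^ r - K" let ?d = "\<bar>real s / m ^ Suc r - real k / m ^ r\<bar>"
    have "ennreal (real s / m ^ Suc r - K) \<le> ennreal (max 0 ?u + ?d)"
      by (intro ennreal_leI) linarith
    also have "\<dots> = ennreal ?u + ennreal ?d" by (simp add: ennreal_plus max_def ennreal_neg del: power_Suc)
    finally show "ennreal (real s / m ^ Suc r - K) \<le> ennreal ?u + ennreal ?d" .
  qed
  also have "\<dots> = (\<integral>\<^sup>+k. ennreal (real k / m ^ r - K) \<partial>gw_pmf F r) + (\<integral>\<^sup>+k. \<integral>\<^sup>+s. ennreal \<bar>real s / m ^ Suc r - real k / m ^ r\<bar> \<partial>sum_iid_pmf F k \<partial>gw_pmf F r)"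
    by (simp add: nn_integral_add)
  also have "\<dots> \<le> (\<integral>\<^sup>+k. ennreal (real k / m ^ r - K) \<partial>gw_pmf F r) + ennreal (increment_bound r)"
    by (intro add_mono order_refl expected_increment_le)
  finally show ?thesis .
qed

text \<open>Beyond some \<open>N\<close> the remaining increments contribute less than
  \<open>\<delta> / 4\<close> to the excess; the finitely many earlier generations are made small
  together by a large \<open>K\<close>.\<close>

lemma gw_uniformly_integrable:
  assumes "0 < \<delta>"
  obtains K where "0 < K"
    "\<And>r. (\<integral>\<^sup>+k. ennreal (real k * indicator {K * m ^ r<..} (real k)) \<partial>gw_pmf F r) \<le> ennreal (\<delta> * m ^ r)"
proof -
  let ?x = "\<lambda>r K. \<integral>\<^sup>+k. ennreal (real k / m ^ r - K) \<partial>gw_pmf F r"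
  obtain N where N: "(\<Sum>i. increment_bound (i + N)) < \<delta> / 4"
    using suminf_exist_split2[OF summable_increment_bound] order_tendstoD(2)[of _ 0 sequentially "\<delta> / 4"] \<open>0 < \<delta>\<close>
    by (metis (no_types, lifting) eventually_False_sequentially eventually_mono suminf_exist_split2 zero_less_divide_iff zero_less_numeral)
  have "eventually (\<lambda>i. \<forall>r\<in>{..N}. ?x r (real i) < ennreal (\<delta> / 4)) sequentially"
  proof (intro eventually_ball_finite ballI)
    fix r
    have "(\<integral>\<^sup>+k. ennreal (real k / m ^ r) \<partial>gw_pmf F r) = ennreal 1"
      by (simp add: divide_ennreal[symmetric] nn_integral_divide gw_mean)
    then have "(\<lambda>i. ?x r (real i)) \<longlonglongrightarrow> 0" by (intro pmf_excess_tendsto_zero) simp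
    then show "eventually (\<lambda>i. ?x r (real i) < ennreal (\<delta> / 4)) sequentially"
      using \<open>0 < \<delta>\<close> by (intro order_tendstoD) auto
  qed simp
  then have "eventually (\<lambda>i. (\<forall>r\<in>{..N}. ?x r (real i) < ennreal (\<delta> / 4)) \<and> 1 \<le> i) sequentially"
    by (intro eventually_conj eventually_ge_at_top)
  then obtain K :: nat where K: "\<And>r. r \<le> N \<Longrightarrow> ?x r (real K) < ennreal (\<delta> / 4)" "1 \<le> K"
    unfolding eventually_sequentially by (metis atMost_iff order_refl)
  have later: "?x (N + j) (real K) \<le> ?x N (real K) + ennreal (\<Sum>i<j. increment_bound (i + N))" for j
  proof (induction j)
    case (Suc j)
    have "?x (N + Suc j) (real K) \<le> ?x (N + j) (real K) + ennreal (increment_bound (N + j))"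
      using gw_excess_Suc[of "N + j" "real K"] by simp
    also have "\<dots> \<le> ?x N (real K) + ennreal (\<Sum>i<j. increment_bound (i + N)) + ennreal (increment_bound (N + j))"
      using Suc by (intro add_mono order_refl)
    also have "\<dots> = ?x N (real K) + ennreal (\<Sum>i<Suc j. increment_bound (i + N))"
      using increment_bound_nonneg by (simp add: add.assoc ennreal_plus sum_nonneg add.commute)
    finally show ?case .
  qed simp
  have all: "?x r (real K) \<le> ennreal (\<delta> / 2)" for r
  proof (cases "r \<le> N")
    case True
    have "?x r (real K) \<le> ennreal (\<delta> / 4)" using K(1)[OF True] by simp
    also have "\<dots> \<le> ennreal (\<delta> / 2)" using \<open>0 < \<delta>\<close> by (intro ennreal_leI) simp
    finally show ?thesis .
  next
    case False
    then obtain j where r: "r = N + j" by (metis nat_le_linear le_iff_add)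
    have "(\<Sum>i<j. increment_bound (i + N)) \<le> (\<Sum>i. increment_bound (i + N))"
      using summable_increment_bound increment_bound_nonneg by (intro sum_le_suminf) (auto intro: summable_ignore_initial_segment)
    then have "?x r (real K) \<le> ennreal (\<delta> / 4) + ennreal (\<delta> / 4)"
      unfolding r using K(1)[of N] N by (intro order_trans[OF later] add_mono ennreal_leI) auto
    then show ?thesis using \<open>0 < \<delta>\<close> by (simp flip: ennreal_plus)
  qed
  show thesis
  proof
    \<comment> \<open>The level doubles because \<open>w \<le> 2 * (w - K)\<close> for
      \<open>w > 2 * K\<close>: beyond twice \<open>K\<close> the whole value is controlled by the
      excess. This is why the excess was kept below \<open>\<delta> / 2\<close>.\<close>
    show "0 < 2 * real K" using K(2) by simp
    fix r
    have "(\<integral>\<^sup>+k. ennreal (real k * indicator {2 * real K * m ^ r<..} (real k)) \<partial>gw_pmf F r) \<le> (\<integral>\<^sup>+k. ennreal (2 * m ^ r) * ennreal (real k / m ^ r - real K) \<partial>gw_pmf F r)"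
    proof (intro nn_integral_mono)
      fix k
      have "real k * indicator {2 * real K * m ^ r<..} (real k) \<le> 2 * m ^ r * max 0 (real k / m ^ r - real K)"
        by (auto simp: indicator_def max_def field_simps)
      then have "ennreal (real k * indicator {2 * real K * m ^ r<..} (real k)) \<le> ennreal (2 * m ^ r * max 0 (real k / m ^ r - real K))"
        by (rule ennreal_leI)
      also have "\<dots> = ennreal (2 * m ^ r) * ennreal (real k / m ^ r - real K)"
        by (simp add: ennreal_mult max_def ennreal_neg)
      finally show "ennreal (real k * indicator {2 * real K * m ^ r<..} (real k)) \<le> ennreal (2 * m ^ r) * ennreal (real k / m ^ r - real K)" .
    qed
    also have "\<dots> \<le> ennreal (2 * m ^ r) * ennreal (\<delta> / 2)"
      by (simp add: nn_integral_cmult all mult_left_mono del: ennreal_mult'')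
    also have "\<dots> = ennreal (\<delta> * m ^ r)" using \<open>0 < \<delta>\<close> by (simp add: mult.commute flip: ennreal_mult)
    finally show "(\<integral>\<^sup>+k. ennreal (real k * indicator {2 * real K * m ^ r<..} (real k)) \<partial>gw_pmf F r) \<le> ennreal (\<delta> * m ^ r)" .
  qed
qed

text \<open>The deviation is measured against \<open>Y\<close> and not against \<open>k\<close>, so
  one threshold covers all \<open>k \<le> Y\<close>, however small. Truncating at
  \<open>K * m ^ r\<close>, with \<open>K\<close> from uniform integrability, makes the threshold
  independent of \<open>r\<close>.\<close>

lemma gw_weak_law:
  assumes "0 < \<epsilon>" "0 < \<sigma>"
  obtains Y0 where "0 < Y0" "\<And>Y r k. Y0 \<le> Y \<Longrightarrow> real k \<le> Y \<Longrightarrow>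
    measure (sum_iid_pmf (gw_pmf F r) k) {s. \<epsilon> * Y * m ^ r \<le> \<bar>real s - real k * m ^ r\<bar>} \<le> \<sigma>"
proof -
  \<comment> \<open>The mean deviation will be at most \<open>3 * \<upsilon> * Y * m ^ r\<close>,
    and Markov's inequality divides by \<open>\<epsilon> * Y * m ^ r\<close>; the third leaves
    exactly \<open>\<sigma>\<close>.\<close>
  define \<upsilon> where "\<upsilon> = \<epsilon> * \<sigma> / 3"
  have \<upsilon>: "0 < \<upsilon>" unfolding \<upsilon>_def using assms by simp
  obtain K where K: "0 < K" "\<And>r. (\<integral>\<^sup>+k. ennreal (real k * indicator {K * m ^ r<..} (real k)) \<partial>gw_pmf F r) \<le> ennreal (\<upsilon> * m ^ r)"
    using gw_uniformly_integrable[OF \<upsilon>] by metis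
  show thesis
  proof
    \<comment> \<open>From this value of \<open>Y\<close> on,
      \<open>k * K \<le> (\<upsilon> * Y)\<^sup>2\<close>, so the variance term divided by
      \<open>?\<theta>\<close> is at most \<open>?\<theta>\<close>.\<close>
    show "0 < K / \<upsilon>\<^sup>2" using K \<upsilon> by simp
    fix Y r k assume Y: "K / \<upsilon>\<^sup>2 \<le> Y" and k: "real k \<le> Y"
    have "0 < Y" using Y \<open>0 < K / \<upsilon>\<^sup>2\<close> by linarith
    let ?\<theta> = "\<upsilon> * Y * m ^ r"
    have \<theta>: "0 < ?\<theta>" using \<upsilon> \<open>0 < Y\<close> by simp
    have "(\<integral>\<^sup>+s. ennreal \<bar>real s - real k * m ^ r\<bar> \<partial>sum_iid_pmf (gw_pmf F r) k)
      \<le> ennreal (2 * real k * (\<upsilon> * m ^ r) + (real k * (K * m ^ r * m ^ r) / ?\<theta> + ?\<theta>) / 2)"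
      using K \<upsilon> \<theta> by (intro nn_integral_sum_iid_abs_deviation[OF gw_mean]) (auto simp: less_imp_le)
    also have "\<dots> \<le> ennreal (3 * ?\<theta>)"
    proof (intro ennreal_leI)
      have "real k * (\<upsilon> * m ^ r) \<le> Y * (\<upsilon> * m ^ r)"
        using k \<upsilon> by (intro mult_right_mono) auto
      then have "2 * real k * (\<upsilon> * m ^ r) \<le> 2 * ?\<theta>" by (simp add: mult_ac)
      moreover have "real k * (K * m ^ r * m ^ r) / ?\<theta> \<le> ?\<theta>"
      proof -
        have "real k * K \<le> Y * (Y * \<upsilon>\<^sup>2)"
          using k Y \<upsilon> K \<open>0 < Y\<close> by (intro mult_mono) (auto simp: field_simps)
        then have "real k * K * (m ^ r * m ^ r) \<le> Y * (Y * \<upsilon>\<^sup>2) * (m ^ r * m ^ r)"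
          by (intro mult_right_mono) auto
        then have "real k * (K * m ^ r * m ^ r) \<le> ?\<theta> * ?\<theta>"
          by (simp add: power2_eq_square mult_ac)
        then show ?thesis using \<theta> by (simp only: pos_divide_le_eq)
      qed
      moreover have gen: "A + (Q + t) / 2 \<le> 3 * t" if "A \<le> 2 * t" "Q \<le> t" for A Q t :: real
        using that by (simp add: field_simps)
      ultimately show "2 * real k * (\<upsilon> * m ^ r) + (real k * (K * m ^ r * m ^ r) / ?\<theta> + ?\<theta>) / 2 \<le> 3 * ?\<theta>"
        using gen by blast
    qed
    finally have "measure (sum_iid_pmf (gw_pmf F r) k) {s. \<epsilon> * Y * m ^ r \<le> \<bar>real s - real k * m ^ r\<bar>} \<le> 3 * ?\<theta> / (\<epsilon> * Y * m ^ r)"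
      using \<theta> \<open>0 < Y\<close> assms by (intro pmf_markov) auto
    also have "\<dots> = \<sigma>" using \<open>0 < Y\<close> assms by (simp add: \<upsilon>_def)
    finally show "measure (sum_iid_pmf (gw_pmf F r) k) {s. \<epsilon> * Y * m ^ r \<le> \<bar>real s - real k * m ^ r\<bar>} \<le> \<sigma>" .
  qed
qed

end

section \<open>Lower bound\<close>

lemma Fbar_antimono: "x \<le> y \<Longrightarrow> Fbar F y \<le> Fbar F x"
  unfolding Fbar_def by (intro measure_pmf.finite_measure_mono) auto

lemma Fbar_nonneg: "0 \<le> Fbar F x"
  unfolding Fbar_def by simp

lemma integrable_indicator_greaterThan: "integrable (measure_pmf F) (\<lambda>k. indicator {y<..} (real k) :: real)"
  by (rule measure_pmf.integrable_const_bound[where B=1]) auto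

lemma expectation_indicator_greaterThan:
  "measure_pmf.expectation F (\<lambda>k. indicator {y<..} (real k)) = Fbar F y"
proof -
  have "(\<lambda>k. indicator {y<..} (real k)) = (indicator {k. y < real k} :: nat \<Rightarrow> real)"
    by (auto simp: indicator_def)
  then show ?thesis by (simp add: Fbar_def)
qed

context supercritical_offspring
begin

definition gw_up :: "nat \<Rightarrow> real \<Rightarrow> real" where
  "gw_up r x = measure (gw_pmf F r) {k. m ^ r * x < real k}"

definition jump_sum :: "nat \<Rightarrow> real \<Rightarrow> real" where
  "jump_sum n x = (\<Sum>i<n. m ^ i * Fbar F (m ^ (i + 1) * x))"

text \<open>Relative loss in one step of the lower recursion at a level
  \<open>x \<ge> m ^ j\<close>: the mean of families larger than \<open>root_m ^ j\<close>, which
  are discarded, and the second-order Bonferroni term.\<close>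

definition loss :: "nat \<Rightarrow> real" where
  "loss j = tail_mean (root_m ^ j) + inverse root_m ^ j"

lemma loss_nonneg: "0 \<le> loss j"
  unfolding loss_def by (intro add_nonneg_nonneg tail_mean_nonneg) simp

lemma summable_loss: "summable loss"
  unfolding loss_def[abs_def] using root_m_gt_1
  by (intro summable_add summable_tail_mean summable_geometric) (simp add: field_simps)

lemma gw_up_le: "0 < x \<Longrightarrow> gw_up r x \<le> 1 / x"
proof -
  assume "0 < x"
  have "gw_up r x \<le> measure (gw_pmf F r) {k. m ^ r * x \<le> real k}"
    unfolding gw_up_def by (intro measure_pmf.finite_measure_mono) auto
  also have "\<dots> \<le> m ^ r / (m ^ r * x)"
    using \<open>0 < x\<close> by (intro pmf_markov) (auto simp: gw_mean)
  finally show ?thesis by simp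
qed

text \<open>Conditioning on the number \<open>k\<close> of children of the root: for
  \<open>k\<close> above \<open>(1 + \<epsilon>) * m * x\<close> the weak law gives success with
  probability at least \<open>1 - \<delta>\<close>; for \<open>k \<le> root_m ^ j\<close> it is
  enough that one subtree exceeds the level \<open>m * x\<close>. Values in between are
  dropped.\<close>

lemma gw_up_Suc_ge:
  assumes "0 < \<epsilon>" "0 < \<delta>" "\<delta> \<le> 1"
  obtains X0 where "0 < X0"
    "\<And>x r j. X0 \<le> x \<Longrightarrow> m ^ j \<le> x \<Longrightarrow>
      (1 - \<delta>) * Fbar F ((1 + \<epsilon>) * (m * x)) + m * (1 - loss j) * gw_up r (m * x) \<le> gw_up (Suc r) x"
proof -
  \<comment> \<open>With this choice \<open>k > (1 + \<epsilon>) * m * x\<close> says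
    \<open>m * x < (1 - \<epsilon>') * k\<close>, so failure is a downward deviation by the fraction
    \<open>\<epsilon>'\<close>.\<close>
  define \<epsilon>' where "\<epsilon>' = \<epsilon> / (1 + \<epsilon>)"
  have \<epsilon>': "0 < \<epsilon>'" "1 - \<epsilon>' = 1 / (1 + \<epsilon>)" using assms by (simp_all add: \<epsilon>'_def field_simps)
  obtain Y0 where Y0: "0 < Y0" "\<And>Y r k. Y0 \<le> Y \<Longrightarrow> real k \<le> Y \<Longrightarrow>
    measure (sum_iid_pmf (gw_pmf F r) k) {s. \<epsilon>' * Y * m ^ r \<le> \<bar>real s - real k * m ^ r\<bar>} \<le> \<delta>"
    using gw_weak_law[OF \<epsilon>'(1) assms(2)] by metis
  show thesis
  proof
    show "0 < Y0" by fact
    fix x r j assume x: "Y0 \<le> x" "m ^ j \<le> x"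
    have "0 < x" using x \<open>0 < Y0\<close> by linarith
    let ?q = "gw_up r (m * x)" and ?K = "root_m ^ j" and ?L = "(1 + \<epsilon>) * (m * x)"
    let ?\<kappa> = "?K * ?q"
    let ?A = "{s. m ^ Suc r * x < real s}"
    have q: "0 \<le> ?q" "?q \<le> 1" unfolding gw_up_def by simp_all
    \<comment> \<open>Markov gives \<open>?q \<le> m ^ (-j) = root_m ^ (-3 j)\<close>, so
      \<open>?\<kappa>\<close> is even at most \<open>root_m ^ (-2 j)\<close>; the weaker geometric
      bound is summable too.\<close>
    have \<kappa>: "?\<kappa> \<le> inverse root_m ^ j"
    proof -
      have "?q \<le> 1 / (m * x)" using \<open>0 < x\<close> by (intro gw_up_le) simp
      also have "\<dots> \<le> 1 / x" using \<open>0 < x\<close> m_gt_1 by (intro divide_left_mono) auto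
      also have "\<dots> \<le> 1 / m ^ j" using x \<open>0 < x\<close> by (intro divide_left_mono) auto
      finally have "?\<kappa> \<le> ?K * (1 / m ^ j)" by (intro mult_left_mono) auto
      also have "\<dots> = inverse root_m ^ j * inverse root_m ^ j"
        by (simp add: root_m_power_cubed power_inverse field_simps)
      also have "\<dots> \<le> inverse root_m ^ j * 1" using root_m_gt_1
        by (intro mult_left_mono power_le_one) (auto simp: field_simps)
      finally show ?thesis by simp
    qed
    have \<kappa>1: "?\<kappa> \<le> 1"
    proof -
      have "inverse root_m ^ j \<le> 1" using root_m_gt_1 by (intro power_le_one) (auto simp: field_simps)
      then show ?thesis using \<kappa> by linarith
    qed
    have xL: "x \<le> ?L"
      using \<open>0 < x\<close> m_gt_1 assms by (simp add: mult_ge1_I mult_le_cancel_left1 flip: mult.assoc)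
    have KL: "?K \<le> ?L"
    proof -
      have "?K \<le> m ^ j" unfolding root_m_power_cubed using root_m_gt_1
        by (simp add: mult_le_cancel_left1 mult_ge1_I)
      then show ?thesis using x xL by linarith
    qed
    \<comment> \<open>A minorant of the conditional probability. Its two parts live on disjoint sets
      because \<open>?K \<le> ?L\<close>, and its expectation is explicit.\<close>
    let ?g = "\<lambda>k. (1 - \<delta>) * indicator {?L<..} (real k) + (1 - ?\<kappa>) * ?q * (real k - real k * indicator {?K<..} (real k))"
    have large: "1 - \<delta> \<le> measure (sum_iid_pmf (gw_pmf F r) k) ?A" if "?L < real k" for k
    proof -
      have "0 < real k" using that xL \<open>0 < x\<close> by linarith
      have "1 - measure (sum_iid_pmf (gw_pmf F r) k) ?A = measure (sum_iid_pmf (gw_pmf F r) k) (UNIV - ?A)"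
        by (subst measure_pmf.prob_compl[symmetric]) auto
      also have "\<dots> \<le> measure (sum_iid_pmf (gw_pmf F r) k) {s. \<epsilon>' * real k * m ^ r \<le> \<bar>real s - real k * m ^ r\<bar>}"
      proof (intro measure_pmf.finite_measure_mono subsetI)
        fix s assume "s \<in> UNIV - ?A"
        then have "real s \<le> m ^ r * (m * x)" by (simp add: mult_ac)
        also have "m * x \<le> real k / (1 + \<epsilon>)" using that assms by (simp add: field_simps)
        then have "m ^ r * (m * x) \<le> m ^ r * (real k / (1 + \<epsilon>))"
          by (intro mult_left_mono) auto
        also have "\<dots> = (1 - \<epsilon>') * real k * m ^ r" unfolding \<epsilon>' by simp
        finally have "\<epsilon>' * real k * m ^ r \<le> real k * m ^ r - real s" by (simp add: algebra_simps)
        then show "s \<in> {s. \<epsilon>' * real k * m ^ r \<le> \<bar>real s - real k * m ^ r\<bar>}" by simp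
      qed simp
      also have "\<dots> \<le> \<delta>" using that x xL by (intro Y0(2)) auto
      finally show ?thesis by simp
    qed
    have small: "(1 - ?\<kappa>) * ?q * real k \<le> measure (sum_iid_pmf (gw_pmf F r) k) ?A" if "real k \<le> ?K" for k
    proof -
      have "?A = UNIV - {s. real s \<le> m ^ Suc r * x}" by auto
      then have "measure (sum_iid_pmf (gw_pmf F r) k) ?A = 1 - measure (sum_iid_pmf (gw_pmf F r) k) {s. real s \<le> m ^ Suc r * x}"
        using measure_pmf.prob_compl[of "{s. real s \<le> m ^ Suc r * x}" "sum_iid_pmf (gw_pmf F r) k"] by simp
      moreover have "measure (sum_iid_pmf (gw_pmf F r) k) {s. real s \<le> m ^ Suc r * x} \<le> (1 - ?q) ^ k"
        using prob_sum_iid_le_power[of "gw_pmf F r" k "m ^ Suc r * x"] by (simp add: gw_up_def mult_ac)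
      moreover have "(1 - ?q) ^ k \<le> 1 - real k * ?q + (real k)\<^sup>2 * ?q\<^sup>2"
        by (rule one_minus_power_le[OF q])
      moreover have "(real k)\<^sup>2 * ?q\<^sup>2 \<le> ?\<kappa> * (real k * ?q)"
      proof -
        have "real k * (real k * ?q * ?q) \<le> ?K * (real k * ?q * ?q)"
          using that q by (intro mult_right_mono) auto
        then show ?thesis by (simp add: power2_eq_square mult_ac)
      qed
      ultimately show ?thesis by (simp add: algebra_simps)
    qed
    have g0: "0 \<le> ?g k" for k
      using assms \<kappa>1 q by (auto simp: indicator_def)
    have g_int: "integrable (measure_pmf F) ?g"
      by (intro Bochner_Integration.integrable_add integrable_mult_right Bochner_Integration.integrable_diff
          integrable_offspring integrable_tail integrable_indicator_greaterThan)
    have "ennreal (measure_pmf.expectation F ?g) = (\<integral>\<^sup>+k. ennreal (?g k) \<partial>F)"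
      using g_int g0 by (intro nn_integral_eq_integral[symmetric]) auto
    also have "\<dots> \<le> (\<integral>\<^sup>+k. ennreal (measure (sum_iid_pmf (gw_pmf F r) k) ?A) \<partial>F)"
      using large small KL by (intro nn_integral_mono ennreal_leI) (auto simp: indicator_def simp del: power_Suc)
    also have "\<dots> = ennreal (gw_up (Suc r) x)"
      unfolding gw_up_def by (simp add: measure_pmf.emeasure_eq_measure[symmetric])
    finally have "measure_pmf.expectation F ?g \<le> gw_up (Suc r) x"
      by (simp add: gw_up_def)
    moreover have "measure_pmf.expectation F ?g = (1 - \<delta>) * Fbar F ?L + (1 - ?\<kappa>) * ?q * (m - tail_mean ?K)"
      using integrable_offspring integrable_tail[of ?K] integrable_indicator_greaterThan[of F ?L]
      by (simp add: mean_offspring expectation_indicator_greaterThan flip: tail_mean_def)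
    moreover have "m * (1 - loss j) * ?q \<le> (1 - ?\<kappa>) * ?q * (m - tail_mean ?K)"
    proof -
      have "tail_mean ?K \<le> m * tail_mean ?K"
        using tail_mean_nonneg[of ?K] m_gt_1 by (simp add: mult_le_cancel_right1)
      moreover have "m * ?\<kappa> \<le> m * inverse root_m ^ j" using \<kappa> by simp
      moreover have "0 \<le> ?\<kappa> * tail_mean ?K" using q tail_mean_nonneg by simp
      moreover have "(1 - ?\<kappa>) * (m - tail_mean ?K) = m - tail_mean ?K - m * ?\<kappa> + ?\<kappa> * tail_mean ?K"
        by (simp add: algebra_simps)
      moreover have "m * (1 - loss j) = m - m * tail_mean ?K - m * inverse root_m ^ j"
        by (simp add: loss_def algebra_simps)
      ultimately have "m * (1 - loss j) \<le> (1 - ?\<kappa>) * (m - tail_mean ?K)" by linarith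
      from mult_right_mono[OF this q(1)] show ?thesis by (simp only: mult_ac)
    qed
    ultimately show "(1 - \<delta>) * Fbar F ?L + m * (1 - loss j) * ?q \<le> gw_up (Suc r) x" by linarith
  qed
qed

text \<open>Each application replaces \<open>x\<close> by \<open>m * x\<close> and therefore
  \<open>j\<close> by \<open>Suc j\<close>, which preserves \<open>m ^ j \<le> x\<close>. The
  factors \<open>1 - loss j\<close> multiply up, and their product stays above 1 minus the tail sum
  of the losses, whatever the number of steps.\<close>

lemma gw_up_ge_shifted_jump_sum:
  assumes "0 < \<epsilon>" "0 < \<delta>" "\<delta> \<le> 1"
  obtains X0 where "0 < X0"
    "\<And>n x. X0 \<le> x \<Longrightarrow> (1 - \<delta>) * (1 - \<delta>) * (\<Sum>i<n. m ^ i * Fbar F ((1 + \<epsilon>) * (m ^ (i + 1) * x))) \<le> gw_up n x"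
proof -
  obtain X0 where X0: "0 < X0" "\<And>x r j. X0 \<le> x \<Longrightarrow> m ^ j \<le> x \<Longrightarrow>
      (1 - \<delta>) * Fbar F ((1 + \<epsilon>) * (m * x)) + m * (1 - loss j) * gw_up r (m * x) \<le> gw_up (Suc r) x"
    using gw_up_Suc_ge[OF assms] by metis
  define T where "T j = (\<Sum>i. loss (i + j))" for j
  have T_Suc: "T j = loss j + T (Suc j)" for j
  proof -
    have "summable (\<lambda>i. loss (i + j))" using summable_loss by (rule summable_ignore_initial_segment)
    from suminf_split_head[OF this] show ?thesis unfolding T_def by simp
  qed
  have T_nonneg: "0 \<le> T j" for j
    unfolding T_def using summable_loss by (intro suminf_nonneg loss_nonneg summable_ignore_initial_segment)
  have "T \<longlonglongrightarrow> 0" unfolding T_def[abs_def] using summable_loss by (rule suminf_exist_split2)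
  then obtain j0 where j0: "T j0 < \<delta>"
    using order_tendstoD(2)[of T 0 sequentially \<delta>] assms by (auto simp: eventually_sequentially)
  have iter: "(1 - \<delta>) * (1 - T j) * (\<Sum>i<n. m ^ i * Fbar F ((1 + \<epsilon>) * (m ^ (i + 1) * x))) \<le> gw_up n x"
    if "X0 \<le> x" "m ^ j \<le> x" "T j \<le> 1" for n x j
    using that
  proof (induction n arbitrary: x j)
    case 0
    then show ?case by (simp add: gw_up_def)
  next
    case (Suc n)
    let ?S = "\<Sum>i<n. m ^ i * Fbar F ((1 + \<epsilon>) * (m ^ (i + 1) * (m * x)))"
    have "0 < x" using Suc.prems(1) X0(1) by linarith
    have le: "loss j \<le> 1" using T_Suc[of j] T_nonneg[of "Suc j"] Suc.prems by linarith
    have S: "0 \<le> ?S" by (intro sum_nonneg mult_nonneg_nonneg Fbar_nonneg) auto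
    have "x \<le> m * x" using \<open>0 < x\<close> m_gt_1 by (simp add: mult_le_cancel_right1)
    then have IH: "(1 - \<delta>) * (1 - T (Suc j)) * ?S \<le> gw_up n (m * x)"
      using Suc.prems T_Suc[of j] loss_nonneg[of j] by (intro Suc.IH) auto
    have "(1 - \<delta>) * (1 - T j) * (\<Sum>i<Suc n. m ^ i * Fbar F ((1 + \<epsilon>) * (m ^ (i + 1) * x)))
      = (1 - \<delta>) * (1 - T j) * Fbar F ((1 + \<epsilon>) * (m * x)) + m * ((1 - \<delta>) * (1 - T j) * ?S)"
      by (simp add: sum.lessThan_Suc_shift sum_distrib_left algebra_simps del: sum.lessThan_Suc)
    also have "\<dots> \<le> (1 - \<delta>) * Fbar F ((1 + \<epsilon>) * (m * x)) + m * ((1 - \<delta>) * ((1 - loss j) * (1 - T (Suc j))) * ?S)"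
    proof (intro add_mono mult_left_mono mult_right_mono)
      show "(1 - \<delta>) * (1 - T j) \<le> 1 - \<delta>" using assms T_nonneg[of j] by (simp add: mult_left_le)
      have "0 \<le> loss j * T (Suc j)" using loss_nonneg T_nonneg by simp
      then show "1 - T j \<le> (1 - loss j) * (1 - T (Suc j))" unfolding T_Suc[of j] by (simp add: algebra_simps)
    qed (use assms S Fbar_nonneg in auto)
    also have "\<dots> = (1 - \<delta>) * Fbar F ((1 + \<epsilon>) * (m * x)) + m * (1 - loss j) * ((1 - \<delta>) * (1 - T (Suc j)) * ?S)"
      by (simp add: mult_ac)
    also have "\<dots> \<le> (1 - \<delta>) * Fbar F ((1 + \<epsilon>) * (m * x)) + m * (1 - loss j) * gw_up n (m * x)"
      using assms le IH by (intro add_mono mult_left_mono) auto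
    also have "\<dots> \<le> gw_up (Suc n) x" by (intro X0(2) Suc.prems)
    finally show ?case .
  qed
  show thesis
  proof
    \<comment> \<open>Starting at \<open>x \<ge> m ^ j0\<close> puts all losses into the tail beyond
      \<open>j0\<close>, whose sum is below \<open>\<delta>\<close>.\<close>
    show "0 < max X0 (m ^ j0)" using X0 by simp
    fix n x assume x: "max X0 (m ^ j0) \<le> x"
    let ?S = "\<Sum>i<n. m ^ i * Fbar F ((1 + \<epsilon>) * (m ^ (i + 1) * x))"
    have S: "0 \<le> ?S" by (intro sum_nonneg mult_nonneg_nonneg Fbar_nonneg) auto
    have "(1 - \<delta>) * (1 - \<delta>) * ?S \<le> (1 - \<delta>) * (1 - T j0) * ?S"
      using assms j0 S by (intro mult_right_mono mult_left_mono) auto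
    also have "\<dots> \<le> gw_up n x" using x j0 assms by (intro iter) auto
    finally show "(1 - \<delta>) * (1 - \<delta>) * ?S \<le> gw_up n x" .
  qed
qed

end

section \<open>Regular variation in the lower bound\<close>

locale heavy_offspring = supercritical_offspring +
  assumes regularly_varying: "regularly_varying_neg1 (Fbar F)"
begin

text \<open>If \<open>Fbar F\<close> vanished at some point it would vanish from there on, and with
  \<open>0 / 0 = 0\<close> the ratio for \<open>t = 1\<close> would tend to 0 instead of 1.\<close>

lemma Fbar_pos: "0 < Fbar F x"
proof (rule ccontr)
  assume "\<not> 0 < Fbar F x"
  then have "Fbar F y = 0" if "x \<le> y" for y
    using Fbar_antimono[OF that, of F] Fbar_nonneg[of F y] by linarith
  then have "eventually (\<lambda>y. Fbar F (1 * y) / Fbar F y = 0) at_top"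
    using eventually_mono[OF eventually_ge_at_top[of x]] by fastforce
  then have "((\<lambda>y. Fbar F (1 * y) / Fbar F y) \<longlongrightarrow> 0) at_top"
    by (rule tendsto_eventually)
  moreover have "((\<lambda>y. Fbar F (1 * y) / Fbar F y) \<longlongrightarrow> 1 / 1) at_top"
    using regularly_varying unfolding regularly_varying_neg1_def by (metis zero_less_one)
  ultimately show False using tendsto_unique[OF trivial_limit_at_top_linorder] by fastforce
qed

lemma Fbar_ratio_tendsto: "0 < t \<Longrightarrow> ((\<lambda>y. Fbar F (t * y) / Fbar F y) \<longlongrightarrow> 1 / t) at_top"
  using regularly_varying unfolding regularly_varying_neg1_def by blast

lemma Fbar_ge_of_ratio:
  assumes "0 < t" "u < 1 / t"
  shows "eventually (\<lambda>y. u * Fbar F y \<le> Fbar F (t * y)) at_top"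
  using order_tendstoD(1)[OF Fbar_ratio_tendsto[OF assms(1)] assms(2)]
  by eventually_elim (use Fbar_pos in \<open>simp add: less_divide_eq less_imp_le\<close>)

lemma Fbar_le_of_ratio:
  assumes "0 < t" "1 / t < u"
  shows "eventually (\<lambda>y. Fbar F (t * y) \<le> u * Fbar F y) at_top"
  using order_tendstoD(2)[OF Fbar_ratio_tendsto[OF assms(1)] assms(2)]
  by eventually_elim (use Fbar_pos in \<open>simp add: divide_less_eq less_imp_le\<close>)

lemma jump_sum_nonneg: "0 \<le> jump_sum n x"
  unfolding jump_sum_def by (intro sum_nonneg mult_nonneg_nonneg Fbar_nonneg) auto

lemma level_ge: "0 < x \<Longrightarrow> x \<le> m ^ i * x"
  using m_gt_1 by (simp add: mult_le_cancel_right1)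

lemma gw_up_ge_jump_sum:
  assumes "0 < e"
  shows "eventually (\<lambda>x. \<forall>n. (1 - e) * jump_sum n x \<le> gw_up n x) at_top"
proof -
  \<comment> \<open>One third of \<open>e\<close>, since three factors \<open>1 - \<delta>\<close>
    occur: two from the shifted sum, one from removing the shift \<open>1 + \<delta>\<close> inside
    \<open>Fbar F\<close>.\<close>
  define \<delta> where "\<delta> = min 1 (e / 3)"
  have \<delta>: "0 < \<delta>" "\<delta> \<le> 1" "3 * \<delta> \<le> e" using assms by (auto simp: \<delta>_def)
  obtain X0 where X0: "0 < X0" "\<And>n x. X0 \<le> x \<Longrightarrow> (1 - \<delta>) * (1 - \<delta>) * (\<Sum>i<n. m ^ i * Fbar F ((1 + \<delta>) * (m ^ (i + 1) * x))) \<le> gw_up n x"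
    using gw_up_ge_shifted_jump_sum[OF \<delta>(1) \<delta>(1,2)] by metis
  have "1 - \<delta> < 1 / (1 + \<delta>)" using \<delta> by (simp add: field_simps)
  then have "eventually (\<lambda>y. (1 - \<delta>) * Fbar F y \<le> Fbar F ((1 + \<delta>) * y)) at_top"
    using \<delta> by (intro Fbar_ge_of_ratio) auto
  then obtain Y0 where Y0: "\<And>y. Y0 \<le> y \<Longrightarrow> (1 - \<delta>) * Fbar F y \<le> Fbar F ((1 + \<delta>) * y)"
    by (auto simp: eventually_at_top_linorder)
  show ?thesis
    using eventually_ge_at_top[of "max X0 Y0"]
  proof eventually_elim
    case (elim x)
    then have "0 < x" using X0 by simp
    show ?case
    proof
      fix n
      have "1 - e \<le> (1 - \<delta>) * (1 - \<delta>) * (1 - \<delta>)"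
      proof -
        have "1 - 2 * \<delta> \<le> (1 - \<delta>) * (1 - \<delta>)" by (simp add: algebra_simps)
        then have "(1 - 2 * \<delta>) * (1 - \<delta>) \<le> (1 - \<delta>) * (1 - \<delta>) * (1 - \<delta>)"
          using \<delta> by (intro mult_right_mono) auto
        moreover have "1 - e \<le> (1 - 2 * \<delta>) * (1 - \<delta>)"
        proof -
          have "(1 - 2 * \<delta>) * (1 - \<delta>) = 1 - 3 * \<delta> + 2 * (\<delta> * \<delta>)" by (simp add: algebra_simps)
          moreover have "0 \<le> \<delta> * \<delta>" by simp
          ultimately show ?thesis using \<delta>(3) by linarith
        qed
        ultimately show ?thesis by linarith
      qed
      then have "(1 - e) * jump_sum n x \<le> (1 - \<delta>) * (1 - \<delta>) * (1 - \<delta>) * jump_sum n x"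
        using jump_sum_nonneg by (intro mult_right_mono)
      also
      have Y: "Y0 \<le> m ^ (i + 1) * x" for i
        using elim level_ge[OF \<open>0 < x\<close>, of "i + 1"] by (simp del: power_Suc)
      have "(1 - \<delta>) * (1 - \<delta>) * (1 - \<delta>) * jump_sum n x = (1 - \<delta>) * (1 - \<delta>) * (\<Sum>i<n. m ^ i * ((1 - \<delta>) * Fbar F (m ^ (i + 1) * x)))"
        by (simp add: jump_sum_def sum_distrib_left mult_ac)
      also have "\<dots> \<le> (1 - \<delta>) * (1 - \<delta>) * (\<Sum>i<n. m ^ i * Fbar F ((1 + \<delta>) * (m ^ (i + 1) * x)))"
        using \<delta> by (intro mult_left_mono sum_mono Y0 Y) auto
      also have "\<dots> \<le> gw_up n x" using elim by (intro X0(2)) auto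
      finally show "(1 - e) * jump_sum n x \<le> gw_up n x" .
    qed
  qed
qed

end

section \<open>Upper bound\<close>

lemma sum_iid_pmf_one: "sum_iid_pmf p (Suc 0) = p"
  by (simp add: bind_return_pmf')

lemma sum_iid_pmf_return_one: "sum_iid_pmf (return_pmf (Suc 0)) k = return_pmf k"
  by (induction k) (simp_all add: bind_return_pmf)

text \<open>The truncation level \<open>y i\<close> depends on the generation, because a family in
  generation \<open>i\<close> is large only on the scale \<open>m ^ (i + 1) * x\<close>. The
  recursion adds the last generation, so that generations can be replaced one after another.\<close>

fun trunc_gw_pmf :: "nat pmf \<Rightarrow> (nat \<Rightarrow> real) \<Rightarrow> nat \<Rightarrow> nat pmf" where
  "trunc_gw_pmf p y 0 = return_pmf 1"
| "trunc_gw_pmf p y (Suc i) = bind_pmf (trunc_gw_pmf p y i) (sum_iid_pmf (trunc_pmf (y i) p))"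

text \<open>Stochastic domination by the full process: the last step is compared directly, and the
  induction hypothesis applies to the conditional expectation of \<open>h\<close>, which is again
  monotone in the number of individuals.\<close>

lemma trunc_gw_pmf_mono:
  assumes "mono h"
  shows "(\<integral>\<^sup>+k. (h k :: ennreal) \<partial>trunc_gw_pmf p y i) \<le> (\<integral>\<^sup>+k. h k \<partial>gw_pmf p i)"
  using assms
proof (induction i arbitrary: h)
  case (Suc i)
  have "(\<integral>\<^sup>+k. h k \<partial>trunc_gw_pmf p y (Suc i)) \<le> (\<integral>\<^sup>+k. \<integral>\<^sup>+s. h s \<partial>sum_iid_pmf p k \<partial>trunc_gw_pmf p y i)"
    using Suc.prems by (auto intro!: nn_integral_mono nn_integral_sum_iid_trunc_mono)
  also have "\<dots> \<le> (\<integral>\<^sup>+k. \<integral>\<^sup>+s. h s \<partial>sum_iid_pmf p k \<partial>gw_pmf p i)"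
    by (intro Suc.IH nn_integral_sum_iid_mono_count Suc.prems)
  finally show ?case unfolding gw_pmf_Suc_last by simp
qed simp

text \<open>Replacing the offspring law by its truncation one generation at a time, each replacement
  costing at most the contribution of one large family.\<close>

lemma trunc_gw_telescope:
  fixes h :: "nat \<Rightarrow> nat \<Rightarrow> ennreal"
  assumes "\<And>i k. i < n \<Longrightarrow> h i k = (\<integral>\<^sup>+s. h (Suc i) s \<partial>sum_iid_pmf p k)" and "i \<le> n"
  shows "h 0 1 \<le> (\<integral>\<^sup>+k. h i k \<partial>trunc_gw_pmf p y i) + (\<Sum>l<i. \<integral>\<^sup>+k. of_nat k *
    (\<integral>\<^sup>+a. indicator {y l<..} (real a) * (\<integral>\<^sup>+s. h (Suc l) (a + s) \<partial>sum_iid_pmf p (k - 1)) \<partial>p) \<partial>trunc_gw_pmf p y l)"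
  using assms(2)
proof (induction i)
  case (Suc i)
  let ?J = "\<lambda>l. \<integral>\<^sup>+k. of_nat k *
    (\<integral>\<^sup>+a. indicator {y l<..} (real a) * (\<integral>\<^sup>+s. h (Suc l) (a + s) \<partial>sum_iid_pmf p (k - 1)) \<partial>p) \<partial>trunc_gw_pmf p y l"
  have "h 0 1 \<le> (\<integral>\<^sup>+k. h i k \<partial>trunc_gw_pmf p y i) + (\<Sum>l<i. ?J l)" using Suc by simp
  also have "(\<integral>\<^sup>+k. h i k \<partial>trunc_gw_pmf p y i) \<le> (\<integral>\<^sup>+k. h (Suc i) k \<partial>trunc_gw_pmf p y (Suc i)) + ?J i"
  proof -
    have "(\<integral>\<^sup>+k. h i k \<partial>trunc_gw_pmf p y i) \<le> (\<integral>\<^sup>+k. (\<integral>\<^sup>+s. h (Suc i) s \<partial>sum_iid_pmf (trunc_pmf (y i) p) k)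
      + of_nat k * (\<integral>\<^sup>+a. indicator {y i<..} (real a) * (\<integral>\<^sup>+s. h (Suc i) (a + s) \<partial>sum_iid_pmf p (k - 1)) \<partial>p) \<partial>trunc_gw_pmf p y i)"
    proof (intro nn_integral_mono)
      fix k
      have "h i k = (\<integral>\<^sup>+s. h (Suc i) s \<partial>sum_iid_pmf p k)" using Suc.prems by (intro assms(1)) simp
      then show "h i k \<le> (\<integral>\<^sup>+s. h (Suc i) s \<partial>sum_iid_pmf (trunc_pmf (y i) p) k)
        + of_nat k * (\<integral>\<^sup>+a. indicator {y i<..} (real a) * (\<integral>\<^sup>+s. h (Suc i) (a + s) \<partial>sum_iid_pmf p (k - 1)) \<partial>p)"
        using nn_integral_sum_iid_trunc_le[where h="h (Suc i)" and p=p and k=k and y="y i"] by (simp only:)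
    qed
    also have "\<dots> = (\<integral>\<^sup>+k. h (Suc i) k \<partial>trunc_gw_pmf p y (Suc i)) + ?J i"
      by (simp add: nn_integral_add)
    finally show ?thesis .
  qed
  finally show ?case by (simp add: add_right_mono add_ac)
qed simp

section \<open>Second moments of the truncated process and the single large family\<close>

context supercritical_offspring
begin

definition trunc_sq :: "real \<Rightarrow> real" where
  "trunc_sq y = measure_pmf.expectation F (\<lambda>k. (real k)\<^sup>2 * indicator {..y} (real k))"

lemma integrable_trunc_sq: "integrable (measure_pmf F) (\<lambda>k. (real k)\<^sup>2 * indicator {..y} (real k))"
  by (rule measure_pmf.integrable_const_bound[where B="y\<^sup>2"]) (auto simp: indicator_def intro: power_mono)

lemma trunc_sq_nonneg: "0 \<le> trunc_sq y"
  unfolding trunc_sq_def by (intro integral_nonneg_AE AE_I2) simp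

lemma nn_trunc_sq: "(\<integral>\<^sup>+a. ennreal ((real a)\<^sup>2) \<partial>trunc_pmf y F) = ennreal (trunc_sq y)"
proof -
  have "(\<integral>\<^sup>+a. ennreal ((real a)\<^sup>2) \<partial>trunc_pmf y F) = (\<integral>\<^sup>+a. ennreal ((real a)\<^sup>2 * indicator {..y} (real a)) \<partial>F)"
    unfolding nn_integral_trunc_pmf by (intro nn_integral_cong) (simp add: indicator_def)
  then show ?thesis
    unfolding trunc_sq_def using integrable_trunc_sq by (subst (asm) nn_integral_eq_integral) simp_all
qed

lemma trunc_gw_mean: "(\<integral>\<^sup>+k. ennreal (real k) \<partial>trunc_gw_pmf F y i) \<le> ennreal (m ^ i)"
  unfolding gw_mean[symmetric] by (intro trunc_gw_pmf_mono) (simp add: mono_def ennreal_leI)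

text \<open>Conditioning gives
  \<open>E Z_(i+1)^2 \<le> trunc_sq (y i) * E Z_i + m^2 * E Z_i^2\<close>. After division by
  \<open>m ^ (2 * (i + 1))\<close> and with \<open>E Z_i \<le> m ^ i\<close>, generation
  \<open>i\<close> adds \<open>trunc_sq (y i) / m ^ (i + 2)\<close>.\<close>

lemma trunc_gw_square:
  "(\<integral>\<^sup>+k. ennreal ((real k)\<^sup>2) \<partial>trunc_gw_pmf F y i) \<le> ennreal ((m ^ i)\<^sup>2 * (1 + (\<Sum>l<i. trunc_sq (y l) / m ^ (l + 2))))"
proof (induction i)
  case (Suc i)
  let ?v = "trunc_sq (y i)" and ?B = "(m ^ i)\<^sup>2 * (1 + (\<Sum>l<i. trunc_sq (y l) / m ^ (l + 2)))"
  have B: "0 \<le> ?B" using trunc_sq_nonneg by (intro mult_nonneg_nonneg add_nonneg_nonneg sum_nonneg) simp_all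
  have "(\<integral>\<^sup>+a. ennreal (real a) \<partial>trunc_pmf (y i) F) \<le> ennreal m"
    unfolding nn_integral_trunc_pmf nn_mean[symmetric] by (intro nn_integral_mono) simp
  then obtain \<mu> where \<mu>: "(\<integral>\<^sup>+a. ennreal (real a) \<partial>trunc_pmf (y i) F) = ennreal \<mu>" "0 \<le> \<mu>" "\<mu> \<le> m"
    by (metis ennreal_cases ennreal_le_iff ennreal_less_top infinity_ennreal_def leD m_ge)
  have "(\<integral>\<^sup>+s. ennreal ((real s)\<^sup>2) \<partial>sum_iid_pmf (trunc_pmf (y i) F) k) \<le> ennreal ?v * ennreal (real k) + ennreal (m\<^sup>2) * ennreal ((real k)\<^sup>2)" for k
  proof -
    have "(\<integral>\<^sup>+s. ennreal ((real s)\<^sup>2) \<partial>sum_iid_pmf (trunc_pmf (y i) F) k) \<le> ennreal (real k * ?v + (real k)\<^sup>2 * \<mu>\<^sup>2)"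
      by (intro nn_integral_sum_iid_square \<mu>) (simp_all add: nn_trunc_sq trunc_sq_nonneg)
    also have "\<dots> \<le> ennreal (?v * real k + m\<^sup>2 * (real k)\<^sup>2)"
    proof (intro ennreal_leI)
      have "\<mu>\<^sup>2 \<le> m\<^sup>2" using \<mu> by (intro power_mono)
      then have "(real k)\<^sup>2 * \<mu>\<^sup>2 \<le> (real k)\<^sup>2 * m\<^sup>2" by (intro mult_left_mono) auto
      then show "real k * ?v + (real k)\<^sup>2 * \<mu>\<^sup>2 \<le> ?v * real k + m\<^sup>2 * (real k)\<^sup>2" by (simp add: mult.commute)
    qed
    finally show ?thesis by (simp add: ennreal_mult trunc_sq_nonneg)
  qed
  then have "(\<integral>\<^sup>+k. ennreal ((real k)\<^sup>2) \<partial>trunc_gw_pmf F y (Suc i)) \<le>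
    (\<integral>\<^sup>+k. ennreal ?v * ennreal (real k) + ennreal (m\<^sup>2) * ennreal ((real k)\<^sup>2) \<partial>trunc_gw_pmf F y i)"
    by (simp add: nn_integral_mono)
  also have "\<dots> \<le> ennreal ?v * ennreal (m ^ i) + ennreal (m\<^sup>2) * ennreal ?B"
    using trunc_gw_mean Suc by (simp add: nn_integral_add nn_integral_cmult add_mono mult_left_mono)
  also have "\<dots> = ennreal (?v * m ^ i + m\<^sup>2 * ?B)"
    using B by (simp add: ennreal_mult trunc_sq_nonneg)
  also have "?v * m ^ i + m\<^sup>2 * ?B = (m ^ Suc i)\<^sup>2 * (1 + (\<Sum>l<Suc i. trunc_sq (y l) / m ^ (l + 2)))"
    by (simp add: field_simps power2_eq_square)
  finally show ?case .
qed simp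

text \<open>The first term bounds the process with no family above
  \<open>c * m ^ (l + 1) * x\<close>. In the sum, such a family in generation \<open>l\<close>
  either exceeds the fraction \<open>1 - 2 * \<epsilon>\<close> of \<open>m ^ (l + 1) * x\<close>,
  or an additional event is required: generation \<open>l\<close> is unusually large
  (\<open>\<upsilon>\<close>), the other families are large together
  (\<open>K / (\<epsilon> * x)\<close>), or the later generations deviate from their mean
  (\<open>\<sigma>\<close>).\<close>

lemma gw_up_le_sum:
  assumes "0 < x" "0 < \<epsilon>" "0 < K" "0 \<le> \<sigma>" "0 \<le> \<upsilon>"
    and K: "\<And>r. (\<integral>\<^sup>+k. ennreal (real k * indicator {K * m ^ r<..} (real k)) \<partial>gw_pmf F r) \<le> ennreal (\<upsilon> * m ^ r)"
    and \<sigma>: "\<And>Y r k. x \<le> Y \<Longrightarrow> real k \<le> Y \<Longrightarrow>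
      measure (sum_iid_pmf (gw_pmf F r) k) {s. \<epsilon> * Y * m ^ r \<le> \<bar>real s - real k * m ^ r\<bar>} \<le> \<sigma>"
  shows "gw_up n x \<le> (1 + (\<Sum>l<n. trunc_sq (c * (m ^ (l + 1) * x)) / m ^ (l + 2))) / x\<^sup>2
    + (\<Sum>l<n. m ^ l * (Fbar F ((1 - 2 * \<epsilon>) * (m ^ (l + 1) * x)) + Fbar F (c * (m ^ (l + 1) * x)) * (\<upsilon> + K / (\<epsilon> * x) + \<sigma>)))"
proof -
  define y where "y l = c * (m ^ (l + 1) * x)" for l
  \<comment> \<open>The probability that \<open>k\<close> individuals alive in generation
    \<open>i\<close> have more than \<open>m ^ n * x\<close> descendants in generation
    \<open>n\<close>; the telescoping runs along this function.\<close>
  define h where "h i k = emeasure (sum_iid_pmf (gw_pmf F (n - i)) k) {s. m ^ n * x < real s}" for i k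
  let ?R = "\<lambda>l. m ^ l * (Fbar F ((1 - 2 * \<epsilon>) * (m ^ (l + 1) * x)) + Fbar F (c * (m ^ (l + 1) * x)) * (\<upsilon> + K / (\<epsilon> * x) + \<sigma>))"
  have R0: "0 \<le> ?R l" for l using assms Fbar_nonneg by simp
  have h_step: "h i k = (\<integral>\<^sup>+s. h (Suc i) s \<partial>sum_iid_pmf F k)" if "i < n" for i k
  proof -
    have "n - i = Suc (n - Suc i)" using that by simp
    then have "sum_iid_pmf (gw_pmf F (n - i)) k = bind_pmf (sum_iid_pmf F k) (sum_iid_pmf (gw_pmf F (n - Suc i)))"
      by (simp add: bind_sum_iid_pmf)
    then show ?thesis unfolding h_def by simp
  qed
  have big_jump: "(\<integral>\<^sup>+k. of_nat k * (\<integral>\<^sup>+a. indicator {y l<..} (real a) * (\<integral>\<^sup>+s. h (Suc l) (a + s) \<partial>sum_iid_pmf F (k - 1)) \<partial>F) \<partial>trunc_gw_pmf F y l) \<le> ennreal (?R l)"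
    if "l < n" for l
  proof -
    let ?Y = "m ^ (l + 1) * x" and ?r = "n - Suc l"
    let ?f = "Fbar F ((1 - 2 * \<epsilon>) * ?Y)" and ?g = "Fbar F (y l)" and ?w = "K / (\<epsilon> * x)"
    have "x \<le> ?Y" using \<open>0 < x\<close> m_gt_1 by (simp add: mult_le_cancel_right1 mult_ge1_I del: power_Suc)
    then have Y: "0 < ?Y" using \<open>0 < x\<close> by linarith
    have mn: "m ^ n * x = m ^ ?r * ?Y" using that by (simp flip: power_add mult.assoc power_Suc2 power_Suc)
    have w: "0 \<le> ?w" using assms by simp
    \<comment> \<open>With at most \<open>(1 - \<epsilon>) * ?Y\<close> individuals in generation
      \<open>l + 1\<close>, more than \<open>?Y * m ^ ?r\<close> descendants after \<open>?r\<close>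
      further steps is a deviation by \<open>\<epsilon> * ?Y * m ^ ?r\<close> from the mean.\<close>
    have h_small: "h (Suc l) u \<le> ennreal \<sigma>" if u: "real u \<le> (1 - \<epsilon>) * ?Y" for u
    proof -
      have "measure (sum_iid_pmf (gw_pmf F ?r) u) {s. m ^ n * x < real s}
        \<le> measure (sum_iid_pmf (gw_pmf F ?r) u) {s. \<epsilon> * ?Y * m ^ ?r \<le> \<bar>real s - real u * m ^ ?r\<bar>}"
      proof (intro measure_pmf.finite_measure_mono subsetI)
        fix s assume s: "s \<in> {s. m ^ n * x < real s}"
        have "real u * m ^ ?r \<le> (1 - \<epsilon>) * ?Y * m ^ ?r" using u by (intro mult_right_mono) auto
        then have "\<epsilon> * ?Y * m ^ ?r \<le> real s - real u * m ^ ?r" using s unfolding mn by (simp add: algebra_simps)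
        then show "s \<in> {s. \<epsilon> * ?Y * m ^ ?r \<le> \<bar>real s - real u * m ^ ?r\<bar>}" by simp
      qed simp
      also have "\<dots> \<le> \<sigma>"
      proof (rule \<sigma>[OF \<open>x \<le> ?Y\<close>])
        have "(1 - \<epsilon>) * ?Y \<le> 1 * ?Y" using \<open>0 < \<epsilon>\<close> Y by (intro mult_right_mono) auto
        then show "real u \<le> ?Y" using u by linarith
      qed
      finally show ?thesis unfolding h_def by (simp add: measure_pmf.emeasure_eq_measure ennreal_leI)
    qed
    have h_le_1: "h (Suc l) u \<le> 1" for u unfolding h_def by (simp add: measure_pmf.emeasure_le_1)
    \<comment> \<open>The other families have expected total at most \<open>K * m ^ l * m\<close>
      unless generation \<open>l\<close> exceeds \<open>K * m ^ l\<close>. The indicator records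
      that exception and is later paid for by uniform integrability.\<close>
    have rest: "emeasure (sum_iid_pmf F (k - 1)) {s. \<epsilon> * ?Y \<le> real s} \<le> indicator {K * m ^ l<..} (real k) + ennreal ?w" for k
    proof (cases "K * m ^ l < real k")
      case True
      then show ?thesis by (simp add: measure_pmf.emeasure_le_1 add_increasing2)
    next
      case False
      have "measure (sum_iid_pmf F (k - 1)) {s. \<epsilon> * ?Y \<le> real s} \<le> K * m ^ l * m / (\<epsilon> * ?Y)"
      proof (rule pmf_markov)
        have "real (k - 1) \<le> K * m ^ l" using False by linarith
        then show "(\<integral>\<^sup>+s. ennreal (real s) \<partial>sum_iid_pmf F (k - 1)) \<le> ennreal (K * m ^ l * m)"
          unfolding nn_integral_sum_iid_mean[OF nn_mean m_ge] by (intro ennreal_leI mult_right_mono) auto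
      qed (use assms Y in auto)
      also have "\<dots> = ?w" using assms by (simp add: field_simps)
      finally show ?thesis using False by (simp add: measure_pmf.emeasure_eq_measure ennreal_leI)
    qed
    have tail_F: "(\<integral>\<^sup>+a. indicator {u<..} (real a) \<partial>F) = ennreal (Fbar F u)" for u
    proof -
      have "(\<integral>\<^sup>+a. indicator {u<..} (real a) \<partial>F) = (\<integral>\<^sup>+a. indicator {a. u < real a} a \<partial>F)"
        by (intro nn_integral_cong) (simp add: indicator_def)
      then show ?thesis by (simp add: Fbar_def measure_pmf.emeasure_eq_measure)
    qed
    have "(\<integral>\<^sup>+a. indicator {y l<..} (real a) * (\<integral>\<^sup>+s. h (Suc l) (a + s) \<partial>sum_iid_pmf F (k - 1)) \<partial>F)
      \<le> ennreal ?f + ennreal ?g * (indicator {K * m ^ l<..} (real k) + ennreal ?w + ennreal \<sigma>)" for k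
    proof -
      let ?D = "indicator {K * m ^ l<..} (real k) + ennreal ?w + ennreal \<sigma>"
      \<comment> \<open>The large family and the rest together stay below
        \<open>(1 - \<epsilon>) * ?Y\<close> if the family is at most
        \<open>(1 - 2 * \<epsilon>) * ?Y\<close> and the rest below \<open>\<epsilon> * ?Y\<close>;
        hence the two different fractions.\<close>
      have "indicator {y l<..} (real a) * (\<integral>\<^sup>+s. h (Suc l) (a + s) \<partial>sum_iid_pmf F (k - 1))
        \<le> indicator {(1 - 2 * \<epsilon>) * ?Y<..} (real a) + indicator {y l<..} (real a) * ?D" for a
      proof (cases "(1 - 2 * \<epsilon>) * ?Y < real a")
        case True
        have "(\<integral>\<^sup>+s. h (Suc l) (a + s) \<partial>sum_iid_pmf F (k - 1)) \<le> (\<integral>\<^sup>+s. 1 \<partial>sum_iid_pmf F (k - 1))"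
          by (intro nn_integral_mono h_le_1)
        then have "indicator {y l<..} (real a) * (\<integral>\<^sup>+s. h (Suc l) (a + s) \<partial>sum_iid_pmf F (k - 1)) \<le> 1 * 1"
          by (intro mult_mono) (auto simp: indicator_def)
        also have "\<dots> \<le> 1 + indicator {y l<..} (real a) * ?D" by simp
        finally show ?thesis using True by simp
      next
        case False
        have "h (Suc l) (a + s) \<le> indicator {s. \<epsilon> * ?Y \<le> real s} s + ennreal \<sigma>" for s
        proof (cases "\<epsilon> * ?Y \<le> real s")
          case True
          then show ?thesis using h_le_1[of "a + s"] by (simp add: add_increasing2)
        next
          case s: False
          have "real (a + s) \<le> (1 - \<epsilon>) * ?Y" using s False by (simp add: algebra_simps)
          then show ?thesis using h_small s by simp
        qed
        then have "(\<integral>\<^sup>+s. h (Suc l) (a + s) \<partial>sum_iid_pmf F (k - 1)) \<le> (\<integral>\<^sup>+s. indicator {s. \<epsilon> * ?Y \<le> real s} s + ennreal \<sigma> \<partial>sum_iid_pmf F (k - 1))"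
          by (intro nn_integral_mono)
        also have "\<dots> = emeasure (sum_iid_pmf F (k - 1)) {s. \<epsilon> * ?Y \<le> real s} + ennreal \<sigma>"
          by (subst nn_integral_add) auto
        also have "\<dots> \<le> ?D" by (intro add_mono rest order_refl)
        finally show ?thesis using False by (cases "y l < real a") simp_all
      qed
      then have "(\<integral>\<^sup>+a. indicator {y l<..} (real a) * (\<integral>\<^sup>+s. h (Suc l) (a + s) \<partial>sum_iid_pmf F (k - 1)) \<partial>F)
        \<le> (\<integral>\<^sup>+a. indicator {(1 - 2 * \<epsilon>) * ?Y<..} (real a) + indicator {y l<..} (real a) * ?D \<partial>F)"
        by (intro nn_integral_mono)
      also have "\<dots> = ennreal ?f + ennreal ?g * ?D"
        by (subst nn_integral_add) (auto simp: nn_integral_multc tail_F)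
      finally show ?thesis .
    qed
    then have "(\<integral>\<^sup>+k. of_nat k * (\<integral>\<^sup>+a. indicator {y l<..} (real a) * (\<integral>\<^sup>+s. h (Suc l) (a + s) \<partial>sum_iid_pmf F (k - 1)) \<partial>F) \<partial>trunc_gw_pmf F y l)
      \<le> (\<integral>\<^sup>+k. ennreal (real k) * (ennreal ?f + ennreal ?g * (indicator {K * m ^ l<..} (real k) + ennreal ?w + ennreal \<sigma>)) \<partial>trunc_gw_pmf F y l)"
      by (intro nn_integral_mono) (simp add: mult_left_mono flip: ennreal_of_nat_eq_real_of_nat)
    also have "\<dots> = (\<integral>\<^sup>+k. (ennreal ?f + ennreal ?g * (ennreal ?w + ennreal \<sigma>)) * ennreal (real k) + ennreal ?g * ennreal (real k * indicator {K * m ^ l<..} (real k)) \<partial>trunc_gw_pmf F y l)"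
      by (intro nn_integral_cong) (auto simp: indicator_def algebra_simps)
    also have "\<dots> = (ennreal ?f + ennreal ?g * (ennreal ?w + ennreal \<sigma>)) * (\<integral>\<^sup>+k. ennreal (real k) \<partial>trunc_gw_pmf F y l)
      + ennreal ?g * (\<integral>\<^sup>+k. ennreal (real k * indicator {K * m ^ l<..} (real k)) \<partial>trunc_gw_pmf F y l)"
      by (subst nn_integral_add) (auto simp: nn_integral_cmult)
    also have "\<dots> \<le> (ennreal ?f + ennreal ?g * (ennreal ?w + ennreal \<sigma>)) * ennreal (m ^ l) + ennreal ?g * ennreal (\<upsilon> * m ^ l)"
    proof (intro add_mono mult_left_mono trunc_gw_mean)
      \<comment> \<open>Uniform integrability is given for the full process; the integrand is
        monotone, so domination carries it to the truncated one.\<close>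
      have "mono (\<lambda>k. ennreal (real k * indicator {K * m ^ l<..} (real k)))"
        by (auto simp: mono_def indicator_def intro!: ennreal_leI)
      then show "(\<integral>\<^sup>+k. ennreal (real k * indicator {K * m ^ l<..} (real k)) \<partial>trunc_gw_pmf F y l) \<le> ennreal (\<upsilon> * m ^ l)"
        using K[of l] trunc_gw_pmf_mono order_trans by blast
    qed auto
    also have "\<dots> = ennreal ((?f + ?g * (?w + \<sigma>)) * m ^ l + ?g * (\<upsilon> * m ^ l))"
    proof -
      have "0 \<le> ?f" "0 \<le> ?g" by (rule Fbar_nonneg)+
      then show ?thesis using w assms(4,5) by (simp add: ennreal_mult ennreal_plus)
    qed
    also have "(?f + ?g * (?w + \<sigma>)) * m ^ l + ?g * (\<upsilon> * m ^ l) = ?R l"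
      unfolding y_def by (simp add: algebra_simps)
    finally show ?thesis .
  qed
  let ?B = "1 + (\<Sum>l<n. trunc_sq (y l) / m ^ (l + 2))"
  have B: "0 \<le> ?B" using trunc_sq_nonneg by (intro add_nonneg_nonneg sum_nonneg) simp_all
  \<comment> \<open>The second moment is taken without centring: the mean contributes only
    \<open>1 / x\<^sup>2\<close>, which is later absorbed because
    \<open>y\<^sup>2 * Fbar F y\<close> tends to infinity.\<close>
  have no_jump: "measure (trunc_gw_pmf F y n) {k. m ^ n * x < real k} \<le> ?B / x\<^sup>2"
  proof -
    have "measure (trunc_gw_pmf F y n) {k. m ^ n * x < real k} \<le> measure (trunc_gw_pmf F y n) {k. (m ^ n * x)\<^sup>2 \<le> (real k)\<^sup>2}"
      using \<open>0 < x\<close> by (intro measure_pmf.finite_measure_mono) (auto intro!: power_mono)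
    also have "\<dots> \<le> (m ^ n)\<^sup>2 * ?B / (m ^ n * x)\<^sup>2"
      using \<open>0 < x\<close> B by (intro pmf_markov trunc_gw_square) auto
    also have "\<dots> = ?B / x\<^sup>2" by (simp add: power_mult_distrib)
    finally show ?thesis .
  qed
  have "ennreal (gw_up n x) = h 0 1"
    unfolding gw_up_def h_def by (simp add: sum_iid_pmf_one measure_pmf.emeasure_eq_measure del: sum_iid_pmf.simps)
  also have "\<dots> \<le> (\<integral>\<^sup>+k. h n k \<partial>trunc_gw_pmf F y n) + (\<Sum>l<n. \<integral>\<^sup>+k. of_nat k *
    (\<integral>\<^sup>+a. indicator {y l<..} (real a) * (\<integral>\<^sup>+s. h (Suc l) (a + s) \<partial>sum_iid_pmf F (k - 1)) \<partial>F) \<partial>trunc_gw_pmf F y l)"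
    by (rule trunc_gw_telescope[where h=h and p=F and y=y, OF h_step order_refl])
  also have "(\<integral>\<^sup>+k. h n k \<partial>trunc_gw_pmf F y n) = (\<integral>\<^sup>+k. indicator {k. m ^ n * x < real k} k \<partial>trunc_gw_pmf F y n)"
    unfolding h_def by (simp add: sum_iid_pmf_return_one)
  also have "\<dots> = ennreal (measure (trunc_gw_pmf F y n) {k. m ^ n * x < real k})"
    by (simp add: measure_pmf.emeasure_eq_measure)
  also have "\<dots> \<le> ennreal (?B / x\<^sup>2)" using no_jump by (rule ennreal_leI)
  also have "(\<Sum>l<n. \<integral>\<^sup>+k. of_nat k *
    (\<integral>\<^sup>+a. indicator {y l<..} (real a) * (\<integral>\<^sup>+s. h (Suc l) (a + s) \<partial>sum_iid_pmf F (k - 1)) \<partial>F) \<partial>trunc_gw_pmf F y l) \<le> (\<Sum>l<n. ennreal (?R l))"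
    by (intro sum_mono big_jump) simp
  also have "\<dots> = ennreal (\<Sum>l<n. ?R l)" using R0 by (intro sum_ennreal)
  finally have "ennreal (gw_up n x) \<le> ennreal (?B / x\<^sup>2 + (\<Sum>l<n. ?R l))"
    using B R0 by (simp add: add_mono sum_nonneg)
  then show ?thesis
    using B R0 by (subst (asm) ennreal_le_iff) (auto simp: y_def intro!: add_nonneg_nonneg sum_nonneg)
qed

end

section \<open>Karamata-type estimates by doubling, and the upper bound\<close>

context heavy_offspring
begin

text \<open>The limit of \<open>Fbar F (2 * y) / Fbar F y\<close> is 1/2, so eventually the ratio is
  at least 1/3, and \<open>y\<^sup>2 * Fbar F y\<close> gains the factor 4/3 with every
  doubling.\<close>

lemma Fbar_square_doubling:
  obtains y0 where "0 < y0" "\<And>y. y0 \<le> y \<Longrightarrow> 4 * (y\<^sup>2 * Fbar F y) \<le> 3 * ((2 * y)\<^sup>2 * Fbar F (2 * y))"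
proof -
  have "eventually (\<lambda>y. 1 / 3 * Fbar F y \<le> Fbar F (2 * y)) at_top"
    by (intro Fbar_ge_of_ratio) auto
  then obtain y1 where y1: "\<And>y. y1 \<le> y \<Longrightarrow> 1 / 3 * Fbar F y \<le> Fbar F (2 * y)"
    by (auto simp: eventually_at_top_linorder)
  show thesis
  proof
    show "0 < max 1 y1" by simp
    fix y assume y: "max 1 y1 \<le> y"
    have "y\<^sup>2 * (1 / 3 * Fbar F y) \<le> y\<^sup>2 * Fbar F (2 * y)" using y by (intro mult_left_mono y1) auto
    then show "4 * (y\<^sup>2 * Fbar F y) \<le> 3 * ((2 * y)\<^sup>2 * Fbar F (2 * y))" by (simp add: power_mult_distrib mult_ac)
  qed
qed

text \<open>Every \<open>y \<ge> y0\<close> is brought into \<open>[y0, 2 * y0]\<close> by repeated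
  halving, so doubling inequalities extend to a half-line.\<close>

lemma dyadic_induct:
  fixes y0 :: real
  assumes "0 < y0" "y0 \<le> y" "\<And>y. y0 \<le> y \<Longrightarrow> y \<le> 2 * y0 \<Longrightarrow> P y" "\<And>y. y0 \<le> y \<Longrightarrow> P y \<Longrightarrow> P (2 * y)"
  shows "P y"
proof -
  obtain N where "y / y0 < 2 ^ N" using real_arch_pow[of 2] by auto
  then have "y \<le> 2 ^ N * y0" using assms(1) by (simp add: field_simps)
  with assms(2) show ?thesis
  proof (induction N arbitrary: y)
    case 0
    then show ?case using assms(1,3) by simp
  next
    case (Suc N)
    show ?case
    proof (cases "y \<le> 2 * y0")
      case False
      then have "P (y / 2)" using Suc.prems by (intro Suc.IH) auto
      then show ?thesis using assms(4)[of "y / 2"] False by simp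
    qed (use assms(3) Suc.prems in blast)
  qed
qed

lemma Fbar_square_at_top: "filterlim (\<lambda>y. y\<^sup>2 * Fbar F y) at_top at_top"
proof -
  let ?g = "\<lambda>y. y\<^sup>2 * Fbar F y"
  obtain y0 where y0: "0 < y0" "\<And>y. y0 \<le> y \<Longrightarrow> 4 * ?g y \<le> 3 * ?g (2 * y)"
    using Fbar_square_doubling by blast
  define g0 where "g0 = y0\<^sup>2 * Fbar F (2 * y0)"
  have g0: "0 < g0" unfolding g0_def using y0(1) Fbar_pos by simp
  have low: "g0 \<le> ?g y" if "y0 \<le> y" for y
  proof (rule dyadic_induct[OF y0(1) that])
    fix y assume "y0 \<le> y" "y \<le> 2 * y0"
    then show "g0 \<le> ?g y" unfolding g0_def using y0(1) Fbar_nonneg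
      by (intro mult_mono power_mono Fbar_antimono) auto
  next
    fix y assume "y0 \<le> y" "g0 \<le> ?g y"
    then show "g0 \<le> ?g (2 * y)" using y0(2)[of y] g0 by linarith
  qed
  have grow: "eventually (\<lambda>y. (4 / 3) ^ N * g0 \<le> ?g y) at_top" for N
  proof (induction N)
    case 0
    then show ?case using eventually_mono[OF eventually_ge_at_top[of y0]] low by simp
  next
    case (Suc N)
    then obtain y1 where y1: "\<And>y. y1 \<le> y \<Longrightarrow> (4 / 3) ^ N * g0 \<le> ?g y" by (auto simp: eventually_at_top_linorder)
    show ?case
      unfolding eventually_at_top_linorder
    proof (intro exI allI impI)
      fix y assume "2 * max y0 y1 \<le> y"
      then have "y0 \<le> y / 2" "y1 \<le> y / 2" by auto
      from y0(2)[OF this(1)] y1[OF this(2)] show "(4 / 3) ^ Suc N * g0 \<le> ?g y" by simp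
    qed
  qed
  show ?thesis
    unfolding filterlim_at_top
  proof
    fix Z
    obtain N where "Z / g0 < (4 / 3) ^ N" using real_arch_pow[of "4 / 3"] by auto
    then have "Z \<le> (4 / 3) ^ N * g0" using g0 by (simp add: field_simps)
    then show "eventually (\<lambda>y. Z \<le> ?g y) at_top" using grow[of N] by (auto elim: eventually_mono)
  qed
qed

text \<open>One half of Karamata's theorem, up to a constant: doubling \<open>y\<close> adds at most
  \<open>4 * y\<^sup>2 * Fbar F y\<close> to the truncated second moment, while
  \<open>y\<^sup>2 * Fbar F y\<close> itself grows geometrically along doublings.\<close>

lemma trunc_sq_le: "eventually (\<lambda>y. trunc_sq y \<le> 13 * (y\<^sup>2 * Fbar F y)) at_top"
proof -
  let ?g = "\<lambda>y. y\<^sup>2 * Fbar F y"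
  obtain y0 where y0: "0 < y0" "\<And>y. y0 \<le> y \<Longrightarrow> 4 * ?g y \<le> 3 * ?g (2 * y)"
    using Fbar_square_doubling by blast
  have mono: "trunc_sq y \<le> trunc_sq z" if "y \<le> z" for y z
    unfolding trunc_sq_def using that by (intro integral_mono integrable_trunc_sq) (auto simp: indicator_def)
  have double: "trunc_sq (2 * y) \<le> trunc_sq y + 4 * ?g y" if "0 < y" for y
  proof -
    have sq: "(real k)\<^sup>2 * indicator {..2 * y} (real k) \<le> (real k)\<^sup>2 * indicator {..y} (real k) + (2 * y)\<^sup>2 * indicator {y<..} (real k)" for k
      using power_mono[of "real k" "2 * y" 2] by (simp add: indicator_def)
    have "trunc_sq (2 * y) \<le> measure_pmf.expectation F (\<lambda>k. (real k)\<^sup>2 * indicator {..y} (real k) + (2 * y)\<^sup>2 * indicator {y<..} (real k))"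
      unfolding trunc_sq_def
      by (intro integral_mono sq Bochner_Integration.integrable_add integrable_mult_right integrable_trunc_sq integrable_indicator_greaterThan)
    also have "\<dots> = trunc_sq y + 4 * ?g y"
      unfolding trunc_sq_def using integrable_trunc_sq integrable_indicator_greaterThan
      by (simp add: expectation_indicator_greaterThan power_mult_distrib)
    finally show ?thesis .
  qed
  \<comment> \<open>The constant 12 is reproduced by a doubling:
    \<open>12 + 4 = 16 = 12 * 4 / 3\<close>. The additive constant is finally absorbed by one
    further \<open>y\<^sup>2 * Fbar F y\<close>, which makes 13.\<close>
  have "trunc_sq y \<le> trunc_sq (2 * y0) + 12 * ?g y" if "y0 \<le> y" for y
  proof (rule dyadic_induct[OF y0(1) that])
    fix y assume "y0 \<le> y" "y \<le> 2 * y0"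
    then show "trunc_sq y \<le> trunc_sq (2 * y0) + 12 * ?g y"
      using mono[of y "2 * y0"] Fbar_nonneg[of F y] by (simp add: add_increasing2)
  next
    fix y assume y: "y0 \<le> y" "trunc_sq y \<le> trunc_sq (2 * y0) + 12 * ?g y"
    then have "trunc_sq (2 * y) \<le> trunc_sq (2 * y0) + 16 * ?g y" using double[of y] y0(1) by linarith
    then show "trunc_sq (2 * y) \<le> trunc_sq (2 * y0) + 12 * ?g (2 * y)" using y0(2)[OF y(1)] by linarith
  qed
  moreover have "eventually (\<lambda>y. trunc_sq (2 * y0) \<le> ?g y) at_top"
    using Fbar_square_at_top unfolding filterlim_at_top by blast
  ultimately show ?thesis
    using eventually_ge_at_top[of y0] by (smt (verit) eventually_elim2)
qed

lemma gw_up_le_jump_sum: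
  assumes "0 < e"
  shows "eventually (\<lambda>x. \<forall>n\<ge>1. gw_up n x \<le> (1 + e) * jump_sum n x) at_top"
proof -
  \<comment> \<open>The budget is \<open>e / 4\<close> for \<open>1 / x\<^sup>2\<close>,
    \<open>e / 4\<close> for the truncated second moments, and \<open>e / 2\<close> for the large
    families. The choices give \<open>1 / t = 1 + e / 8\<close>,
    \<open>1 - 2 * \<epsilon> = t\<close>, \<open>13 * c\<^sup>2 * (2 / c) = e / 4\<close> and
    \<open>(2 / c) * (3 * \<upsilon>) = e / 4\<close>.\<close>
  define t where "t = 1 / (1 + e / 8)"
  define \<epsilon> where "\<epsilon> = (1 - t) / 2"
  define c where "c = e / 104"
  define \<upsilon> where "\<upsilon> = e * c / 24"
  have t: "0 < t" "t < 1" "1 / t < 1 + e / 4" using assms by (simp_all add: t_def field_simps)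
  have \<epsilon>: "0 < \<epsilon>" "1 - 2 * \<epsilon> = t" using t by (simp_all add: \<epsilon>_def field_simps)
  have c: "0 < c" using assms by (simp add: c_def)
  have \<upsilon>: "0 < \<upsilon>" using assms c by (simp add: \<upsilon>_def)
  obtain K where K: "0 < K" "\<And>r. (\<integral>\<^sup>+k. ennreal (real k * indicator {K * m ^ r<..} (real k)) \<partial>gw_pmf F r) \<le> ennreal (\<upsilon> * m ^ r)"
    using gw_uniformly_integrable[OF \<upsilon>] by metis
  obtain Y0 where Y0: "0 < Y0" "\<And>Y r k. Y0 \<le> Y \<Longrightarrow> real k \<le> Y \<Longrightarrow>
    measure (sum_iid_pmf (gw_pmf F r) k) {s. \<epsilon> * Y * m ^ r \<le> \<bar>real s - real k * m ^ r\<bar>} \<le> \<upsilon>"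
    using gw_weak_law[OF \<epsilon>(1) \<upsilon>] by metis
  have "eventually (\<lambda>y. Fbar F (t * y) \<le> (1 + e / 4) * Fbar F y) at_top"
    using t by (intro Fbar_le_of_ratio)
  then obtain y1 where y1: "\<And>y. y1 \<le> y \<Longrightarrow> Fbar F (t * y) \<le> (1 + e / 4) * Fbar F y"
    by (auto simp: eventually_at_top_linorder)
  have "eventually (\<lambda>y. Fbar F (c * y) \<le> (2 / c) * Fbar F y) at_top"
    using c by (intro Fbar_le_of_ratio) (auto simp: field_simps)
  then obtain y2 where y2: "\<And>y. y2 \<le> y \<Longrightarrow> Fbar F (c * y) \<le> (2 / c) * Fbar F y"
    by (auto simp: eventually_at_top_linorder)
  obtain y3 where y3: "\<And>y. y3 \<le> y \<Longrightarrow> trunc_sq y \<le> 13 * (y\<^sup>2 * Fbar F y)"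
    using trunc_sq_le by (auto simp: eventually_at_top_linorder)
  have "eventually (\<lambda>y. 4 * m\<^sup>2 / e \<le> y\<^sup>2 * Fbar F y) at_top"
    using Fbar_square_at_top unfolding filterlim_at_top by blast
  then obtain y4 where y4: "\<And>y. y4 \<le> y \<Longrightarrow> 4 * m\<^sup>2 / e \<le> y\<^sup>2 * Fbar F y"
    by (auto simp: eventually_at_top_linorder)
  define X where "X = Max {1, Y0, y1, y2, y3 / c, y4, K / (\<epsilon> * \<upsilon>)}"
  show ?thesis
    using eventually_ge_at_top[of X]
  proof eventually_elim
    case (elim x)
    then have x: "1 \<le> x" "Y0 \<le> x" "y1 \<le> x" "y2 \<le> x" "y3 / c \<le> x" "y4 \<le> x" "K / (\<epsilon> * \<upsilon>) \<le> x"
      unfolding X_def by simp_all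
    have "0 < x" using x by simp
    have small: "K / (\<epsilon> * x) \<le> \<upsilon>" using x \<epsilon> \<upsilon> \<open>0 < x\<close> by (simp add: field_simps)
    show ?case
    proof (intro allI impI)
      fix n :: nat assume "1 \<le> n"
      have up: "gw_up n x \<le> (1 + (\<Sum>l<n. trunc_sq (c * (m ^ (l + 1) * x)) / m ^ (l + 2))) / x\<^sup>2
        + (\<Sum>l<n. m ^ l * (Fbar F (t * (m ^ (l + 1) * x)) + Fbar F (c * (m ^ (l + 1) * x)) * (\<upsilon> + K / (\<epsilon> * x) + \<upsilon>)))"
        unfolding \<epsilon>(2)[symmetric]
        using \<open>0 < x\<close> \<epsilon>(1) K \<upsilon> x(2) by (intro gw_up_le_sum Y0(2)) (auto simp: less_imp_le)
      \<comment> \<open>The term \<open>1 / x\<^sup>2\<close> is compared with the summand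
        \<open>i = 0\<close>, present because \<open>1 \<le> n\<close>.\<close>
      have first: "1 / x\<^sup>2 \<le> e / 4 * jump_sum n x"
      proof -
        have "x \<le> m * x" using level_ge[OF \<open>0 < x\<close>, of 1] by simp
        then have "4 * m\<^sup>2 / e \<le> (m * x)\<^sup>2 * Fbar F (m * x)" using x(6) by (intro y4) linarith
        then have "m\<^sup>2 * (4 / e) \<le> m\<^sup>2 * (x\<^sup>2 * Fbar F (m * x))" by (simp add: power_mult_distrib mult_ac)
        then have "4 / e \<le> x\<^sup>2 * Fbar F (m * x)" by (rule mult_left_le_imp_le) simp
        then have "1 / x\<^sup>2 \<le> e / 4 * Fbar F (m * x)" using assms \<open>0 < x\<close> by (simp add: field_simps)
        also have "Fbar F (m * x) \<le> jump_sum n x"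
        proof -
          have "(\<Sum>i\<in>{0}. m ^ i * Fbar F (m ^ (i + 1) * x)) \<le> jump_sum n x"
            unfolding jump_sum_def using \<open>1 \<le> n\<close> by (intro sum_mono2) (auto intro: mult_nonneg_nonneg Fbar_nonneg)
          then show ?thesis by simp
        qed
        finally show ?thesis using assms by simp
      qed
      have Y: "y1 \<le> m ^ (l + 1) * x" "y2 \<le> m ^ (l + 1) * x" "y3 \<le> c * (m ^ (l + 1) * x)" for l
      proof -
        have z: "x \<le> m ^ (l + 1) * x" by (rule level_ge[OF \<open>0 < x\<close>])
        show "y1 \<le> m ^ (l + 1) * x" "y2 \<le> m ^ (l + 1) * x" using x(3,4) z by linarith+
        have "y3 \<le> c * x" using x(5) c by (simp add: field_simps)
        also have "\<dots> \<le> c * (m ^ (l + 1) * x)" using z c by (intro mult_left_mono) auto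
        finally show "y3 \<le> c * (m ^ (l + 1) * x)" .
      qed
      have second: "(\<Sum>l<n. trunc_sq (c * (m ^ (l + 1) * x)) / m ^ (l + 2)) / x\<^sup>2 \<le> e / 4 * jump_sum n x"
        unfolding jump_sum_def sum_divide_distrib sum_distrib_left
      proof (intro sum_mono)
        fix l
        let ?Y = "m ^ (l + 1) * x"
        have "trunc_sq (c * ?Y) \<le> 13 * ((c * ?Y)\<^sup>2 * Fbar F (c * ?Y))" by (rule y3[OF Y(3)])
        also have "\<dots> \<le> 13 * ((c * ?Y)\<^sup>2 * (2 / c * Fbar F ?Y))" by (intro mult_left_mono y2 Y) auto
        also have "\<dots> = m ^ (l + 2) * x\<^sup>2 * (e / 4 * (m ^ l * Fbar F ?Y))"
          using c by (simp add: c_def power2_eq_square field_simps)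
        finally show "trunc_sq (c * ?Y) / m ^ (l + 2) / x\<^sup>2 \<le> e / 4 * (m ^ l * Fbar F ?Y)"
          using \<open>0 < x\<close> by (simp add: divide_le_eq mult_ac)
      qed
      have third: "(\<Sum>l<n. m ^ l * (Fbar F (t * (m ^ (l + 1) * x)) + Fbar F (c * (m ^ (l + 1) * x)) * (\<upsilon> + K / (\<epsilon> * x) + \<upsilon>))) \<le> (1 + e / 2) * jump_sum n x"
        unfolding jump_sum_def sum_distrib_left
      proof (intro sum_mono)
        fix l
        let ?Y = "m ^ (l + 1) * x"
        have "Fbar F (c * ?Y) * (\<upsilon> + K / (\<epsilon> * x) + \<upsilon>) \<le> (2 / c * Fbar F ?Y) * (3 * \<upsilon>)"
          using small \<upsilon> K \<epsilon> \<open>0 < x\<close> c Fbar_nonneg by (intro mult_mono y2 Y) auto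
        also have "\<dots> = e / 4 * Fbar F ?Y" using c by (simp add: \<upsilon>_def)
        finally have "Fbar F (t * ?Y) + Fbar F (c * ?Y) * (\<upsilon> + K / (\<epsilon> * x) + \<upsilon>) \<le> (1 + e / 4) * Fbar F ?Y + e / 4 * Fbar F ?Y"
          by (rule add_mono[OF y1[OF Y(1)]])
        also have "\<dots> = (1 + e / 2) * Fbar F ?Y" by (simp add: algebra_simps)
        finally have "m ^ l * (Fbar F (t * ?Y) + Fbar F (c * ?Y) * (\<upsilon> + K / (\<epsilon> * x) + \<upsilon>)) \<le> m ^ l * ((1 + e / 2) * Fbar F ?Y)"
          by (intro mult_left_mono) auto
        then show "m ^ l * (Fbar F (t * ?Y) + Fbar F (c * ?Y) * (\<upsilon> + K / (\<epsilon> * x) + \<upsilon>)) \<le> (1 + e / 2) * (m ^ l * Fbar F ?Y)"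
          by (simp add: mult_ac)
      qed
      show "gw_up n x \<le> (1 + e) * jump_sum n x"
        using up first second third by (simp add: add_divide_distrib algebra_simps)
    qed
  qed
qed

end

section \<open>The process and its almost sure limit\<close>

lemma GW_cong:
  assumes "\<And>i j. j < n \<Longrightarrow> X i j \<omega> = Y i j \<omega>'"
  shows "GW X n \<omega> = GW Y n \<omega>'"
  using assms by (induction n) auto

lemma measurable_add_count_space:
  fixes f g :: "'a \<Rightarrow> nat"
  assumes "f \<in> measurable N (count_space UNIV)" "g \<in> measurable N (count_space UNIV)"
  shows "(\<lambda>\<omega>. f \<omega> + g \<omega>) \<in> measurable N (count_space UNIV)"
  by (rule measurable_compose_countable[where f="\<lambda>k \<omega>. k + g \<omega>", OF _ assms(1)])
     (rule measurable_compose[OF assms(2)], simp)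

lemma measurable_sum_count_space:
  fixes f :: "nat \<Rightarrow> 'a \<Rightarrow> nat"
  assumes "\<And>i. f i \<in> measurable N (count_space UNIV)"
  shows "(\<lambda>\<omega>. \<Sum>i=1..k. f i \<omega>) \<in> measurable N (count_space UNIV)"
proof (induction k)
  case (Suc k)
  from measurable_add_count_space[OF this assms[of "Suc k"]] show ?case by simp
qed simp

text \<open>The number of summands is random but takes countably many values, and for each fixed
  value the sum is measurable. Stated for arbitrary \<open>X\<close>, so that it also applies to
  coordinates of a product space.\<close>

lemma measurable_GW:
  assumes "\<And>i j. j < n \<Longrightarrow> X i j \<in> measurable N (count_space UNIV)"
  shows "GW X n \<in> measurable N (count_space UNIV)"
  using assms
proof (induction n)
  case 0
  have "GW X 0 = (\<lambda>_. 1)" by auto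
  then show ?case by simp
next
  case (Suc n)
  have "GW X (Suc n) = (\<lambda>\<omega>. \<Sum>i=1..GW X n \<omega>. X i n \<omega>)" by auto
  moreover have "(\<lambda>\<omega>. \<Sum>i=1..GW X n \<omega>. X i n \<omega>) \<in> measurable N (count_space UNIV)"
  proof (rule measurable_compose_countable[where f="\<lambda>k \<omega>. \<Sum>i=1..k. X i n \<omega>"])
    show "(\<lambda>\<omega>. \<Sum>i=1..k. X i n \<omega>) \<in> measurable N (count_space UNIV)" for k
      by (rule measurable_sum_count_space) (rule Suc.prems, simp)
    show "GW X n \<in> measurable N (count_space UNIV)"
      by (rule Suc.IH) (rule Suc.prems, simp)
  qed
  ultimately show ?case by (simp only:)
qed

lemma distr_eq_pmfI:
  fixes p :: "'b::countable pmf"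
  assumes "prob_space M" "X \<in> measurable M (count_space UNIV)" "\<And>a. measure M (X -` {a} \<inter> space M) = pmf p a"
  shows "distr M (count_space UNIV) X = measure_pmf p"
proof (rule measure_eqI_countable[where A=UNIV])
  interpret prob_space M by fact
  fix a
  show "emeasure (distr M (count_space UNIV) X) {a} = emeasure (measure_pmf p) {a}"
    using assms by (simp add: emeasure_distr emeasure_eq_measure emeasure_pmf_single)
qed simp_all

lemma pmf_eq_prob_distr:
  assumes "distr M (count_space UNIV) X = measure_pmf p" "X \<in> measurable M (count_space UNIV)"
  shows "measure M (X -` {a} \<inter> space M) = pmf p a"
  using assms by (simp add: measure_pmf_single[symmetric] measure_distr flip: assms(1))

lemma (in prob_space) indep_add_pmf:
  fixes X Y :: "'a \<Rightarrow> nat"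
  assumes ind: "indep_var (count_space UNIV) X (count_space UNIV) Y"
    and X: "distr M (count_space UNIV) X = measure_pmf p" and Y: "distr M (count_space UNIV) Y = measure_pmf q"
  shows "distr M (count_space UNIV) (\<lambda>\<omega>. X \<omega> + Y \<omega>) = measure_pmf (bind_pmf p (\<lambda>a. map_pmf ((+) a) q))"
proof -
  have mX: "X \<in> measurable M (count_space UNIV)" and mY: "Y \<in> measurable M (count_space UNIV)"
    using indep_var_rv1[OF ind] indep_var_rv2[OF ind] by auto
  have mXY: "(\<lambda>\<omega>. (X \<omega>, Y \<omega>)) \<in> measurable M (count_space UNIV)"
    using measurable_Pair[OF mX mY] by (simp add: pair_measure_countable)
  have "distr M (count_space UNIV) (\<lambda>\<omega>. (X \<omega>, Y \<omega>)) = measure_pmf (pair_pmf p q)"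
  proof (rule distr_eq_pmfI[OF prob_space_axioms mXY])
    fix ab :: "nat \<times> nat"
    obtain a b where ab: "ab = (a, b)" by (cases ab)
    have "prob ((\<lambda>\<omega>. (X \<omega>, Y \<omega>)) -` ({a} \<times> {b}) \<inter> space M) = pmf p a * pmf q b"
      using indep_varD[OF ind, of "{a}" "{b}"] pmf_eq_prob_distr[OF X mX] pmf_eq_prob_distr[OF Y mY] by simp
    then show "prob ((\<lambda>\<omega>. (X \<omega>, Y \<omega>)) -` {ab} \<inter> space M) = pmf (pair_pmf p q) ab"
      by (simp add: ab pmf_pair)
  qed
  then have "distr (distr M (count_space UNIV) (\<lambda>\<omega>. (X \<omega>, Y \<omega>))) (count_space UNIV) (\<lambda>(a, b). a + b)
    = measure_pmf (map_pmf (\<lambda>(a, b). a + b) (pair_pmf p q))"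
    by (simp add: map_pmf_rep_eq)
  moreover have "map_pmf (\<lambda>(a, b). a + b) (pair_pmf p q) = bind_pmf p (\<lambda>a. map_pmf ((+) a) q)"
    by (simp add: pair_pmf_def map_bind_pmf map_pmf_def bind_assoc_pmf bind_return_pmf)
  ultimately show ?thesis
    by (subst (asm) distr_distr[OF _ mXY]) (auto simp: o_def)
qed

text \<open>\<open>A\<close> is almost surely contained in the lower limit of the
  \<open>B n\<close>, the increasing union of the tail intersections \<open>D N\<close>, each of
  probability at most \<open>C\<close>.\<close>

lemma (in prob_space) prob_le_of_eventually:
  assumes A: "A \<in> events" and B: "\<And>n. B n \<in> events"
    and ev: "AE \<omega> in M. \<omega> \<in> A \<longrightarrow> eventually (\<lambda>n. \<omega> \<in> B n) sequentially"
    and C: "\<And>n. n0 \<le> n \<Longrightarrow> prob (B n) \<le> C"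
  shows "prob A \<le> C"
proof -
  define D where "D N = (\<Inter>n\<in>{N..}. B n)" for N :: nat
  have D: "D N \<in> events" for N unfolding D_def using B by (intro sets.countable_INT) auto
  have "incseq D" unfolding D_def incseq_def by (auto intro: order_trans)
  then have lim: "(\<lambda>N. prob (D N)) \<longlonglongrightarrow> prob (\<Union>N. D N)"
    using D by (intro finite_Lim_measure_incseq) auto
  have "prob (D N) \<le> C" for N
  proof -
    have "prob (D N) \<le> prob (B (max N n0))" unfolding D_def using B by (intro finite_measure_mono) auto
    also have "\<dots> \<le> C" by (intro C) simp
    finally show ?thesis .
  qed
  then have "prob (\<Union>N. D N) \<le> C" by (intro LIMSEQ_le_const2[OF lim]) auto
  moreover have "prob A \<le> prob (\<Union>N. D N)"
  proof (rule finite_measure_mono_AE)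
    show "AE \<omega> in M. \<omega> \<in> A \<longrightarrow> \<omega> \<in> (\<Union>N. D N)"
      using ev by eventually_elim (auto simp: D_def eventually_sequentially)
    show "(\<Union>N. D N) \<in> events" using D by auto
  qed
  ultimately show ?thesis by linarith
qed

locale gw_process = supercritical_offspring F m + prob_space M
  for F m and M :: "'a measure" +
  fixes xi :: "nat \<Rightarrow> nat \<Rightarrow> 'a \<Rightarrow> nat"
  assumes indep: "indep_vars (\<lambda>_. count_space UNIV) (\<lambda>p. xi (fst p) (snd p)) UNIV"
    and law: "\<And>i n. distr M (count_space UNIV) (xi i n) = measure_pmf F"
begin

lemma measurable_xi [measurable]: "xi i n \<in> measurable M (count_space UNIV)"
  using indep unfolding indep_vars_def by (metis UNIV_I fst_conv snd_conv)

lemma measurable_GW_xi [measurable]: "GW xi n \<in> measurable M (count_space UNIV)"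
  by (intro measurable_GW measurable_xi)

lemma indep_functions:
  assumes "A \<inter> B = {}"
    and "f \<in> measurable (PiM A (\<lambda>_. count_space UNIV)) (count_space UNIV)"
    and "g \<in> measurable (PiM B (\<lambda>_. count_space UNIV)) (count_space UNIV)"
  shows "indep_var (count_space UNIV) (\<lambda>\<omega>. f (\<lambda>p\<in>A. xi (fst p) (snd p) \<omega>)) (count_space UNIV) (\<lambda>\<omega>. g (\<lambda>p\<in>B. xi (fst p) (snd p) \<omega>))"
  using indep_var_compose[OF indep_var_restrict[OF indep assms(1)] assms(2,3)] by (simp add: o_def)

lemma law_sum: "distr M (count_space UNIV) (\<lambda>\<omega>. \<Sum>i=1..k. xi i n \<omega>) = measure_pmf (sum_iid_pmf F k)"
proof (induction k)
  case 0
  show ?case by (intro distr_eq_pmfI prob_space_axioms) (auto simp: indicator_def prob_space)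
next
  case (Suc k)
  let ?A = "{(Suc k, n)}" and ?B = "{1..k} \<times> {n}"
  \<comment> \<open>The default 0 outside \<open>1..k\<close> makes the summand measurable on the
    product over \<open>?B\<close> for every \<open>i\<close>, also where \<open>(i, n)\<close> is
    not a coordinate.\<close>
  have "indep_var (count_space UNIV) (\<lambda>\<omega>. (\<lambda>w. w (Suc k, n)) (\<lambda>p\<in>?A. xi (fst p) (snd p) \<omega>))
    (count_space UNIV) (\<lambda>\<omega>. (\<lambda>w. \<Sum>i=1..k. if i \<le> k \<and> 1 \<le> i then w (i, n) else 0) (\<lambda>p\<in>?B. xi (fst p) (snd p) \<omega>))"
  proof (intro indep_functions measurable_sum_count_space)
    show "(\<lambda>w. w (Suc k, n)) \<in> measurable (PiM ?A (\<lambda>_. count_space UNIV)) (count_space (UNIV :: nat set))"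
      by (intro measurable_component_singleton) simp
    show "(\<lambda>w. if i \<le> k \<and> 1 \<le> i then w (i, n) else 0) \<in> measurable (PiM ?B (\<lambda>_. count_space UNIV)) (count_space (UNIV :: nat set))" for i
    proof (cases "i \<le> k \<and> 1 \<le> i")
      case True
      then have "(\<lambda>w. w (i, n)) \<in> measurable (PiM ?B (\<lambda>_. count_space UNIV)) (count_space (UNIV :: nat set))"
        by (intro measurable_component_singleton) simp
      with True show ?thesis by simp
    qed auto
  qed auto
  then have "indep_var (count_space UNIV) (xi (Suc k) n) (count_space UNIV) (\<lambda>\<omega>. \<Sum>i=1..k. xi i n \<omega>)"
    by simp
  from indep_add_pmf[OF this law Suc] show ?case by (simp add: add.commute)
qed

text \<open>Generation \<open>n\<close> is a function of the variables with second index below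
  \<open>n\<close>, the sum of those with second index \<open>n\<close>. Rebuilding
  \<open>GW\<close> from the coordinates of the product space makes this dependence
  explicit.\<close>

lemma indep_GW_sum: "indep_var (count_space UNIV) (GW xi n) (count_space UNIV) (\<lambda>\<omega>. \<Sum>i=1..k. xi i n \<omega>)"
proof -
  let ?A = "UNIV \<times> {..<n}" and ?B = "UNIV \<times> {n}"
  have "indep_var (count_space UNIV) (\<lambda>\<omega>. (\<lambda>w. GW (\<lambda>i j w. w (i, j)) n w) (\<lambda>p\<in>?A. xi (fst p) (snd p) \<omega>))
    (count_space UNIV) (\<lambda>\<omega>. (\<lambda>w. \<Sum>i=1..k. w (i, n)) (\<lambda>p\<in>?B. xi (fst p) (snd p) \<omega>))"
    by (intro indep_functions measurable_sum_count_space measurable_GW measurable_component_singleton) auto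
  moreover have "GW (\<lambda>i j w. w (i, j)) n (\<lambda>p\<in>?A. xi (fst p) (snd p) \<omega>) = GW xi n \<omega>" for \<omega>
    by (rule GW_cong) simp
  ultimately show ?thesis by simp
qed

text \<open>The joint law is needed because the increments of \<open>W_n\<close> involve two
  generations. The law of \<open>GW xi n\<close> is an assumption here so that the same lemma drives
  the induction for \<open>law_GW\<close>.\<close>

lemma law_GW_pair_if:
  assumes "distr M (count_space UNIV) (GW xi n) = measure_pmf p"
  shows "distr M (count_space UNIV) (\<lambda>\<omega>. (GW xi n \<omega>, GW xi (Suc n) \<omega>)) = measure_pmf (bind_pmf p (\<lambda>k. map_pmf (Pair k) (sum_iid_pmf F k)))"
proof (rule distr_eq_pmfI[OF prob_space_axioms])
  show "(\<lambda>\<omega>. (GW xi n \<omega>, GW xi (Suc n) \<omega>)) \<in> measurable M (count_space UNIV)"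
    using measurable_Pair[OF measurable_GW_xi measurable_GW_xi] by (simp add: pair_measure_countable del: GW.simps)
  fix ks :: "nat \<times> nat"
  obtain k s where ks: "ks = (k, s)" by (cases ks)
  \<comment> \<open>On the event that generation \<open>n\<close> equals \<open>k\<close>, the
    random upper limit of the sum may be replaced by the constant \<open>k\<close>; then
    independence applies.\<close>
  have "(\<lambda>\<omega>. (GW xi n \<omega>, GW xi (Suc n) \<omega>)) -` {ks} \<inter> space M = (\<lambda>\<omega>. (GW xi n \<omega>, \<Sum>i=1..k. xi i n \<omega>)) -` ({k} \<times> {s}) \<inter> space M"
    unfolding ks by auto
  then have "prob ((\<lambda>\<omega>. (GW xi n \<omega>, GW xi (Suc n) \<omega>)) -` {ks} \<inter> space M) = pmf p k * pmf (sum_iid_pmf F k) s"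
    using indep_varD[OF indep_GW_sum, of "{k}" "{s}" n k] pmf_eq_prob_distr[OF assms measurable_GW_xi]
      pmf_eq_prob_distr[OF law_sum measurable_sum_count_space[OF measurable_xi]] by simp
  moreover have "emeasure (bind_pmf p (\<lambda>k. map_pmf (Pair k) (sum_iid_pmf F k))) {(k, s)} = emeasure p {k} * emeasure (sum_iid_pmf F k) {s}"
  proof -
    have "emeasure (sum_iid_pmf F k') (Pair k' -` {(k, s)}) = indicator {k} k' * emeasure (sum_iid_pmf F k) {s}" for k'
      by (cases "k' = k") (auto simp: vimage_def)
    then show ?thesis by (simp add: nn_integral_multc)
  qed
  ultimately show "prob ((\<lambda>\<omega>. (GW xi n \<omega>, GW xi (Suc n) \<omega>)) -` {ks} \<inter> space M) = pmf (bind_pmf p (\<lambda>k. map_pmf (Pair k) (sum_iid_pmf F k))) ks"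
    by (simp add: ks emeasure_pmf_single flip: ennreal_mult)
qed

lemma law_GW: "distr M (count_space UNIV) (GW xi n) = measure_pmf (gw_pmf F n)"
proof (induction n)
  case 0
  show ?case by (intro distr_eq_pmfI prob_space_axioms measurable_GW_xi) (auto simp: indicator_def prob_space)
next
  case (Suc n)
  let ?P = "\<lambda>\<omega>. (GW xi n \<omega>, GW xi (Suc n) \<omega>)"
  have mP: "?P \<in> measurable M (count_space UNIV)"
    using measurable_Pair[OF measurable_GW_xi measurable_GW_xi] by (simp add: pair_measure_countable del: GW.simps)
  have "distr M (count_space UNIV) (GW xi (Suc n)) = distr (distr M (count_space UNIV) ?P) (count_space UNIV) snd"
    by (subst distr_distr[OF _ mP]) (simp_all add: o_def del: GW.simps)
  also have "\<dots> = measure_pmf (map_pmf snd (bind_pmf (gw_pmf F n) (\<lambda>k. map_pmf (Pair k) (sum_iid_pmf F k))))"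
    unfolding law_GW_pair_if[OF Suc] by (simp add: map_pmf_rep_eq)
  also have "map_pmf snd (bind_pmf (gw_pmf F n) (\<lambda>k. map_pmf (Pair k) (sum_iid_pmf F k))) = gw_pmf F (Suc n)"
    unfolding gw_pmf_Suc_last by (simp add: map_bind_pmf pmf.map_comp o_def)
  finally show ?case .
qed

lemma measurable_GW_Wn [measurable]: "GW_Wn m xi n \<in> borel_measurable M"
proof -
  have "(\<lambda>\<omega>. real (GW xi n \<omega>) / m ^ n) \<in> borel_measurable M"
    by (rule measurable_compose[OF measurable_GW_xi]) simp
  then show ?thesis by (simp add: GW_Wn_def[abs_def])
qed

lemma measurable_GW_W [measurable]: "GW_W m xi \<in> borel_measurable M"
  unfolding GW_W_def[abs_def] by measurable

lemma prob_GW_Wn_greater: "prob {\<omega> \<in> space M. x < GW_Wn m xi n \<omega>} = gw_up n x"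
proof -
  have "{\<omega> \<in> space M. x < GW_Wn m xi n \<omega>} = GW xi n -` {k. m ^ n * x < real k} \<inter> space M"
    by (auto simp: GW_Wn_def field_simps)
  then show ?thesis
    unfolding gw_up_def law_GW[symmetric] by (simp add: measure_distr)
qed

text \<open>The expected absolute increments are summable, so by monotone convergence almost every
  path has absolutely summable increments. This also shows that \<open>lim\<close> in
  \<open>GW_W\<close> is a genuine limit almost everywhere.\<close>

lemma AE_GW_Wn_tendsto: "AE \<omega> in M. (\<lambda>n. GW_Wn m xi n \<omega>) \<longlonglongrightarrow> GW_W m xi \<omega>"
proof -
  let ?d = "\<lambda>n \<omega>. \<bar>GW_Wn m xi (Suc n) \<omega> - GW_Wn m xi n \<omega>\<bar>"
  have incr: "(\<integral>\<^sup>+\<omega>. ennreal (?d n \<omega>) \<partial>M) \<le> ennreal (increment_bound n)" for n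
  proof -
    let ?P = "\<lambda>\<omega>. (GW xi n \<omega>, GW xi (Suc n) \<omega>)"
    let ?f = "\<lambda>(k, s). ennreal \<bar>real s / m ^ Suc n - real k / m ^ n\<bar>"
    have mP: "?P \<in> measurable M (count_space UNIV)"
      using measurable_Pair[OF measurable_GW_xi measurable_GW_xi] by (simp add: pair_measure_countable del: GW.simps)
    have "(\<integral>\<^sup>+\<omega>. ennreal (?d n \<omega>) \<partial>M) = (\<integral>\<^sup>+\<omega>. ?f (?P \<omega>) \<partial>M)"
      by (simp add: GW_Wn_def del: GW.simps power_Suc)
    also have "\<dots> = (\<integral>\<^sup>+z. ?f z \<partial>distr M (count_space UNIV) ?P)"
      by (rule nn_integral_distr[symmetric, OF mP]) simp
    also have "\<dots> = (\<integral>\<^sup>+k. \<integral>\<^sup>+s. ennreal \<bar>real s / m ^ Suc n - real k / m ^ n\<bar> \<partial>sum_iid_pmf F k \<partial>gw_pmf F n)"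
      unfolding law_GW_pair_if[OF law_GW] by (simp del: power_Suc)
    also have "\<dots> \<le> ennreal (increment_bound n)" by (rule expected_increment_le)
    finally show ?thesis .
  qed
  have "(\<integral>\<^sup>+\<omega>. (\<Sum>n. ennreal (?d n \<omega>)) \<partial>M) = (\<Sum>n. \<integral>\<^sup>+\<omega>. ennreal (?d n \<omega>) \<partial>M)"
    by (intro nn_integral_suminf) measurable
  also have "\<dots> \<le> (\<Sum>n. ennreal (increment_bound n))"
    by (intro suminf_le incr) auto
  also have "\<dots> = ennreal (\<Sum>n. increment_bound n)"
    by (intro suminf_ennreal2 increment_bound_nonneg summable_increment_bound)
  finally have "(\<integral>\<^sup>+\<omega>. (\<Sum>n. ennreal (?d n \<omega>)) \<partial>M) \<noteq> \<infinity>"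
    by (auto simp: top_unique)
  then have "AE \<omega> in M. (\<Sum>n. ennreal (?d n \<omega>)) \<noteq> \<infinity>"
    by (intro nn_integral_PInf_AE) measurable
  then show ?thesis
  proof eventually_elim
    case (elim \<omega>)
    then have "summable (\<lambda>n. ?d n \<omega>)" by (intro summable_suminf_not_top) (auto simp: top_ennreal_def infinity_ennreal_def)
    then have "summable (\<lambda>n. GW_Wn m xi (Suc n) \<omega> - GW_Wn m xi n \<omega>)" by (rule summable_rabs_cancel)
    then have "convergent (\<lambda>n. GW_Wn m xi n \<omega> - GW_Wn m xi 0 \<omega>)"
      by (simp add: summable_iff_convergent sum_lessThan_telescope[of "\<lambda>n. GW_Wn m xi n \<omega>"])
    from convergent_add[OF this convergent_const[of "GW_Wn m xi 0 \<omega>"]]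
    have "convergent (\<lambda>n. GW_Wn m xi n \<omega>)" by simp
    then show ?case unfolding GW_W_def by (simp add: convergent_LIMSEQ_iff)
  qed
qed

lemma prob_GW_W_le:
  assumes "\<And>n. 1 \<le> n \<Longrightarrow> gw_up n x \<le> C"
  shows "prob {\<omega> \<in> space M. x < GW_W m xi \<omega>} \<le> C"
proof (rule prob_le_of_eventually)
  show "AE \<omega> in M. \<omega> \<in> {\<omega> \<in> space M. x < GW_W m xi \<omega>} \<longrightarrow> eventually (\<lambda>n. \<omega> \<in> {\<omega> \<in> space M. x < GW_Wn m xi n \<omega>}) sequentially"
    using AE_GW_Wn_tendsto
  proof eventually_elim
    case (elim \<omega>)
    show ?case using order_tendstoD(1)[OF elim, of x] by (auto elim: eventually_mono)
  qed
  show "prob {\<omega> \<in> space M. x < GW_Wn m xi n \<omega>} \<le> C" if "1 \<le> n" for n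
    unfolding prob_GW_Wn_greater by (rule assms[OF that])
qed measurable

text \<open>\<open>W \<le> x\<close> forces \<open>W_n < y\<close> eventually only for
  \<open>y > x\<close>; the gap avoids any question of atoms of \<open>W\<close> at
  \<open>x\<close>.\<close>

lemma prob_GW_W_ge:
  assumes "\<And>n. n0 \<le> n \<Longrightarrow> C \<le> gw_up n y" "x < y"
  shows "C \<le> prob {\<omega> \<in> space M. x < GW_W m xi \<omega>}"
proof -
  have "prob {\<omega> \<in> space M. GW_W m xi \<omega> \<le> x} \<le> 1 - C"
  proof (rule prob_le_of_eventually)
    show "AE \<omega> in M. \<omega> \<in> {\<omega> \<in> space M. GW_W m xi \<omega> \<le> x} \<longrightarrow> eventually (\<lambda>n. \<omega> \<in> {\<omega> \<in> space M. GW_Wn m xi n \<omega> \<le> y}) sequentially"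
      using AE_GW_Wn_tendsto
    proof eventually_elim
      case (elim \<omega>)
      show ?case
      proof
        assume "\<omega> \<in> {\<omega> \<in> space M. GW_W m xi \<omega> \<le> x}"
        then have "eventually (\<lambda>n. GW_Wn m xi n \<omega> < y) sequentially"
          using \<open>x < y\<close> by (intro order_tendstoD(2)[OF elim]) auto
        then show "eventually (\<lambda>n. \<omega> \<in> {\<omega> \<in> space M. GW_Wn m xi n \<omega> \<le> y}) sequentially"
          by eventually_elim (use \<open>\<omega> \<in> _\<close> in auto)
      qed
    qed
    fix n assume "n0 \<le> n"
    have "prob {\<omega> \<in> space M. GW_Wn m xi n \<omega> \<le> y} = 1 - gw_up n y"
      unfolding prob_GW_Wn_greater[symmetric]
      by (subst prob_compl[symmetric]) (auto intro!: arg_cong[where f=prob])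
    then show "prob {\<omega> \<in> space M. GW_Wn m xi n \<omega> \<le> y} \<le> 1 - C" using assms(1)[OF \<open>n0 \<le> n\<close>] by simp
  qed measurable
  moreover have "prob {\<omega> \<in> space M. GW_W m xi \<omega> \<le> x} = 1 - prob {\<omega> \<in> space M. x < GW_W m xi \<omega>}"
    by (subst prob_compl[symmetric]) (auto intro!: arg_cong[where f=prob])
  ultimately show ?thesis by simp
qed

end

section \<open>Integral form and the main theorem\<close>

lemma borel_measurable_Fbar [measurable]: "Fbar F \<in> borel_measurable borel"
proof -
  have "mono (\<lambda>x. - Fbar F x)" by (simp add: mono_def Fbar_antimono)
  from borel_measurable_uminus[OF borel_measurable_mono[OF this]] show ?thesis by simp
qed

lemma Fbar_le_1: "Fbar F x \<le> 1"
  by (simp add: Fbar_def)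

text \<open>The interval integral written with an indicator, so that splitting, rescaling and limit
  theorems apply without orientation of the endpoints.\<close>

definition tail_integral :: "nat pmf \<Rightarrow> real \<Rightarrow> real \<Rightarrow> real" where
  "tail_integral F a b = (\<integral>u. indicator {a<..b} u * Fbar F u \<partial>lborel)"

lemma integrable_indicator_Ioc: "integrable lborel (indicator {a<..b::real} :: real \<Rightarrow> real)"
  by (rule integrable_real_indicator, simp) (cases "a \<le> b", simp_all)

lemma integrable_tail_integral: "integrable lborel (\<lambda>u. indicator {a<..b::real} u * Fbar F u)"
proof (rule Bochner_Integration.integrable_bound)
  show "integrable lborel (indicator {a<..b} :: real \<Rightarrow> real)" by (rule integrable_indicator_Ioc)
  show "AE u in lborel. norm (indicator {a<..b} u * Fbar F u) \<le> norm (indicator {a<..b} u :: real)"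
    using Fbar_le_1 Fbar_nonneg by (auto simp: indicator_def)
qed measurable

lemma interval_integral_Fbar: "a \<le> b \<Longrightarrow> (LBINT u=ereal a..ereal b. Fbar F u) = tail_integral F a b"
  by (simp add: interval_integral_Ioc tail_integral_def set_lebesgue_integral_def)

lemma tail_integral_add:
  assumes "a \<le> b" "b \<le> c"
  shows "tail_integral F a c = tail_integral F a b + tail_integral F b c"
proof -
  have "tail_integral F a c = (\<integral>u. indicator {a<..b} u * Fbar F u + indicator {b<..c} u * Fbar F u \<partial>lborel)"
    unfolding tail_integral_def using assms by (intro Bochner_Integration.integral_cong) (auto simp: indicator_def)
  also have "\<dots> = tail_integral F a b + tail_integral F b c"
    unfolding tail_integral_def by (intro Bochner_Integration.integral_add integrable_tail_integral)
  finally show ?thesis .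
qed

lemma tail_integral_nonneg: "0 \<le> tail_integral F a b"
  unfolding tail_integral_def by (intro integral_nonneg_AE AE_I2) (simp add: Fbar_nonneg)

lemma tail_integral_scale:
  assumes "0 < Y"
  shows "tail_integral F (a * Y) (b * Y) = Y * (\<integral>t. indicator {a<..b} t * Fbar F (t * Y) \<partial>lborel)"
proof -
  have "tail_integral F (a * Y) (b * Y) = Y * (\<integral>t. indicator {a * Y<..b * Y} (0 + Y * t) * Fbar F (0 + Y * t) \<partial>lborel)"
    unfolding tail_integral_def using assms by (subst lborel_integral_real_affine[where c=Y and t=0]) simp_all
  also have "(\<lambda>t. indicator {a * Y<..b * Y} (0 + Y * t) * Fbar F (0 + Y * t)) = (\<lambda>t. indicator {a<..b} t * Fbar F (t * Y))"
    using assms by (auto simp: indicator_def fun_eq_iff mult.commute[of Y])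
  finally show ?thesis .
qed

lemma le_double_of_abs_diff_le: "\<bar>s - i\<bar> \<le> 1 / 2 * i \<Longrightarrow> i \<le> 2 * s" for s i :: real
  by linarith

context heavy_offspring
begin

text \<open>Substituting \<open>u = t * Y\<close> turns the quotient into the integral of
  \<open>Fbar F (t * Y) / Fbar F Y\<close> over \<open>{1 / m<..1}\<close>, whose integrand tends to
  \<open>1 / t\<close>; the integral of \<open>1 / t\<close> is \<open>ln m\<close>.\<close>

lemma tail_integral_ratio_tendsto:
  "((\<lambda>Y. tail_integral F (1 / m * Y) (1 * Y) / (Y * Fbar F Y)) \<longlongrightarrow> ln m) at_top"
proof -
  let ?A = "{1 / m<..1}"
  have inv_m: "0 < 1 / m" "1 / m \<le> 1" using m_gt_1 by simp_all
  have "((\<lambda>Y. \<integral>t. indicator ?A t * (Fbar F (t * Y) / Fbar F Y) \<partial>lborel) \<longlongrightarrow> (\<integral>t. indicator ?A t * (1 / t) \<partial>lborel)) at_top"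
  proof (rule integral_dominated_convergence_at_top[where w="\<lambda>t. indicator ?A t * (m + 1)"])
    show "AE t in lborel. ((\<lambda>Y. indicator ?A t * (Fbar F (t * Y) / Fbar F Y)) \<longlongrightarrow> indicator ?A t * (1 / t)) at_top"
    proof (rule AE_I2)
      fix t :: real
      show "((\<lambda>Y. indicator ?A t * (Fbar F (t * Y) / Fbar F Y)) \<longlongrightarrow> indicator ?A t * (1 / t)) at_top"
      proof (cases "t \<in> ?A")
        case True
        then have "1 / m < t" by simp
        with inv_m(1) have "0 < t" by (rule less_trans)
        then show ?thesis by (intro tendsto_mult tendsto_const Fbar_ratio_tendsto)
      qed simp
    qed
    \<comment> \<open>Monotonicity reduces the domination for all \<open>t\<close> in the interval
      to its left endpoint, where the limit \<open>m\<close> is below \<open>m + 1\<close>.\<close>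
    have "eventually (\<lambda>Y. Fbar F (1 / m * Y) \<le> (m + 1) * Fbar F Y) at_top"
      using inv_m by (intro Fbar_le_of_ratio) auto
    then show "eventually (\<lambda>Y. AE t in lborel. norm (indicator ?A t * (Fbar F (t * Y) / Fbar F Y)) \<le> indicator ?A t * (m + 1)) at_top"
      using eventually_gt_at_top[of 0]
    proof eventually_elim
      case (elim Y)
      have "Fbar F (t * Y) / Fbar F Y \<le> m + 1" if "t \<in> ?A" for t
      proof -
        have "Fbar F (t * Y) \<le> Fbar F (1 / m * Y)"
          using that elim by (intro Fbar_antimono mult_right_mono) auto
        then show ?thesis using elim Fbar_pos[of Y] by (simp add: divide_le_eq)
      qed
      then show ?case using Fbar_nonneg[of F] by (intro AE_I2) (auto simp: indicator_def)
    qed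
  qed (auto intro!: integrable_mult_left integrable_indicator_Ioc)
  also have "(\<integral>t. indicator ?A t * (1 / t) \<partial>lborel) = ln m"
  proof -
    have "(LBINT t=ereal (1 / m)..ereal 1. 1 / t) = ln 1 - ln (1 / m)"
      using inv_m by (intro interval_integral_FTC_finite)
        (auto dest!: less_le_trans[OF inv_m(1)] intro!: continuous_intros derivative_eq_intros simp: min_def max_def simp flip: has_real_derivative_iff_has_vector_derivative)
    then show ?thesis
      using inv_m by (simp add: interval_integral_Ioc set_lebesgue_integral_def ln_div)
  qed
  finally have lim: "((\<lambda>Y. \<integral>t. indicator ?A t * (Fbar F (t * Y) / Fbar F Y) \<partial>lborel) \<longlongrightarrow> ln m) at_top" .
  show ?thesis
  proof (rule Lim_transform_eventually[OF lim])
    show "eventually (\<lambda>Y. (\<integral>t. indicator ?A t * (Fbar F (t * Y) / Fbar F Y) \<partial>lborel) = tail_integral F (1 / m * Y) (1 * Y) / (Y * Fbar F Y)) at_top"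
      using eventually_gt_at_top[of 0]
    proof eventually_elim
      case (elim Y)
      have "(\<integral>t. indicator ?A t * (Fbar F (t * Y) / Fbar F Y) \<partial>lborel) = (\<integral>t. indicator ?A t * Fbar F (t * Y) / Fbar F Y \<partial>lborel)"
        by simp
      also have "\<dots> = (\<integral>t. indicator ?A t * Fbar F (t * Y) \<partial>lborel) / Fbar F Y"
        by (rule integral_divide_zero)
      finally show ?case unfolding tail_integral_scale[OF elim] using elim by simp
    qed
  qed
qed

text \<open>The integral over the block from \<open>m ^ i * x\<close> to
  \<open>m ^ (i + 1) * x\<close> is \<open>m * x * ln m\<close> times the \<open>i\<close>-th
  summand, with a relative error that is uniform in \<open>i\<close> since all blocks lie beyond
  \<open>x\<close>.\<close>

lemma jump_sum_approx_integral:
  assumes "0 < e"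
  shows "eventually (\<lambda>x. \<forall>n. \<bar>jump_sum n x - 1 / (m * ln m) * (1 / x) * tail_integral F x (m ^ n * x)\<bar>
    \<le> e * (1 / (m * ln m) * (1 / x) * tail_integral F x (m ^ n * x))) at_top"
proof -
  \<comment> \<open>The blocks give an error relative to the sum, while the claim is relative to the
    integral. With \<open>\<delta> \<le> 1 / 2\<close> the sum is at most twice the normalised
    integral, so \<open>2 * \<delta> \<le> e\<close> is what remains to be arranged.\<close>
  define \<delta> where "\<delta> = min (1 / 2) (e / 2)"
  have \<delta>: "0 < \<delta>" "\<delta> \<le> 1 / 2" "2 * \<delta> \<le> e" using assms by (auto simp: \<delta>_def)
  have lnm: "0 < ln m" using m_gt_1 by simp
  have "eventually (\<lambda>Y. dist (tail_integral F (1 / m * Y) (1 * Y) / (Y * Fbar F Y)) (ln m) < \<delta> * ln m) at_top"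
    using \<delta> lnm by (intro tendstoD[OF tail_integral_ratio_tendsto]) simp
  then obtain Y0 where Y0: "\<And>Y. Y0 \<le> Y \<Longrightarrow> dist (tail_integral F (1 / m * Y) (1 * Y) / (Y * Fbar F Y)) (ln m) < \<delta> * ln m"
    by (auto simp: eventually_at_top_linorder)
  show ?thesis
    using eventually_ge_at_top[of "max 1 Y0"]
  proof eventually_elim
    case (elim x)
    then have "0 < x" "Y0 \<le> x" by auto
    have block: "\<bar>tail_integral F (m ^ i * x) (m ^ (i + 1) * x) - ln m * m * x * (m ^ i * Fbar F (m ^ (i + 1) * x))\<bar>
      \<le> \<delta> * (ln m * m * x * (m ^ i * Fbar F (m ^ (i + 1) * x)))" for i
    proof -
      let ?Y = "m ^ (i + 1) * x"
      let ?P = "?Y * Fbar F ?Y"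
      have cancel: "(a / p - l) * p = a - l * p" if "p \<noteq> 0" for a p l :: real
        using that by (simp add: left_diff_distrib)
      have "Y0 \<le> ?Y" "0 < ?Y" using \<open>Y0 \<le> x\<close> \<open>0 < x\<close> level_ge[OF \<open>0 < x\<close>, of "i + 1"] by linarith+
      then have P: "0 < ?P" using Fbar_pos by simp
      have "tail_integral F (1 / m * ?Y) (1 * ?Y) = tail_integral F (m ^ i * x) ?Y" by simp
      then have "\<bar>tail_integral F (m ^ i * x) ?Y / ?P - ln m\<bar> \<le> \<delta> * ln m"
        using Y0[OF \<open>Y0 \<le> ?Y\<close>] by (simp add: dist_real_def)
      then have "\<bar>tail_integral F (m ^ i * x) ?Y / ?P - ln m\<bar> * ?P \<le> \<delta> * ln m * ?P"
        using P by (intro mult_right_mono) auto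
      also have "\<bar>tail_integral F (m ^ i * x) ?Y / ?P - ln m\<bar> * ?P = \<bar>(tail_integral F (m ^ i * x) ?Y / ?P - ln m) * ?P\<bar>"
        by (simp only: abs_mult[of _ ?P] abs_of_pos[OF P])
      also have "(tail_integral F (m ^ i * x) ?Y / ?P - ln m) * ?P = tail_integral F (m ^ i * x) ?Y - ln m * ?P"
        by (rule cancel[OF less_imp_neq[OF P, THEN not_sym]])
      finally show ?thesis by (simp add: mult_ac)
    qed
    show ?case
    proof
      fix n
      have split: "tail_integral F x (m ^ n * x) = (\<Sum>i<n. tail_integral F (m ^ i * x) (m ^ (i + 1) * x))"
      proof (induction n)
        case 0
        then show ?case by (simp add: tail_integral_def)
      next
        case (Suc n)
        have "m ^ n * x \<le> m ^ Suc n * x" using \<open>0 < x\<close> m_gt_1 by (intro mult_right_mono power_increasing) auto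
        then have "tail_integral F x (m ^ Suc n * x) = tail_integral F x (m ^ n * x) + tail_integral F (m ^ n * x) (m ^ Suc n * x)"
          by (intro tail_integral_add level_ge[OF \<open>0 < x\<close>])
        then show ?case using Suc by simp
      qed
      let ?I = "tail_integral F x (m ^ n * x)" and ?c = "ln m * m * x" and ?s = "jump_sum n x"
      have c: "0 < ?c" using lnm \<open>0 < x\<close> by simp
      have "\<bar>?I - ?c * ?s\<bar> = \<bar>\<Sum>i<n. tail_integral F (m ^ i * x) (m ^ (i + 1) * x) - ?c * (m ^ i * Fbar F (m ^ (i + 1) * x))\<bar>"
        unfolding split jump_sum_def sum_distrib_left sum_subtractf ..
      also have "\<dots> \<le> (\<Sum>i<n. \<delta> * (?c * (m ^ i * Fbar F (m ^ (i + 1) * x))))"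
        by (intro order_trans[OF sum_abs] sum_mono block)
      also have "\<dots> = \<delta> * (?c * ?s)" unfolding jump_sum_def sum_distrib_left ..
      finally have "\<bar>?I - ?c * ?s\<bar> \<le> \<delta> * (?c * ?s)" .
      moreover define g where "g = 1 / (m * ln m) * (1 / x) * ?I"
      have I: "?I = ?c * g" unfolding g_def using lnm \<open>0 < x\<close> by simp
      have "\<bar>?I - ?c * ?s\<bar> = ?c * \<bar>g - ?s\<bar>"
        unfolding I by (simp only: right_diff_distrib[symmetric] abs_mult[of ?c] abs_of_pos[OF c])
      ultimately have "?c * \<bar>g - ?s\<bar> \<le> ?c * (\<delta> * ?s)"
        by (simp only: mult.left_commute)
      then have gs: "\<bar>g - ?s\<bar> \<le> \<delta> * ?s" using c by (simp only: mult_le_cancel_left_pos)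
      moreover have "\<delta> * ?s \<le> 1 / 2 * ?s" using \<delta> jump_sum_nonneg by (intro mult_right_mono)
      ultimately have "?s \<le> 2 * g" by linarith
      then have "\<delta> * ?s \<le> \<delta> * (2 * g)" using \<delta> by (intro mult_left_mono) auto
      also have "\<dots> = 2 * \<delta> * g" by simp
      also have "\<dots> \<le> e * g"
      proof (rule mult_right_mono[OF \<delta>(3)])
        show "0 \<le> g" using \<open>?s \<le> 2 * g\<close> jump_sum_nonneg[of n x] by linarith
      qed
      finally show "\<bar>?s - 1 / (m * ln m) * (1 / x) * ?I\<bar> \<le> e * (1 / (m * ln m) * (1 / x) * ?I)"
        using gs unfolding g_def[symmetric] by linarith
    qed
  qed
qed

text \<open>The lower bound bounds half of every partial sum by a probability, so the partial sums
  never exceed 2.\<close>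

lemma summable_jump_sum:
  "eventually (\<lambda>x. summable (\<lambda>i. m ^ i * Fbar F (m ^ (i + 1) * x))) at_top"
proof -
  have "eventually (\<lambda>x. \<forall>n. (1 - 1 / 2) * jump_sum n x \<le> gw_up n x) at_top"
    by (rule gw_up_ge_jump_sum) simp
  then show ?thesis
  proof eventually_elim
    case (elim x)
    have "(\<Sum>i<n. m ^ i * Fbar F (m ^ (i + 1) * x)) \<le> 2" for n
    proof -
      have "gw_up n x \<le> 1" unfolding gw_up_def by simp
      with elim[rule_format, of n] show ?thesis unfolding jump_sum_def by simp
    qed
    then show ?case by (intro summableI_nonneg_bounded) (auto intro: mult_nonneg_nonneg Fbar_nonneg)
  qed
qed

text \<open>Monotone convergence along the endpoints \<open>m ^ n * x\<close>; the bound
  \<open>C\<close> provides the finite limit and hence integrability on the half-line.\<close>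

lemma tail_integral_tendsto:
  assumes "0 < x" "\<And>n. tail_integral F x (m ^ n * x) \<le> C"
  shows "(\<lambda>n. tail_integral F x (m ^ n * x)) \<longlonglongrightarrow> (LBINT u=ereal x..\<infinity>. Fbar F u)"
proof -
  let ?f = "\<lambda>n u. indicator {x<..m ^ n * x} u * Fbar F u"
  have incr: "m ^ i * x \<le> m ^ j * x" if "i \<le> j" for i j
    using that \<open>0 < x\<close> m_gt_1 by (intro mult_right_mono power_increasing) auto
  have "incseq (\<lambda>n. tail_integral F x (m ^ n * x))"
  proof (rule incseq_SucI)
    fix n
    show "tail_integral F x (m ^ n * x) \<le> tail_integral F x (m ^ Suc n * x)"
      using tail_integral_add[of x "m ^ n * x" "m ^ Suc n * x" F] level_ge[OF \<open>0 < x\<close>] incr[of n "Suc n"] tail_integral_nonneg[of F "m ^ n * x" "m ^ Suc n * x"]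
      by simp
  qed
  from incseq_convergent[OF this] obtain L where L: "(\<lambda>n. tail_integral F x (m ^ n * x)) \<longlonglongrightarrow> L"
    using assms(2) by blast
  have "(\<integral>u. indicator {x<..} u * Fbar F u \<partial>lborel) = L"
  proof (rule integral_monotone_convergence_nonneg(2))
    show "integrable lborel (?f n)" for n by (rule integrable_tail_integral)
    show "AE u in lborel. mono (\<lambda>n. ?f n u)"
      using incr Fbar_nonneg[of F] by (intro AE_I2) (auto simp: mono_def indicator_def intro: order_trans)
    show "AE u in lborel. 0 \<le> ?f n u" for n by (simp add: Fbar_nonneg)
    show "AE u in lborel. (\<lambda>n. ?f n u) \<longlonglongrightarrow> indicator {x<..} u * Fbar F u"
    proof (rule AE_I2)
      fix u :: real
      obtain N where N: "u / x < m ^ N" using real_arch_pow[OF m_gt_1] by blast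
      have "?f n u = indicator {x<..} u * Fbar F u" if "N \<le> n" for n
      proof -
        have "u \<le> m ^ N * x" using N \<open>0 < x\<close> by (simp add: field_simps)
        also have "\<dots> \<le> m ^ n * x" using that by (rule incr)
        finally show ?thesis by (simp add: indicator_def)
      qed
      then show "(\<lambda>n. ?f n u) \<longlonglongrightarrow> indicator {x<..} u * Fbar F u"
        by (intro tendsto_eventually) (auto simp: eventually_sequentially)
    qed
    show "(\<lambda>n. integral\<^sup>L lborel (?f n)) \<longlonglongrightarrow> L" using L unfolding tail_integral_def .
  qed measurable
  then show ?thesis
    using L by (simp add: interval_integral_to_infinity_eq set_lebesgue_integral_def)
qed

text \<open>The finite-\<open>n\<close> estimate is uniform in \<open>n\<close>, so \<open>n\<close>
  may tend to infinity at fixed \<open>x\<close>. The instance with error 1/2 only bounds the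
  integrals by a multiple of the series, which gives their convergence.\<close>

lemma suminf_approx_integral:
  assumes "0 < e"
  shows "eventually (\<lambda>x. \<bar>(\<Sum>i. m ^ i * Fbar F (m ^ (i + 1) * x)) - 1 / (m * ln m) * (1 / x) * (LBINT u=ereal x..\<infinity>. Fbar F u)\<bar>
    \<le> e * (1 / (m * ln m) * (1 / x) * (LBINT u=ereal x..\<infinity>. Fbar F u))) at_top"
  using jump_sum_approx_integral[OF assms] jump_sum_approx_integral[of "1/2", OF half_gt_zero[OF zero_less_one]] summable_jump_sum eventually_gt_at_top[of 0]
proof eventually_elim
  case (elim x)
  let ?S = "\<Sum>i. m ^ i * Fbar F (m ^ (i + 1) * x)"
  let ?k = "1 / (m * ln m) * (1 / x)"
  have k: "0 < ?k" using m_gt_1 elim by simp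
  have S: "(\<lambda>n. jump_sum n x) \<longlonglongrightarrow> ?S"
    unfolding jump_sum_def using elim by (intro summable_LIMSEQ)
  have "tail_integral F x (m ^ n * x) \<le> 2 * ?S / ?k" for n
  proof -
    have "jump_sum n x \<le> ?S" unfolding jump_sum_def
      using elim by (intro sum_le_suminf) (auto intro: mult_nonneg_nonneg Fbar_nonneg)
    have "\<bar>jump_sum n x - ?k * tail_integral F x (m ^ n * x)\<bar> \<le> 1 / 2 * (?k * tail_integral F x (m ^ n * x))"
      using elim by simp
    then have "?k * tail_integral F x (m ^ n * x) \<le> 2 * jump_sum n x"
      by (rule le_double_of_abs_diff_le)
    also have "\<dots> \<le> 2 * ?S" using \<open>jump_sum n x \<le> ?S\<close> by simp
    finally have "?k * tail_integral F x (m ^ n * x) \<le> 2 * ?S" .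
    then show ?thesis using k by (simp only: pos_le_divide_eq mult.commute)
  qed
  then have I: "(\<lambda>n. tail_integral F x (m ^ n * x)) \<longlonglongrightarrow> (LBINT u=ereal x..\<infinity>. Fbar F u)"
    using elim by (intro tail_integral_tendsto) auto
  show ?case
    using elim(1)
    by (intro LIMSEQ_le[OF tendsto_rabs[OF tendsto_diff[OF S tendsto_mult[OF tendsto_const I]]]
        tendsto_mult[OF tendsto_const tendsto_mult[OF tendsto_const I]]]) auto
qed

end

lemma asymp_equivI_real:
  fixes f g :: "real \<Rightarrow> real"
  assumes "\<And>e. 0 < e \<Longrightarrow> eventually (\<lambda>x. \<bar>f x - g x\<bar> \<le> e * \<bar>g x\<bar>) at_top"
  shows "f \<sim>[at_top] g"
  unfolding asymp_equiv_altdef by (rule landau_o.smallI) (use assms in simp)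

locale heavy_gw_process = heavy_offspring F m + gw_process F m M xi
  for F m and M :: "'a measure" and xi
begin

text \<open>The upper bound passes to the limit at the same level. The lower bound is applied at
  \<open>(1 + \<delta>) * x\<close>, and regular variation returns to the level \<open>x\<close> for
  one more factor \<open>1 - \<delta>\<close>.\<close>

lemma prob_GW_W_approx:
  assumes "0 < e"
  shows "eventually (\<lambda>x. \<bar>prob {\<omega> \<in> space M. x < GW_W m xi \<omega>} - (\<Sum>i. m ^ i * Fbar F (m ^ (i + 1) * x))\<bar>
    \<le> e * (\<Sum>i. m ^ i * Fbar F (m ^ (i + 1) * x))) at_top"
proof -
  define \<delta> where "\<delta> = min (1 / 2) (e / 2)"
  have \<delta>: "0 < \<delta>" "\<delta> < 1" "2 * \<delta> \<le> e" using assms by (auto simp: \<delta>_def)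
  have "1 - \<delta> < 1 / (1 + \<delta>)" using \<delta> by (simp add: field_simps)
  then have "eventually (\<lambda>y. (1 - \<delta>) * Fbar F y \<le> Fbar F ((1 + \<delta>) * y)) at_top"
    using \<delta> by (intro Fbar_ge_of_ratio) auto
  then obtain Y0 where Y0: "\<And>y. Y0 \<le> y \<Longrightarrow> (1 - \<delta>) * Fbar F y \<le> Fbar F ((1 + \<delta>) * y)"
    by (auto simp: eventually_at_top_linorder)
  obtain X0 where X0: "\<And>x n. X0 \<le> x \<Longrightarrow> (1 - \<delta>) * jump_sum n x \<le> gw_up n x"
    using gw_up_ge_jump_sum[OF \<delta>(1)] by (auto simp: eventually_at_top_linorder)
  show ?thesis
    using gw_up_le_jump_sum[OF assms] summable_jump_sum eventually_ge_at_top[of "max 1 (max X0 Y0)"]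
  proof eventually_elim
    case (elim x)
    then have x: "0 < x" "X0 \<le> x" "Y0 \<le> x" by auto
    let ?S = "\<Sum>i. m ^ i * Fbar F (m ^ (i + 1) * x)"
    let ?P = "prob {\<omega> \<in> space M. x < GW_W m xi \<omega>}"
    have le_S: "jump_sum n x \<le> ?S" for n unfolding jump_sum_def
      using elim by (intro sum_le_suminf) (auto intro: mult_nonneg_nonneg Fbar_nonneg)
    have S: "(\<lambda>n. jump_sum n x) \<longlonglongrightarrow> ?S"
      unfolding jump_sum_def using elim by (intro summable_LIMSEQ)
    have S0: "0 \<le> ?S" using le_S[of 0] by (simp add: jump_sum_def)
    have "?P \<le> (1 + e) * ?S"
    proof (rule prob_GW_W_le)
      fix n :: nat assume "1 \<le> n"
      then have "gw_up n x \<le> (1 + e) * jump_sum n x" using elim(1) by blast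
      also have "\<dots> \<le> (1 + e) * ?S" using le_S assms by (intro mult_left_mono) auto
      finally show "gw_up n x \<le> (1 + e) * ?S" .
    qed
    moreover have "(1 - e) * ?S \<le> ?P"
    proof -
      \<comment> \<open>A fixed partial sum is a lower bound for all \<open>n \<ge> n0\<close>, as
        the passage to \<open>W\<close> requires; only afterwards does \<open>n0\<close> tend to
        infinity.\<close>
      have "(1 - \<delta>) * ((1 - \<delta>) * jump_sum n0 x) \<le> ?P" for n0
      proof (rule prob_GW_W_ge[where y="(1 + \<delta>) * x"])
        show "x < (1 + \<delta>) * x" using x \<delta> by simp
        then have X: "X0 \<le> (1 + \<delta>) * x" using x by linarith
        fix n assume "n0 \<le> n"
        have "(1 - \<delta>) * jump_sum n0 x = (\<Sum>i<n0. m ^ i * ((1 - \<delta>) * Fbar F (m ^ (i + 1) * x)))"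
          unfolding jump_sum_def by (simp add: sum_distrib_left mult_ac)
        also have "\<dots> \<le> (\<Sum>i<n0. m ^ i * Fbar F ((1 + \<delta>) * (m ^ (i + 1) * x)))"
        proof (intro sum_mono mult_left_mono Y0)
          show "Y0 \<le> m ^ (i + 1) * x" for i using x level_ge[OF x(1), of "i + 1"] by linarith
        qed simp
        also have "\<dots> = jump_sum n0 ((1 + \<delta>) * x)" unfolding jump_sum_def by (simp add: mult_ac)
        also have "\<dots> \<le> jump_sum n ((1 + \<delta>) * x)" unfolding jump_sum_def
          using \<open>n0 \<le> n\<close> by (intro sum_mono2) (auto intro: mult_nonneg_nonneg Fbar_nonneg)
        finally have "(1 - \<delta>) * ((1 - \<delta>) * jump_sum n0 x) \<le> (1 - \<delta>) * jump_sum n ((1 + \<delta>) * x)"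
          using \<delta> by (intro mult_left_mono) auto
        also have "\<dots> \<le> gw_up n ((1 + \<delta>) * x)" by (rule X0[OF X])
        finally show "(1 - \<delta>) * ((1 - \<delta>) * jump_sum n0 x) \<le> gw_up n ((1 + \<delta>) * x)" .
      qed
      then have "(1 - \<delta>) * ((1 - \<delta>) * ?S) \<le> ?P"
        by (intro LIMSEQ_le_const2[OF tendsto_mult[OF tendsto_const tendsto_mult[OF tendsto_const S]]]) auto
      moreover have "(1 - e) * ?S \<le> (1 - \<delta>) * (1 - \<delta>) * ?S"
      proof (rule mult_right_mono[OF _ S0])
        have "(1 - \<delta>) * (1 - \<delta>) = 1 - 2 * \<delta> + \<delta> * \<delta>" by (simp add: algebra_simps)
        moreover have "0 \<le> \<delta> * \<delta>" by simp
        ultimately show "1 - e \<le> (1 - \<delta>) * (1 - \<delta>)" using \<delta>(3) by linarith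
      qed
      ultimately show ?thesis by (simp only: mult.assoc)
    qed
    ultimately show ?case by (simp add: abs_le_iff algebra_simps)
  qed
qed

end

theorem theorem4:
  fixes M :: "'a measure" and F :: "nat pmf" and xi :: "nat \<Rightarrow> nat \<Rightarrow> 'a \<Rightarrow> nat"
  assumes "prob_space M"
    and "prob_space.indep_vars M (\<lambda>_. count_space UNIV) (\<lambda>p. xi (fst p) (snd p)) UNIV"
    and "\<forall>i n. distr M (count_space UNIV) (xi i n) = measure_pmf F"
    and "integrable (measure_pmf F) real"
    and "offspring_mean F > 1"
    and "integrable (measure_pmf F) (\<lambda>k. real k * ln (real k))"
    and "regularly_varying_neg1 (Fbar F)"
  shows
    "unif_asymp_equiv
       (\<lambda>n x. measure M {\<omega> \<in> space M. GW_Wn (offspring_mean F) xi n \<omega> > x})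
       (\<lambda>n x. \<Sum>i<n. offspring_mean F ^ i * Fbar F (offspring_mean F ^ (i+1) * x)) \<and>
     unif_asymp_equiv
       (\<lambda>n x. \<Sum>i<n. offspring_mean F ^ i * Fbar F (offspring_mean F ^ (i+1) * x))
       (\<lambda>n x. 1 / (offspring_mean F * ln (offspring_mean F)) * (1 / x) *
              (LBINT u=ereal x..ereal (offspring_mean F ^ n * x). Fbar F u)) \<and>
     ((\<lambda>x. measure M {\<omega> \<in> space M. GW_W (offspring_mean F) xi \<omega> > x})
       \<sim>[at_top] (\<lambda>x. \<Sum>i. offspring_mean F ^ i * Fbar F (offspring_mean F ^ (i+1) * x))) \<and>
     ((\<lambda>x. \<Sum>i. offspring_mean F ^ i * Fbar F (offspring_mean F ^ (i+1) * x))
       \<sim>[at_top] (\<lambda>x. 1 / (offspring_mean F * ln (offspring_mean F)) * (1 / x) *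
              (LBINT u=ereal x..\<infinity>. Fbar F u)))"
proof -
  define m where "m = offspring_mean F"
  interpret prob_space M by fact
  interpret heavy_gw_process F m M xi
    using assms by unfold_locales (auto simp: m_def offspring_mean_def)
  have "unif_asymp_equiv (\<lambda>n x. measure M {\<omega> \<in> space M. GW_Wn m xi n \<omega> > x})
       (\<lambda>n x. \<Sum>i<n. m ^ i * Fbar F (m ^ (i+1) * x))"
    unfolding unif_asymp_equiv_def prob_GW_Wn_greater jump_sum_def[symmetric]
  proof (intro allI impI)
    fix e :: real assume "0 < e"
    show "eventually (\<lambda>x. \<forall>n\<ge>1. \<bar>gw_up n x - jump_sum n x\<bar> \<le> e * \<bar>jump_sum n x\<bar>) at_top"
      using gw_up_ge_jump_sum[OF \<open>0 < e\<close>] gw_up_le_jump_sum[OF \<open>0 < e\<close>]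
    proof eventually_elim
      case (elim x)
      show ?case
      proof (intro allI impI)
        fix n :: nat assume "1 \<le> n"
        then have "(1 - e) * jump_sum n x \<le> gw_up n x" "gw_up n x \<le> (1 + e) * jump_sum n x"
          using elim by blast+
        then show "\<bar>gw_up n x - jump_sum n x\<bar> \<le> e * \<bar>jump_sum n x\<bar>"
          using jump_sum_nonneg[of n x] by (simp add: abs_le_iff algebra_simps)
      qed
    qed
  qed
  moreover have "unif_asymp_equiv (\<lambda>n x. \<Sum>i<n. m ^ i * Fbar F (m ^ (i+1) * x))
       (\<lambda>n x. 1 / (m * ln m) * (1 / x) * (LBINT u=ereal x..ereal (m ^ n * x). Fbar F u))"
    unfolding unif_asymp_equiv_def jump_sum_def[symmetric]
  proof (intro allI impI)
    fix e :: real assume "0 < e"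
    show "eventually (\<lambda>x. \<forall>n\<ge>1. \<bar>jump_sum n x - 1 / (m * ln m) * (1 / x) * (LBINT u=ereal x..ereal (m ^ n * x). Fbar F u)\<bar>
      \<le> e * \<bar>1 / (m * ln m) * (1 / x) * (LBINT u=ereal x..ereal (m ^ n * x). Fbar F u)\<bar>) at_top"
      \<comment> \<open>Positivity of \<open>x\<close> gives \<open>x \<le> m ^ n * x\<close>, so
        that the oriented interval integral agrees with \<open>tail_integral\<close>.\<close>
      using jump_sum_approx_integral[OF \<open>0 < e\<close>] eventually_gt_at_top[of 0]
    proof eventually_elim
      case (elim x)
      show ?case
      proof (intro allI impI)
        fix n :: nat
        let ?g = "1 / (m * ln m) * (1 / x) * tail_integral F x (m ^ n * x)"
        have "\<bar>jump_sum n x - ?g\<bar> \<le> e * ?g" using elim by blast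
        also have "e * ?g \<le> e * \<bar>?g\<bar>" using \<open>0 < e\<close> by (intro mult_left_mono abs_ge_self) simp
        finally show "\<bar>jump_sum n x - 1 / (m * ln m) * (1 / x) * (LBINT u=ereal x..ereal (m ^ n * x). Fbar F u)\<bar>
          \<le> e * \<bar>1 / (m * ln m) * (1 / x) * (LBINT u=ereal x..ereal (m ^ n * x). Fbar F u)\<bar>"
          unfolding interval_integral_Fbar[OF level_ge[OF elim(2)]] .
      qed
    qed
  qed
  moreover have "(\<lambda>x. measure M {\<omega> \<in> space M. GW_W m xi \<omega> > x}) \<sim>[at_top] (\<lambda>x. \<Sum>i. m ^ i * Fbar F (m ^ (i+1) * x))"
  proof (rule asymp_equivI_real)
    fix e :: real assume "0 < e"
    from prob_GW_W_approx[OF this]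
    show "eventually (\<lambda>x. \<bar>prob {\<omega> \<in> space M. x < GW_W m xi \<omega>} - (\<Sum>i. m ^ i * Fbar F (m ^ (i + 1) * x))\<bar>
      \<le> e * \<bar>\<Sum>i. m ^ i * Fbar F (m ^ (i + 1) * x)\<bar>) at_top"
      by eventually_elim (use \<open>0 < e\<close> in \<open>meson abs_ge_self mult_left_mono less_imp_le order_trans\<close>)
  qed
  moreover have "(\<lambda>x. \<Sum>i. m ^ i * Fbar F (m ^ (i+1) * x)) \<sim>[at_top] (\<lambda>x. 1 / (m * ln m) * (1 / x) * (LBINT u=ereal x..\<infinity>. Fbar F u))"
  proof (rule asymp_equivI_real)
    fix e :: real assume "0 < e"
    from suminf_approx_integral[OF this]
    show "eventually (\<lambda>x. \<bar>(\<Sum>i. m ^ i * Fbar F (m ^ (i + 1) * x)) - 1 / (m * ln m) * (1 / x) * (LBINT u=ereal x..\<infinity>. Fbar F u)\<bar>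
      \<le> e * \<bar>1 / (m * ln m) * (1 / x) * (LBINT u=ereal x..\<infinity>. Fbar F u)\<bar>) at_top"
      by eventually_elim (use \<open>0 < e\<close> in \<open>meson abs_ge_self mult_left_mono less_imp_le order_trans\<close>)
  qed
  ultimately show ?thesis unfolding m_def by blast
qed

end
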